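(* Let $0<M_1<M_2$ and $R_2>R_1>2M_2$. For every $u\in\mathcal A_{BV}$, $$\mathcal I_{\mathrm{rel}}[u]=\mathcal J[u].$$ In particular, the infimum defining $\mathcal I_{\mathrm{rel}}[u]$ is over a nonempty set and is finite, and it is attained along a recovery sequence (i.e. there exist $u_n\in\mathcal A_\infty$ with $u_n\to u$ in $L^1(\mathbb R)$ and $\mathcal I[u_n]\to\mathcal J[u]$).
   Context: $\Delta M:=M_2-M_1$. For real $x$, $x_+=\max\{x,0\}$. $\mathcal A_\infty$: functions $u\in C^\infty(\mathbb R)$ with $u\ge0$, $\operatorname{supp}u\subset(R_1,R_2)$, $\int_{R_1}^{R_2}r^2u\,dr=1$. $\mathcal A_{BV}$: functions $u\in BV(\mathbb R)$ (so $u\in L^1(\mathbb R)$ and $Du$ is a finite signed Radon measure on $\mathbb R$) with $u\ge0$ a.e., $u=0$ a.e. on $\mathbb R\setminus[R_1,R_2]$, $\int_{R_1}^{R_2}r^2u\,dr=1$. $Du=(Du)^+-(Du)^-$ is the Jordan decomposition. For $u$ in either class: $P_u(r)=\int_{R_1}^r s^2u(s)\,ds$, $m_u=M_1+\Delta M\,P_u$, $F_u(r)=1-2m_u(r)/r$ on $[R_1,R_2]$ (so $F_u\ge1-2M_2/R_1>0$). $\mathcal I[u]=\int_{R_1}^{R_2}\frac{r^3(u')_+}{\sqrt{F_u}}\,dr$ for $u\in\mathcal A_\infty$; $\mathcal J[u]=\int_{[R_1,R_2]}\frac{r^3}{\sqrt{F_u(r)}}\,d(Du)^+(r)$ for $u\in\mathcal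 A_{BV}$. $\mathcal I_{\mathrm{rel}}[u]:=\inf\{\liminf_{n\to\infty}\mathcal I[u_n]:\ u_n\in\mathcal A_\infty,\ u_n\to u\text{ in }L^1(\mathbb R)\}$ for $u\in\mathcal A_{BV}$, with value $+\infty$ when no approximating sequence exists. *)

theory Defs
  imports "HOL-Analysis.Analysis"
begin

definition smooth :: "(real \<Rightarrow> real) \<Rightarrow> bool" where
  "smooth f \<longleftrightarrow> (\<forall>k. (deriv ^^ k) f differentiable_on UNIV)"

definition supp :: "(real \<Rightarrow> real) \<Rightarrow> real set" where
  "supp f = closure {x. f x \<noteq> 0}"

definition test_function :: "(real \<Rightarrow> real) \<Rightarrow> bool" where
  "test_function \<phi> \<longleftrightarrow> smooth \<phi> \<and> compact (supp \<phi>)"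

text \<open>
  A finite signed Borel measure is a countably additive real-valued set function on the Borel
  sets. On the real line such a measure is automatically Radon. Non-Borel sets
  get the value 0, so that equal signed measures are equal as functions.
\<close>

definition finite_signed_measure :: "(real set \<Rightarrow> real) \<Rightarrow> bool" where
  "finite_signed_measure D \<longleftrightarrow>
     D {} = 0 \<and>
     (\<forall>A :: nat \<Rightarrow> real set. range A \<subseteq> sets borel \<longrightarrow> disjoint_family A \<longrightarrow>
        (\<lambda>i. D (A i)) sums D (\<Union>i. A i)) \<and>
     (\<forall>A. A \<notin> sets borel \<longrightarrow> D A = 0)"

definition finite_borel_measure :: "real measure \<Rightarrow> bool" where
  "finite_borel_measure M \<longleftrightarrow> sets M = sets borel \<and> finite_measure M"

definition mutually_singular :: "real measure \<Rightarrow> real measure \<Rightarrow> bool" where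
  "mutually_singular M N \<longleftrightarrow> (\<exists>A\<in>sets borel. emeasure M A = 0 \<and> emeasure N (- A) = 0)"

definition jordan_decomposition ::
    "(real set \<Rightarrow> real) \<Rightarrow> real measure \<Rightarrow> real measure \<Rightarrow> bool" where
  "jordan_decomposition D M N \<longleftrightarrow>
     finite_borel_measure M \<and> finite_borel_measure N \<and> mutually_singular M N \<and>
     (\<forall>A\<in>sets borel. D A = measure M A - measure N A)"

text \<open>
  By the Hahn-Jordan theorem, the two descriptions below are proper (exactly one pair \<open>(M, N)\<close>
  qualifies) for every finite signed measure.
\<close>

definition pos_part :: "(real set \<Rightarrow> real) \<Rightarrow> real measure" where
  "pos_part D = (THE M. \<exists>N. jordan_decomposition D M N)"

definition neg_part :: "(real set \<Rightarrow> real) \<Rightarrow> real measure" where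
  "neg_part D = (THE N. \<exists>M. jordan_decomposition D M N)"

definition signed_integral :: "(real set \<Rightarrow> real) \<Rightarrow> (real \<Rightarrow> real) \<Rightarrow> real" where
  "signed_integral D \<phi> = (LINT x|pos_part D. \<phi> x) - (LINT x|neg_part D. \<phi> x)"

definition distributional_derivative :: "(real \<Rightarrow> real) \<Rightarrow> (real set \<Rightarrow> real) \<Rightarrow> bool" where
  "distributional_derivative u D \<longleftrightarrow>
     finite_signed_measure D \<and>
     (\<forall>\<phi>. test_function \<phi> \<longrightarrow>
        (LINT x|lebesgue. u x * deriv \<phi> x) = - signed_integral D \<phi>)"

text \<open>
  Elements of BV are represented by arbitrary Lebesgue measurable representatives.
\<close>

definition BV :: "(real \<Rightarrow> real) set" where
  "BV = {u. integrable lebesgue u \<and> (\<exists>D. distributional_derivative u D)}"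

definition Du :: "(real \<Rightarrow> real) \<Rightarrow> real set \<Rightarrow> real" where
  "Du u = (THE D. distributional_derivative u D)"

definition L1_converges :: "(nat \<Rightarrow> real \<Rightarrow> real) \<Rightarrow> (real \<Rightarrow> real) \<Rightarrow> bool" where
  "L1_converges un u \<longleftrightarrow> (\<lambda>n. LINT x|lebesgue. \<bar>un n x - u x\<bar>) \<longlonglongrightarrow> 0"

definition A_infty :: "real \<Rightarrow> real \<Rightarrow> (real \<Rightarrow> real) set" where
  "A_infty R1 R2 = {u. smooth u \<and> (\<forall>x. u x \<ge> 0) \<and> supp u \<subseteq> {R1<..<R2} \<and>
     (LINT r:{R1..R2}|lebesgue. r\<^sup>2 * u r) = 1}"

definition A_BV :: "real \<Rightarrow> real \<Rightarrow> (real \<Rightarrow> real) set" where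
  "A_BV R1 R2 = {u. u \<in> BV \<and> (AE x in lebesgue. u x \<ge> 0) \<and>
     (AE x in lebesgue. x \<notin> {R1..R2} \<longrightarrow> u x = 0) \<and>
     (LINT r:{R1..R2}|lebesgue. r\<^sup>2 * u r) = 1}"

definition P_fun :: "real \<Rightarrow> (real \<Rightarrow> real) \<Rightarrow> real \<Rightarrow> real" where
  "P_fun R1 u r = (LINT s:{R1..r}|lebesgue. s\<^sup>2 * u s)"

definition m_fun :: "real \<Rightarrow> real \<Rightarrow> real \<Rightarrow> (real \<Rightarrow> real) \<Rightarrow> real \<Rightarrow> real" where
  "m_fun M1 M2 R1 u r = M1 + (M2 - M1) * P_fun R1 u r"

definition F_fun :: "real \<Rightarrow> real \<Rightarrow> real \<Rightarrow> (real \<Rightarrow> real) \<Rightarrow> real \<Rightarrow> real" where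
  "F_fun M1 M2 R1 u r = 1 - 2 * m_fun M1 M2 R1 u r / r"

definition I_fun :: "real \<Rightarrow> real \<Rightarrow> real \<Rightarrow> real \<Rightarrow> (real \<Rightarrow> real) \<Rightarrow> real" where
  "I_fun M1 M2 R1 R2 u =
     (LINT r:{R1..R2}|lebesgue. r ^ 3 * max (deriv u r) 0 / sqrt (F_fun M1 M2 R1 u r))"

definition J_fun :: "real \<Rightarrow> real \<Rightarrow> real \<Rightarrow> real \<Rightarrow> (real \<Rightarrow> real) \<Rightarrow> real" where
  "J_fun M1 M2 R1 R2 u =
     (LINT r:{R1..R2}|pos_part (Du u). r ^ 3 / sqrt (F_fun M1 M2 R1 u r))"

definition approximants :: "real \<Rightarrow> real \<Rightarrow> (real \<Rightarrow> real) \<Rightarrow> (nat \<Rightarrow> real \<Rightarrow> real) set" where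
  "approximants R1 R2 u = {un. (\<forall>n. un n \<in> A_infty R1 R2) \<and> L1_converges un u}"

text \<open>The infimum of the empty set in \<^typ>\<open>ereal\<close> is \<open>\<infinity>\<close>.\<close>

definition I_rel :: "real \<Rightarrow> real \<Rightarrow> real \<Rightarrow> real \<Rightarrow> (real \<Rightarrow> real) \<Rightarrow> ereal" where
  "I_rel M1 M2 R1 R2 u =
     (INF un\<in>approximants R1 R2 u. liminf (\<lambda>n. ereal (I_fun M1 M2 R1 R2 (un n))))"

end

(*
  Replacing u by a nonnegative Borel representative, test functions identify Du uniquely, so its
  Jordan parts can be used through the integration-by-parts formula alone.

  Lower bound: if u_n -> u in L^1, the weights r^3 / sqrt F converge uniformly. For a test function
  phi with 0 <= phi <= weight - delta on [R1, R2], integration by parts gives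
  I[u_n] >= -int u_n phi' -> int phi dDu. Taking phi to be a polynomial just below the weight times a
  smooth approximation of the indicator of a positive Hahn set makes int phi dDu close to J[u].

  Recovery: contract u towards the midpoint of [R1, R2], mollify at a smaller scale and normalise.
  The derivative of the mollification is the mollified Du, hence its positive part is bounded by the
  mollified (Du)^+, and swapping integrals turns the energy into the integral of averaged weights
  against (Du)^+, which tends to J[u] by dominated convergence. This works even if (Du)^+ charges
  the endpoints, because the contraction moves them into the interior.
*)
theory Submission
  imports Defs
begin

section \<open>Smooth functions\<close>

text \<open>The weight depends on u through all of P_u, but P_u integrates u over a bounded set, so
  L^1 convergence controls it uniformly in r; 2 * M2 < R1 keeps F above \<open>F_lower\<close>,
  where the inverse square root is Lipschitz. The delicate point is mass of (Du)^+ at R1 and R2. The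
  lower bound does not lose it, because phi is constrained only on the closed interval and may be
  nonzero beyond it, where the competitors vanish. The recovery sequence does not lose it, because
  the mollification radius is at most half of the room freed by the contraction: every point at
  which the weight is averaged stays in [R1, R2]. \<open>Du\<close> and \<open>pos_part\<close> are
  definite descriptions, so nothing can be said about them before existence and uniqueness of the
  Jordan decomposition and uniqueness of the distributional derivative; this is what the
  measure-theoretic part provides.\<close>

inductive_set function_algebra :: "(real \<Rightarrow> real) set \<Rightarrow> (real \<Rightarrow> real) set" for B where
  base: "f \<in> B \<Longrightarrow> f \<in> function_algebra B"
| const: "(\<lambda>x. c) \<in> function_algebra B"
| add: "f \<in> function_algebra B \<Longrightarrow> g \<in> function_algebra B \<Longrightarrow> (\<lambda>x. f x + g x) \<in> function_algebra B"
| mult: "f \<in> function_algebra B \<Longrightarrow> g \<in> function_algebra B \<Longrightarrow> (\<lambda>x. f x * g x) \<in> function_algebra B"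

text \<open>By the sum and product rules the generated algebra is closed under derivatives as soon
  as the derivatives of the generators lie in it, so it contains all iterated derivatives of its
  members. B itself need not be closed, which is what \<open>flat\<close> requires.\<close>

lemma smooth_coinduct:
  assumes B: "\<And>f. f \<in> B \<Longrightarrow> \<exists>f'\<in>function_algebra B. \<forall>x. (f has_real_derivative f' x) (at x)"
    and f: "f \<in> function_algebra B"
  shows "smooth f"
proof -
  have step: "\<exists>f'\<in>function_algebra B. \<forall>x. (f has_real_derivative f' x) (at x)"
    if "f \<in> function_algebra B" for f
    using that
  proof induction
    case (base f)
    then show ?case by (rule B)
  next
    case (const c)
    have "(\<lambda>x. 0) \<in> function_algebra B" by (rule function_algebra.const)
    moreover have "\<forall>x. ((\<lambda>x. c) has_real_derivative 0) (at x)" by simp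
    ultimately show ?case by (intro bexI[of _ "\<lambda>x. 0"]) auto
  next
    case (add f g)
    then obtain f' g' where "f' \<in> function_algebra B" "g' \<in> function_algebra B"
      "\<And>x. (f has_real_derivative f' x) (at x)" "\<And>x. (g has_real_derivative g' x) (at x)" by blast
    then show ?case
      by (intro bexI[of _ "\<lambda>x. f' x + g' x"]) (auto intro: DERIV_add function_algebra.add)
  next
    case (mult f g)
    then obtain f' g' where "f' \<in> function_algebra B" "g' \<in> function_algebra B"
      "\<And>x. (f has_real_derivative f' x) (at x)" "\<And>x. (g has_real_derivative g' x) (at x)" by blast
    with mult show ?case
      by (intro bexI[of _ "\<lambda>x. f' x * g x + g' x * f x"])
        (auto intro!: DERIV_mult function_algebra.add function_algebra.mult)
  qed
  have iter: "(deriv ^^ k) f \<in> function_algebra B" for k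
  proof (induction k)
    case (Suc k)
    from step[OF Suc] obtain f' where f': "f' \<in> function_algebra B"
      "\<And>x. ((deriv ^^ k) f has_real_derivative f' x) (at x)" by blast
    then have "(deriv ^^ Suc k) f = f'" by (auto intro: DERIV_imp_deriv)
    with f' show ?case by simp
  qed (use f in simp)
  show ?thesis
    unfolding smooth_def differentiable_on_def
  proof (intro allI ballI)
    fix k x
    from step[OF iter[of k]] show "(deriv ^^ k) f differentiable at x within UNIV"
      using real_differentiable_def by blast
  qed
qed

lemma smooth_deriv: "smooth f \<Longrightarrow> smooth (deriv f)"
  unfolding smooth_def
proof
  fix k assume "\<forall>k. (deriv ^^ k) f differentiable_on UNIV"
  then have "(deriv ^^ Suc k) f differentiable_on UNIV" by blast
  then show "(deriv ^^ k) (deriv f) differentiable_on UNIV"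
    by (simp only: funpow_Suc_right o_apply)
qed

lemma smooth_has_derivative:
  assumes "smooth f" shows "(f has_real_derivative deriv f x) (at x)"
proof -
  have "(deriv ^^ 0) f differentiable_on UNIV" using assms unfolding smooth_def by blast
  then have "f differentiable at x" by (auto simp: differentiable_on_def)
  then show ?thesis by (simp add: DERIV_deriv_iff_real_differentiable)
qed

lemma smooth_continuous_on: "smooth f \<Longrightarrow> continuous_on S f"
  using smooth_has_derivative by (intro continuous_at_imp_continuous_on ballI) (blast intro: DERIV_isCont)

lemma smooth_borel_measurable: "smooth f \<Longrightarrow> f \<in> borel_measurable borel"
  by (intro borel_measurable_continuous_onI smooth_continuous_on)

lemma smooth_if_derivative_closed:
  assumes "\<And>f. f \<in> B \<Longrightarrow> \<exists>f'\<in>B. \<forall>x. (f has_real_derivative f' x) (at x)" and "f \<in> B"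
  shows "smooth f"
  using assms by (intro smooth_coinduct[of B]) (blast intro: function_algebra.base)+

lemma function_algebra_smooth: "f \<in> function_algebra (Collect smooth) \<Longrightarrow> smooth f"
  by (rule smooth_coinduct[of "Collect smooth"])
    (auto intro!: function_algebra.base smooth_deriv smooth_has_derivative)

lemma smooth_const: "smooth (\<lambda>x. c)"
  by (rule function_algebra_smooth[OF function_algebra.const])

lemma smooth_mult: "smooth f \<Longrightarrow> smooth g \<Longrightarrow> smooth (\<lambda>x. f x * g x)"
  by (intro function_algebra_smooth function_algebra.mult) (auto intro: function_algebra.base)

lemma smooth_add: "smooth f \<Longrightarrow> smooth g \<Longrightarrow> smooth (\<lambda>x. f x + g x)"
  by (intro function_algebra_smooth function_algebra.add) (auto intro: function_algebra.base)

lemma smooth_diff: 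
  assumes "smooth f" "smooth g" shows "smooth (\<lambda>x. f x - g x)"
  using smooth_add[OF assms(1) smooth_mult[OF smooth_const[of "-1"] assms(2)]] by simp

lemma smooth_affine:
  assumes "smooth f" shows "smooth (\<lambda>x. f (a + b * x))"
\<comment> \<open>The factor c makes the class closed: each differentiation contributes another
  factor b.\<close>
proof (rule smooth_if_derivative_closed[of "{g. \<exists>f c. smooth f \<and> g = (\<lambda>x. c * f (a + b * x))}"])
  fix g assume "g \<in> {g. \<exists>f c. smooth f \<and> g = (\<lambda>x. c * f (a + b * x))}"
  then obtain f c where f: "smooth f" and g: "g = (\<lambda>x. c * f (a + b * x))" by blast
  have "(g has_real_derivative (c * b) * deriv f (a + b * x)) (at x)" for x
    unfolding g using smooth_has_derivative[OF f, of "a + b * x"]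
    by (auto intro!: derivative_eq_intros DERIV_chain2[where f=f])
  then show "\<exists>f'\<in>{g. \<exists>f c. smooth f \<and> g = (\<lambda>x. c * f (a + b * x))}.
      \<forall>x. (g has_real_derivative f' x) (at x)"
    using smooth_deriv[OF f] by (intro bexI[of _ "\<lambda>x. (c * b) * deriv f (a + b * x)"]) auto
qed (use assms in \<open>auto intro!: exI[of _ f] exI[of _ 1]\<close>)

lemma smooth_polynomial: "real_polynomial_function p \<Longrightarrow> smooth p" for p :: "real \<Rightarrow> real"
proof (rule smooth_if_derivative_closed[of "Collect real_polynomial_function"])
  fix f :: "real \<Rightarrow> real" assume "f \<in> Collect real_polynomial_function"
  then show "\<exists>f'\<in>Collect real_polynomial_function. \<forall>x. (f has_real_derivative f' x) (at x)"
    by (metis has_real_derivative_polynomial_function mem_Collect_eq)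
qed simp

section \<open>Flat functions and smooth cutoffs of intervals\<close>

text \<open>The classical smooth function that is not analytic at 0. The parameter c is kept because
  the functions converge pointwise to the indicator of the open half-line as c tends to 0 from
  above.\<close>

definition flat :: "real \<Rightarrow> real \<Rightarrow> real" where
  "flat c x = (if 0 < x then exp (- c / x) else 0)"

lemma flat_power_tendsto:
  assumes "0 < c"
  shows "((\<lambda>x. (1 / x) ^ k * flat c x) \<longlongrightarrow> 0) (at 0)"
proof (rule filterlim_split_at)
  have "\<forall>\<^sub>F x in at_left (0::real). x < 0" by (simp add: eventually_at_filter)
  then have "\<forall>\<^sub>F x in at_left 0. 0 = (1 / x) ^ k * flat c x"
    by eventually_elim (simp add: flat_def)
  then show "((\<lambda>x. (1 / x) ^ k * flat c x) \<longlongrightarrow> 0) (at_left 0)"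
    by (rule tendsto_cong[THEN iffD1]) simp
  have "filterlim (\<lambda>x. c * inverse x) at_top (at_right 0)"
    by (rule filterlim_tendsto_pos_mult_at_top[OF tendsto_const assms filterlim_inverse_at_top_right])
  from filterlim_compose[OF tendsto_power_div_exp_0 this]
  have "((\<lambda>x. (1 / c) ^ k * ((c * inverse x) ^ k / exp (c * inverse x))) \<longlongrightarrow> (1 / c) ^ k * 0) (at_right 0)"
    by (rule tendsto_mult[OF tendsto_const])
  moreover have "\<forall>\<^sub>F x in at_right (0::real). (1 / c) ^ k * ((c * inverse x) ^ k / exp (c * inverse x)) = (1 / x) ^ k * flat c x"
    using eventually_at_right_less[of 0]
  proof eventually_elim
    case (elim x)
    have "(c * inverse x) ^ k / exp (c * inverse x) = c ^ k * ((1 / x) ^ k * flat c x)"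
      using elim by (simp add: flat_def exp_minus power_mult_distrib divide_inverse)
    moreover have "(1 / c) ^ k * c ^ k = 1" using assms by (simp flip: power_mult_distrib)
    ultimately show ?case by (metis mult.assoc mult_1)
  qed
  ultimately show "((\<lambda>x. (1 / x) ^ k * flat c x) \<longlongrightarrow> 0) (at_right 0)"
    by (auto intro: Lim_transform_eventually)
qed

text \<open>The derivative is written as a combination of functions of the same family, with k
  raised by 2 and by 1, so that it visibly lies in the algebra they generate. For x at most 0
  everything vanishes through \<open>flat\<close>, whatever the value of 1 / x.\<close>

lemma flat_power_derivative:
  assumes "0 < c"
  shows "((\<lambda>x. (1 / x) ^ k * flat c x) has_real_derivative
    (c * ((1 / x) ^ (k + 2) * flat c x) + (- real k) * ((1 / x) ^ (k + 1) * flat c x))) (at x)"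
proof (cases "x = 0")
  case True
  \<comment> \<open>The difference quotient at 0 is the family member with exponent k + 1.\<close>
  have "((\<lambda>h. ((1 / h) ^ k * flat c h - (1 / 0) ^ k * flat c 0) / h) \<longlongrightarrow> 0) (at 0)"
    using flat_power_tendsto[OF assms, of "k + 1"] by (simp add: flat_def)
  then show ?thesis unfolding True DERIV_def add_0 by (simp add: flat_def)
next
  case False
  consider "x < 0" | "x > 0" using False by linarith
  then show ?thesis
  proof cases
    case 1
    have "((\<lambda>x. 0) has_real_derivative 0) (at x)" by simp
    then have "((\<lambda>x. (1 / x) ^ k * flat c x) has_real_derivative 0) (at x)"
      by (rule has_field_derivative_transform_within_open[of _ _ _ "{..<0}"])
        (use 1 in \<open>auto simp: flat_def\<close>)
    then show ?thesis using 1 by (simp add: flat_def)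
  next
    case 2
    have "((\<lambda>x. (1 / x) ^ k * exp (- c / x)) has_real_derivative
      (c * ((1 / x) ^ (k + 2) * exp (- c / x)) + (- real k) * ((1 / x) ^ (k + 1) * exp (- c / x)))) (at x)"
    proof -
      have inv: "((\<lambda>x. 1 / x) has_real_derivative - ((1 / x) ^ 2)) (at x)"
        using 2 by (auto intro!: derivative_eq_intros simp: power2_eq_square)
      have "((\<lambda>x. exp (- c / x)) has_real_derivative exp (- c / x) * (c * (1 / x) ^ 2)) (at x)"
        using 2 by (auto intro!: derivative_eq_intros simp: power2_eq_square)
      from DERIV_mult[OF DERIV_power[OF inv, of k] this]
      show ?thesis by (rule DERIV_cong) (cases k; simp add: power_add power2_eq_square algebra_simps flip: add_divide_distrib)
    qed
    then have "((\<lambda>x. (1 / x) ^ k * flat c x) has_real_derivative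
      (c * ((1 / x) ^ (k + 2) * exp (- c / x)) + (- real k) * ((1 / x) ^ (k + 1) * exp (- c / x)))) (at x)"
      by (rule has_field_derivative_transform_within_open[of _ _ _ "{0<..}"])
        (use 2 in \<open>auto simp: flat_def\<close>)
    then show ?thesis using 2 by (simp add: flat_def)
  qed
qed

lemma smooth_flat:
  assumes "0 < c" shows "smooth (flat c)"
proof -
  let ?B = "{f. \<exists>k. f = (\<lambda>x. (1 / x) ^ k * flat c x)}"
  have "smooth (\<lambda>x. (1 / x) ^ 0 * flat c x)"
  proof (rule smooth_coinduct[of ?B])
    fix f assume "f \<in> ?B"
    then obtain k where f: "f = (\<lambda>x. (1 / x) ^ k * flat c x)" by blast
    have "(\<lambda>x. c * ((1 / x) ^ (k + 2) * flat c x) + (- real k) * ((1 / x) ^ (k + 1) * flat c x))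
      \<in> function_algebra ?B"
      by (intro function_algebra.add function_algebra.mult[OF function_algebra.const] function_algebra.base) blast+
    then show "\<exists>f'\<in>function_algebra ?B. \<forall>x. (f has_real_derivative f' x) (at x)"
      by (rule bexI[rotated]) (use flat_power_derivative[OF assms, of k] f in blast)
  qed (rule function_algebra.base, blast)
  then show ?thesis by simp
qed

lemma flat_bounds: "0 < c \<Longrightarrow> 0 \<le> flat c x" "0 < c \<Longrightarrow> flat c x \<le> 1"
  by (auto simp: flat_def)

lemma flat_tendsto_indicator:
  "(\<lambda>n. flat (1 / real (Suc n)) x) \<longlonglongrightarrow> indicator {0<..} x"
proof (cases "x > 0")
  case True
  have "(\<lambda>n. exp (- (1 / real (Suc n)) / x)) \<longlonglongrightarrow> exp (- 0 / x)"
    using LIMSEQ_inverse_real_of_nat True by (intro tendsto_intros) (auto simp: inverse_eq_divide)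
  then show ?thesis using True by (simp add: flat_def)
qed (simp add: flat_def)

text \<open>For c > 0 this is a smooth bump that is positive exactly on the open interval from a to
  b. Letting c tend to 0 recovers the indicator of that interval with the support held
  fixed.\<close>

definition window :: "real \<Rightarrow> real \<Rightarrow> real \<Rightarrow> real \<Rightarrow> real" where
  "window c a b x = flat c (x - a) * flat c (b - x)"

lemma smooth_window: "0 < c \<Longrightarrow> smooth (window c a b)"
  unfolding window_def[abs_def]
  using smooth_mult[OF smooth_affine[OF smooth_flat, of c "-a" 1] smooth_affine[OF smooth_flat, of c b "-1"]]
  by simp

lemma window_bounds: "0 < c \<Longrightarrow> 0 \<le> window c a b x" "0 < c \<Longrightarrow> window c a b x \<le> 1"
  by (auto simp: window_def flat_bounds mult_le_one)

lemma window_eq_0: "x \<notin> {a<..<b} \<Longrightarrow> window c a b x = 0"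
  by (auto simp: window_def flat_def)

lemma window_pos: "x \<in> {a<..<b} \<Longrightarrow> 0 < window c a b x"
  by (auto simp: window_def flat_def)

lemma window_tendsto_indicator:
  "(\<lambda>n. window (1 / real (Suc n)) a b x) \<longlonglongrightarrow> indicator {a<..<b} x"
proof -
  have "(\<lambda>n. window (1 / real (Suc n)) a b x) \<longlonglongrightarrow> indicator {0<..} (x - a) * indicator {0<..} (b - x)"
    unfolding window_def by (intro tendsto_mult flat_tendsto_indicator)
  also have "indicator {0<..} (x - a) * indicator {0<..} (b - x) = (indicator {a<..<b} x :: real)"
    by (auto simp: indicator_def)
  finally show ?thesis .
qed

section \<open>Supports and test functions\<close>

lemma supp_subset: "closed S \<Longrightarrow> (\<And>x. x \<notin> S \<Longrightarrow> f x = 0) \<Longrightarrow> supp f \<subseteq> S"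
  unfolding supp_def by (intro closure_minimal) auto

lemma outside_supp: "x \<notin> supp f \<Longrightarrow> f x = 0"
  unfolding supp_def using closure_subset[of "{x. f x \<noteq> 0}"] by auto

lemma test_functionI:
  assumes "smooth f" "\<And>x. x \<notin> {a..b} \<Longrightarrow> f x = 0" shows "test_function f"
proof -
  have "supp f \<subseteq> {a..b}" by (intro supp_subset assms) auto
  then have "compact (supp f)"
    unfolding supp_def by (rule compact_closure[THEN iffD2, OF bounded_subset[OF bounded_closed_interval, of _ a b, OF subset_trans[OF closure_subset]]])
  with assms show ?thesis by (simp add: test_function_def)
qed

lemma test_function_support:
  assumes "test_function f"
  shows "\<exists>a>0. \<forall>x. x \<notin> {-a..a} \<longrightarrow> f x = 0"
proof -
  have "bounded (supp f)" using assms by (simp add: test_function_def compact_imp_bounded)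
  then obtain a where a: "\<forall>x\<in>supp f. norm x \<le> a" "0 < a"
    by (auto simp: bounded_pos)
  have "f x = 0" if "x \<notin> {-a..a}" for x
    using that a(1) by (intro outside_supp) auto
  with a(2) show ?thesis by blast
qed

lemma deriv_eq_0_outside:
  assumes "smooth f" "closed S" "\<And>x. x \<notin> S \<Longrightarrow> f x = 0" "x \<notin> S"
  shows "deriv f x = 0"
proof -
  have "((\<lambda>x. 0) has_real_derivative 0) (at x)" by simp
  then have "(f has_real_derivative 0) (at x)"
    by (rule has_field_derivative_transform_within_open[of _ _ _ "- S"]) (use assms in auto)
  then show ?thesis by (rule DERIV_imp_deriv)
qed

lemma test_function_deriv: "test_function f \<Longrightarrow> test_function (deriv f)"
proof -
  assume f: "test_function f"
  obtain a where a: "\<And>x. x \<notin> {-a..a} \<Longrightarrow> f x = 0" using test_function_support[OF f] by blast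
  have "smooth f" using f by (simp add: test_function_def)
  then show "test_function (deriv f)"
    using a by (intro test_functionI[of _ "-a" a] smooth_deriv deriv_eq_0_outside[of f "{-a..a}"]) auto
qed

lemma test_function_bounded:
  assumes "test_function f" obtains C where "0 < C" "\<And>x. \<bar>f x\<bar> \<le> C"
proof -
  obtain a where a: "\<And>x. x \<notin> {-a..a} \<Longrightarrow> f x = 0" using test_function_support[OF assms] by blast
  have "compact (f ` {-a..a})"
    using assms by (intro compact_continuous_image smooth_continuous_on) (auto simp: test_function_def)
  then have "bounded (f ` {-a..a})" by (rule compact_imp_bounded)
  then obtain C where C: "0 < C" "\<forall>y\<in>f ` {-a..a}. norm y \<le> C"
    by (auto simp: bounded_pos)
  have "\<bar>f x\<bar> \<le> C" for x using C a[of x] by (cases "x \<in> {-a..a}") auto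
  with C(1) show ?thesis by (rule that)
qed

section \<open>Hahn and Jordan decompositions\<close>

text \<open>Truncating at 1 makes the supremum in the greedy choice finite before \<open>D\<close> is known to be
  bounded.\<close>

lemma greedy_exhaustion:
  fixes D :: "'a set \<Rightarrow> real"
  assumes "{} \<in> \<C>" and "D {} = 0"
    and null: "\<And>B :: nat \<Rightarrow> 'a set. range B \<subseteq> \<C> \<Longrightarrow> disjoint_family B \<Longrightarrow> (\<lambda>n. D (B n)) \<longlonglongrightarrow> 0"
  shows "\<exists>B :: nat \<Rightarrow> 'a set. range B \<subseteq> \<C> \<and> disjoint_family B \<and> (\<forall>n. B n \<subseteq> A) \<and>
    (\<forall>n. 0 \<le> D (B n)) \<and> (\<forall>E\<in>\<C>. E \<subseteq> A - (\<Union>n. B n) \<longrightarrow> D E \<le> 0)"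
proof -
  \<comment> \<open>The greedy choice: E captures at least half of the truncated supremum over
    subsets of X, and is empty if that supremum is not positive.\<close>
  have "\<exists>E\<in>\<C>. E \<subseteq> X \<and> (\<forall>E'\<in>\<C>. E' \<subseteq> X \<longrightarrow> min 1 (D E') \<le> 2 * D E)" for X
  proof -
    define V where "V = (\<lambda>E. min 1 (D E)) ` {E\<in>\<C>. E \<subseteq> X}"
    have bdd: "bdd_above V" unfolding V_def by (rule bdd_aboveI[of _ 1]) auto
    have up: "min 1 (D E) \<le> Sup V" if "E \<in> \<C>" "E \<subseteq> X" for E
      using that by (intro cSup_upper bdd) (auto simp: V_def)
    show ?thesis
    proof (cases "Sup V \<le> 0")
      case True
      then show ?thesis using up assms(1,2) by (intro bexI[of _ "{}"]) force+
    next
      case False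
      moreover have "V \<noteq> {}" using assms(1) by (auto simp: V_def)
      ultimately obtain E where E: "E \<in> \<C>" "E \<subseteq> X" "Sup V / 2 < min 1 (D E)"
        using less_cSupD[of V "Sup V / 2"] unfolding V_def by fastforce
      show ?thesis using E up by (intro bexI[of _ E]) force+
    qed
  qed
  then obtain pick where pick: "\<And>X. pick X \<in> \<C>" "\<And>X. pick X \<subseteq> X"
    "\<And>X E. E \<in> \<C> \<Longrightarrow> E \<subseteq> X \<Longrightarrow> min 1 (D E) \<le> 2 * D (pick X)"
    by metis
  define R where "R = rec_nat A (\<lambda>n X. X - pick X)"
  define B where "B n = pick (R n)" for n
  have R: "R 0 = A" "\<And>n. R (Suc n) = R n - B n" by (simp_all add: R_def B_def)
  have "antimono R" using R by (intro decseq_SucI) auto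
  have disj: "B m \<inter> B n = {}" if "m < n" for m n
  proof -
    have "B n \<subseteq> R n" by (simp add: B_def pick)
    also have "R n \<subseteq> R (Suc m)" using that by (intro antimonoD[OF \<open>antimono R\<close>, of "Suc m" n]) simp
    finally show ?thesis using R by auto
  qed
  have disjB: "disjoint_family B"
    unfolding disjoint_family_on_def using disj by (metis Int_commute linorder_neqE_nat)
  have sub: "A - (\<Union>n. B n) \<subseteq> R n" for n by (induction n) (auto simp: R)
  have rB: "range B \<subseteq> \<C>" by (auto simp: B_def pick)
  show ?thesis
  proof (intro exI[of _ B] conjI allI ballI impI rB disjB)
    show "B n \<subseteq> A" for n using antimonoD[OF \<open>antimono R\<close>, of 0 n] pick(2)[of "R n"] R by (auto simp: B_def)
    show "0 \<le> D (B n)" for n using pick(3)[of "{}" "R n"] assms(1,2) by (simp add: B_def)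
    fix E assume E: "E \<in> \<C>" "E \<subseteq> A - (\<Union>n. B n)"
    have le: "min 1 (D E) \<le> 2 * D (B n)" for n
      unfolding B_def using E sub[of n] by (intro pick(3)) auto
    \<comment> \<open>A set E left over after all choices competed at every stage, so its truncated
      value is bounded by a null sequence; and \<open>min 1 (D E) \<le> 0\<close> forces
      \<open>D E \<le> 0\<close>.\<close>
    have "(\<lambda>n. 2 * D (B n)) \<longlonglongrightarrow> 2 * 0"
      by (rule tendsto_mult[OF tendsto_const null[OF rB disjB]])
    from LIMSEQ_le_const[OF this] le have "min 1 (D E) \<le> 2 * 0" by blast
    then show "D E \<le> 0" by (auto simp: min_def split: if_splits)
  qed
qed

context
  fixes D assumes D: "finite_signed_measure D"
begin

lemma signed_empty: "D {} = 0"
  using D by (simp add: finite_signed_measure_def)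

lemma signed_sums:
  "range A \<subseteq> sets borel \<Longrightarrow> disjoint_family A \<Longrightarrow> (\<lambda>i. D (A i)) sums D (\<Union>i. A i)" for A :: "nat \<Rightarrow> real set"
  using D by (simp add: finite_signed_measure_def)

lemma signed_Un:
  assumes "A \<in> sets borel" "B \<in> sets borel" "A \<inter> B = {}"
  shows "D (A \<union> B) = D A + D B"
proof -
  have "(\<lambda>n. D (binaryset A B n)) sums D (\<Union>n. binaryset A B n)"
    using assms by (intro signed_sums) (auto simp: range_binaryset_eq disjoint_family_on_def binaryset_def)
  moreover have "(\<lambda>n. D (binaryset A B n)) sums (D A + D B)"
    using binaryset_sums signed_empty by blast
  ultimately show ?thesis using sums_unique2 by (simp add: UN_binaryset_eq)
qed

text \<open>Greedy exhaustion is used twice. Removing sets of negative value from A leaves a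
  positive set of value at least D A. Collecting positive sets then gives P: a set E outside P
  contains a positive set of at least the same value, and by exhaustion that value is at most
  0.\<close>

lemma Hahn_decomposition:
  obtains P where "P \<in> sets borel" "\<And>E. E \<in> sets borel \<Longrightarrow> E \<subseteq> P \<Longrightarrow> 0 \<le> D E"
    "\<And>E. E \<in> sets borel \<Longrightarrow> E \<subseteq> - P \<Longrightarrow> D E \<le> 0"
proof -
  define pos where "pos = {X\<in>sets borel. \<forall>E\<in>sets borel. E \<subseteq> X \<longrightarrow> 0 \<le> D E}"
  have null: "(\<lambda>n. D (B n)) \<longlonglongrightarrow> 0" if "range B \<subseteq> sets borel" "disjoint_family B" for B :: "nat \<Rightarrow> real set"
    using signed_sums[OF that] by (blast intro: summable_LIMSEQ_zero sums_summable)
  \<comment> \<open>Exhaustion applied to - D: the removed union has value at most 0, so removing it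
    cannot lower D, and the remainder has no subset of negative value.\<close>
  have inner: "\<exists>X\<in>pos. X \<subseteq> A \<and> D A \<le> D X" if A: "A \<in> sets borel" for A
  proof -
    have "(\<lambda>n. - D (B n)) \<longlonglongrightarrow> 0" if "range B \<subseteq> sets borel" "disjoint_family B" for B :: "nat \<Rightarrow> real set"
      using tendsto_minus[OF null[OF that]] by simp
    from greedy_exhaustion[of "sets borel" "\<lambda>E. - D E" A, OF _ _ this] signed_empty
    obtain B :: "nat \<Rightarrow> real set" where B: "range B \<subseteq> sets borel" "disjoint_family B"
      "\<And>n. B n \<subseteq> A" "\<And>n. 0 \<le> - D (B n)" "\<And>E. E \<in> sets borel \<Longrightarrow> E \<subseteq> A - (\<Union>n. B n) \<Longrightarrow> - D E \<le> 0"
      by (metis minus_zero sets.empty_sets)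
    have "D (\<Union>n. B n) \<le> 0"
      using B(4) by (intro sums_le[OF _ signed_sums[OF B(1,2)] sums_zero]) simp
    moreover have UB: "(\<Union>n. B n) \<in> sets borel" using B(1) by auto
    then have "D ((A - (\<Union>n. B n)) \<union> (\<Union>n. B n)) = D (A - (\<Union>n. B n)) + D (\<Union>n. B n)"
      using A by (intro signed_Un) auto
    moreover have "(A - (\<Union>n. B n)) \<union> (\<Union>n. B n) = A" using B(3) by auto
    moreover have "A - (\<Union>n. B n) \<in> pos" using A UB B(5) by (auto simp: pos_def)
    ultimately show ?thesis by (intro bexI[of _ "A - (\<Union>n. B n)"]) auto
  qed
  have "(\<lambda>n. D (B n)) \<longlonglongrightarrow> 0" if "range B \<subseteq> pos" "disjoint_family B" for B :: "nat \<Rightarrow> real set"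
    using that by (intro null) (auto simp: pos_def)
  moreover have "{} \<in> pos" by (simp add: pos_def signed_empty)
  ultimately obtain B :: "nat \<Rightarrow> real set" where B: "range B \<subseteq> pos" "disjoint_family B"
    "\<And>E. E \<in> pos \<Longrightarrow> E \<subseteq> UNIV - (\<Union>n. B n) \<Longrightarrow> D E \<le> 0"
    using greedy_exhaustion[of pos D UNIV] signed_empty by metis
  show ?thesis
  proof (rule that[of "\<Union>n. B n"])
    show "(\<Union>n. B n) \<in> sets borel" using B(1) by (auto simp: pos_def)
  next
    fix E assume E: "E \<in> sets borel" "E \<subseteq> (\<Union>n. B n)"
    have "(\<lambda>n. D (E \<inter> B n)) sums D (\<Union>n. E \<inter> B n)"
    proof (rule signed_sums)
      show "range (\<lambda>n. E \<inter> B n) \<subseteq> sets borel" using B(1) E by (auto simp: pos_def)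
      show "disjoint_family (\<lambda>n. E \<inter> B n)" using B(2) unfolding disjoint_family_on_def by blast
    qed
    moreover have "(\<Union>n. E \<inter> B n) = E" using E by auto
    ultimately have s: "(\<lambda>n. D (E \<inter> B n)) sums D E" by simp
    have "0 \<le> D (E \<inter> B n)" for n
    proof -
      have "B n \<in> pos" using B(1) by auto
      then have "E \<inter> B n \<in> sets borel" "\<forall>E\<in>sets borel. E \<subseteq> B n \<longrightarrow> 0 \<le> D E" 
        using E by (auto simp: pos_def)
      then show ?thesis by blast
    qed
    then show "0 \<le> D E" by (rule sums_le[OF _ sums_zero s])
  next
    fix E assume E: "E \<in> sets borel" "E \<subseteq> - (\<Union>n. B n)"
    from inner[OF E(1)] obtain X where "X \<in> pos" "X \<subseteq> E" "D E \<le> D X" by blast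
    moreover from this have "X \<subseteq> UNIV - (\<Union>n. B n)" using E by blast
    ultimately show "D E \<le> 0" using B(3) by fastforce
  qed
qed

text \<open>The factor s is 1 or -1 in the Hahn decomposition, so one construction yields both
  Jordan parts. With S = UNIV it also turns a nonnegative set function into a measure, as needed in
  \<open>dominating_measure\<close>.\<close>

lemma signed_finite_borel_measure:
  assumes S: "S \<in> sets borel" and s: "\<And>E. E \<in> sets borel \<Longrightarrow> E \<subseteq> S \<Longrightarrow> 0 \<le> s * D E"
  obtains M where "finite_borel_measure M" "\<And>A. A \<in> sets borel \<Longrightarrow> measure M A = s * D (A \<inter> S)"
proof -
  define M where "M = measure_of UNIV (sets borel) (\<lambda>A. ennreal (s * D (A \<inter> S)))"
  have sa: "sigma_algebra UNIV (sets (borel :: real measure))"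
    by (metis sets.sigma_algebra_axioms space_borel)
  have sets: "sets M = sets borel" unfolding M_def by (simp add: sigma_algebra.sets_measure_of_eq[OF sa])
  have em: "emeasure M A = ennreal (s * D (A \<inter> S))" if "A \<in> sets borel" for A
    unfolding M_def
  proof (rule emeasure_measure_of_sigma[OF sa _ _ that])
    show "positive (sets borel) (\<lambda>A. ennreal (s * D (A \<inter> S)))"
      by (simp add: positive_def signed_empty)
    show "countably_additive (sets borel) (\<lambda>A. ennreal (s * D (A \<inter> S)))"
    proof (rule countably_additiveI)
      fix A :: "nat \<Rightarrow> real set" assume A: "range A \<subseteq> sets borel" "disjoint_family A"
      have "(\<lambda>n. D (A n \<inter> S)) sums D (\<Union>n. A n \<inter> S)"
      proof (rule signed_sums)
        show "range (\<lambda>n. A n \<inter> S) \<subseteq> sets borel" using A S by auto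
        show "disjoint_family (\<lambda>n. A n \<inter> S)" using A unfolding disjoint_family_on_def by blast
      qed
      then have sums: "(\<lambda>n. s * D (A n \<inter> S)) sums (s * D ((\<Union>n. A n) \<inter> S))"
        unfolding Int_UN_distrib2[symmetric] by (simp add: sums_mult)
      have "0 \<le> s * D (A n \<inter> S)" for n using A S by (intro s) auto
      then show "(\<Sum>i. ennreal (s * D (A i \<inter> S))) = ennreal (s * D (\<Union> (range A) \<inter> S))"
        by (rule suminf_ennreal_eq[OF _ sums])
    qed
  qed
  have sp: "space M = UNIV" using sets_eq_imp_space_eq[OF sets] by simp
  have "finite_measure M" using em[of UNIV] by (intro finite_measureI) (auto simp: sp)
  moreover have "measure M A = s * D (A \<inter> S)" if "A \<in> sets borel" for A
    using em[OF that] s[of "A \<inter> S"] that S by (simp add: measure_def)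
  ultimately show ?thesis using that sets by (simp add: finite_borel_measure_def)
qed

lemma jordan_decomposition_exists: "\<exists>M N. jordan_decomposition D M N"
proof -
  obtain P where P: "P \<in> sets borel" "\<And>E. E \<in> sets borel \<Longrightarrow> E \<subseteq> P \<Longrightarrow> 0 \<le> D E"
    "\<And>E. E \<in> sets borel \<Longrightarrow> E \<subseteq> - P \<Longrightarrow> D E \<le> 0" by (rule Hahn_decomposition) blast
  obtain M where M: "finite_borel_measure M" "\<And>A. A \<in> sets borel \<Longrightarrow> measure M A = 1 * D (A \<inter> P)"
    using P by (rule_tac signed_finite_borel_measure[of P 1]) auto
  obtain N where N: "finite_borel_measure N" "\<And>A. A \<in> sets borel \<Longrightarrow> measure N A = - 1 * D (A \<inter> - P)"
    using P by (rule_tac signed_finite_borel_measure[of "- P" "-1"]) auto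
  have "emeasure M (- P) = 0" "emeasure N (- (- P)) = 0"
    using M N P signed_empty by (auto simp: finite_measure.emeasure_eq_measure finite_borel_measure_def)
  then have "mutually_singular M N" using P unfolding mutually_singular_def by (intro bexI[of _ "- P"]) auto
  moreover have "D A = measure M A - measure N A" if "A \<in> sets borel" for A
  proof -
    have "D ((A \<inter> P) \<union> (A \<inter> - P)) = D (A \<inter> P) + D (A \<inter> - P)" using that P by (intro signed_Un) auto
    moreover have "(A \<inter> P) \<union> (A \<inter> - P) = A" by auto
    ultimately show ?thesis using M N that by simp
  qed
  ultimately show ?thesis using M N unfolding jordan_decomposition_def by blast
qed

end

section \<open>Uniqueness of the Jordan decomposition\<close>

lemma finite_borel_measure_eqI:
  assumes "finite_borel_measure M" "finite_borel_measure N" "\<And>A. A \<in> sets borel \<Longrightarrow> measure M A = measure N A"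
  shows "M = N"
  using assms by (intro measure_eqI) (auto simp: finite_borel_measure_def finite_measure.emeasure_eq_measure)

text \<open>P is the complement of the set witnessing singularity: M is null off P and N is null on
  P, so D agrees with M on subsets of P and with - N on subsets of its complement.\<close>

lemma jordan_decomposition_measure_eq:
  assumes "jordan_decomposition D M N"
  obtains P where "P \<in> sets borel" "\<And>A. A \<in> sets borel \<Longrightarrow> measure M A = D (A \<inter> P)"
    "\<And>A. A \<in> sets borel \<Longrightarrow> measure N A = - D (A - P)"
proof -
  from assms obtain S where S: "S \<in> sets borel" "emeasure M S = 0" "emeasure N (- S) = 0"
    and fin: "finite_borel_measure M" "finite_borel_measure N"
    and D: "\<And>A. A \<in> sets borel \<Longrightarrow> D A = measure M A - measure N A"
    by (auto simp: jordan_decomposition_def mutually_singular_def)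
  interpret M: finite_measure M using fin by (simp add: finite_borel_measure_def)
  interpret N: finite_measure N using fin by (simp add: finite_borel_measure_def)
  have sets: "sets M = sets borel" "sets N = sets borel" using fin by (auto simp: finite_borel_measure_def)
  have 0: "measure M S = 0" "measure N (- S) = 0" using S by (auto simp: measure_def)
  have M0: "measure M A = 0" if "A \<in> sets borel" "A \<subseteq> S" for A
    using M.finite_measure_mono[of A S] that S sets 0 measure_nonneg[of M A] by auto
  have N0: "measure N A = 0" if "A \<in> sets borel" "A \<subseteq> - S" for A
    using N.finite_measure_mono[of A "- S"] that S sets 0 measure_nonneg[of N A] by auto
  show ?thesis
  proof (rule that[of "- S"])
    fix A :: "real set" assume A: "A \<in> sets borel"
    have "measure M A = measure M (A \<inter> S) + measure M (A - S)"
      using M.finite_measure_Union[of "A \<inter> S" "A - S"] A S sets by (auto simp: Int_Diff_Un)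
    then show "measure M A = D (A \<inter> - S)"
      using D[of "A \<inter> - S"] M0[of "A \<inter> S"] N0[of "A \<inter> - S"] A S by (auto simp: Diff_eq)
    have "measure N A = measure N (A \<inter> S) + measure N (A - S)"
      using N.finite_measure_Union[of "A \<inter> S" "A - S"] A S sets by (auto simp: Int_Diff_Un)
    then show "measure N A = - D (A - - S)"
      using D[of "A \<inter> S"] M0[of "A \<inter> S"] N0[of "A - S"] A S by (auto simp: Diff_eq)
  qed (use S in auto)
qed

text \<open>Each positive part is D restricted to its own Hahn set. Evaluating D on that set by the
  other decomposition and discarding the negative part bounds it by the other positive part;
  symmetry gives equality.\<close>

lemma jordan_decomposition_unique:
  assumes "jordan_decomposition D M N" "jordan_decomposition D M' N'"
  shows "M = M'" "N = N'"
proof -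
  obtain P where P: "P \<in> sets borel" "\<And>A. A \<in> sets borel \<Longrightarrow> measure M A = D (A \<inter> P)"
    "\<And>A. A \<in> sets borel \<Longrightarrow> measure N A = - D (A - P)"
    using jordan_decomposition_measure_eq[OF assms(1)] by blast
  obtain Q where Q: "Q \<in> sets borel" "\<And>A. A \<in> sets borel \<Longrightarrow> measure M' A = D (A \<inter> Q)"
    "\<And>A. A \<in> sets borel \<Longrightarrow> measure N' A = - D (A - Q)"
    using jordan_decomposition_measure_eq[OF assms(2)] by blast
  have D: "D A = measure M A - measure N A" "D A = measure M' A - measure N' A" if "A \<in> sets borel" for A
    using assms that by (auto simp: jordan_decomposition_def)
  have fin: "finite_borel_measure M" "finite_borel_measure M'" "finite_borel_measure N" "finite_borel_measure N'"
    using assms by (auto simp: jordan_decomposition_def)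
  have "measure M A \<le> measure M' A" if A: "A \<in> sets borel" for A
  proof -
    have "measure M A = measure M' (A \<inter> P) - measure N' (A \<inter> P)" using P D(2)[of "A \<inter> P"] A by simp
    also have "\<dots> \<le> measure M' (A \<inter> P)" by simp
    also have "\<dots> \<le> measure M' A"
      using fin(2) A P by (intro finite_measure.finite_measure_mono) (auto simp: finite_borel_measure_def)
    finally show ?thesis .
  qed
  moreover have "measure M' A \<le> measure M A" if A: "A \<in> sets borel" for A
  proof -
    have "measure M' A = measure M (A \<inter> Q) - measure N (A \<inter> Q)" using Q D(1)[of "A \<inter> Q"] A by simp
    also have "\<dots> \<le> measure M (A \<inter> Q)" by simp
    also have "\<dots> \<le> measure M A"
      using fin(1) A Q by (intro finite_measure.finite_measure_mono) (auto simp: finite_borel_measure_def)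
    finally show ?thesis .
  qed
  ultimately have eq: "measure M A = measure M' A" if "A \<in> sets borel" for A using that by (simp add: antisym)
  then show "M = M'" by (intro finite_borel_measure_eqI fin)
  show "N = N'" using eq D by (intro finite_borel_measure_eqI fin) force+
qed

lemma jordan_decomposition_parts:
  assumes "finite_signed_measure D"
  shows "jordan_decomposition D (pos_part D) (neg_part D)"
proof -
  obtain M N where MN: "jordan_decomposition D M N" using jordan_decomposition_exists[OF assms] by blast
  have "pos_part D = M" unfolding pos_part_def
    using MN jordan_decomposition_unique(1)[OF _ MN] by (intro the_equality) blast+
  moreover have "neg_part D = N" unfolding neg_part_def
    using MN jordan_decomposition_unique(2)[OF _ MN] by (intro the_equality) blast+
  ultimately show ?thesis using MN by simp
qed

section \<open>Approximation by test functions\<close>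

lemma finite_borel_measureD:
  assumes "finite_borel_measure M"
  shows "finite_measure M" "sets M = sets borel" "space M = UNIV"
    "borel_measurable M = (borel_measurable borel :: (real \<Rightarrow> real) set)"
  using assms sets_eq_imp_space_eq[of M borel] measurable_cong_sets[of M borel borel borel]
  by (auto simp: finite_borel_measure_def)

lemma integrable_bounded_finite_borel:
  fixes f :: "real \<Rightarrow> real"
  assumes "finite_borel_measure M" "f \<in> borel_measurable borel" "\<And>x. \<bar>f x\<bar> \<le> C"
  shows "integrable M f"
  using assms(2,3) finite_borel_measureD[OF assms(1)]
  by (intro finite_measure.integrable_const_bound[of M _ C]) auto

lemma integral_tendsto_bounded:
  fixes f :: "nat \<Rightarrow> real \<Rightarrow> real"
  assumes "finite_borel_measure M" "\<And>n. f n \<in> borel_measurable borel" "g \<in> borel_measurable borel"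
    "\<And>n x. \<bar>f n x\<bar> \<le> C" "\<And>x. (\<lambda>n. f n x) \<longlonglongrightarrow> g x"
  shows "(\<lambda>n. LINT x|M. f n x) \<longlonglongrightarrow> (LINT x|M. g x)"
  using assms finite_borel_measureD[OF assms(1)]
  by (intro integral_dominated_convergence[where w="\<lambda>_. C"] finite_measure.integrable_const) auto

lemma borel_eq_sigma_sets_greaterThan: "sets (borel :: real measure) = sigma_sets UNIV (range greaterThan)"
  unfolding borel_Ioi by (simp add: sets_measure_of image_def)

text \<open>No compact support is asked for: passing from psi to 1 - psi must stay in the class for
  the approximable sets to be closed under complements. The support is cut down afterwards in
  \<open>indicator_approx_supported\<close>.\<close>

definition smoothly_approximable :: "real measure \<Rightarrow> real set \<Rightarrow> bool" where
  "smoothly_approximable M A \<longleftrightarrow> (\<forall>\<epsilon>>0. \<exists>\<psi>. smooth \<psi> \<and> (\<forall>x. 0 \<le> \<psi> x \<and> \<psi> x \<le> 1) \<and>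
     (LINT x|M. \<bar>\<psi> x - indicator A x\<bar>) < \<epsilon>)"

context
  fixes M assumes M: "finite_borel_measure M"
begin

lemma smoothly_approximable_limit:
  assumes meas: "\<And>n. A n \<in> sets borel" "B \<in> sets borel"
    and A: "\<And>n :: nat. smoothly_approximable M (A n)"
    and lim: "\<And>x. (\<lambda>n. indicator (A n) x :: real) \<longlonglongrightarrow> indicator B x"
  shows "smoothly_approximable M B"
  unfolding smoothly_approximable_def
proof (intro allI impI)
  fix \<epsilon> :: real assume "0 < \<epsilon>"
  have "(\<lambda>n. LINT x|M. \<bar>indicator (A n) x - indicator B x :: real\<bar>) \<longlonglongrightarrow> (LINT x|M. 0)"
  proof (rule integral_tendsto_bounded[OF M, where C=1])
    show "(\<lambda>n. \<bar>indicator (A n) x - indicator B x :: real\<bar>) \<longlonglongrightarrow> 0" for x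
      using tendsto_rabs[OF tendsto_diff[OF lim[of x] tendsto_const[of "indicator B x"]]] by simp
  qed (use meas in \<open>auto simp: indicator_def\<close>)
  then have "(\<lambda>n. LINT x|M. \<bar>indicator (A n) x - indicator B x :: real\<bar>) \<longlonglongrightarrow> 0" by simp
  from order_tendstoD(2)[OF this, of "\<epsilon> / 2"] \<open>0 < \<epsilon>\<close>
  obtain n where n: "(LINT x|M. \<bar>indicator (A n) x - indicator B x :: real\<bar>) < \<epsilon> / 2"
    by (auto simp: eventually_sequentially)
  from A[of n] \<open>0 < \<epsilon>\<close> obtain \<psi> where \<psi>: "smooth \<psi>" "\<And>x. 0 \<le> \<psi> x \<and> \<psi> x \<le> 1"
    "(LINT x|M. \<bar>\<psi> x - indicator (A n) x\<bar>) < \<epsilon> / 2"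
    unfolding smoothly_approximable_def by (meson half_gt_zero)
  note [measurable] = smooth_borel_measurable[OF \<psi>(1)] meas
  have b: "\<bar>\<psi> x - indicator C x\<bar> \<le> 1" for C x using \<psi>(2)[of x] by (auto simp: indicator_def)
  have i: "integrable M (\<lambda>x. \<bar>\<psi> x - indicator (A n) x\<bar>)" "integrable M (\<lambda>x. \<bar>indicator (A n) x - indicator B x :: real\<bar>)"
    "integrable M (\<lambda>x. \<bar>\<psi> x - indicator B x\<bar>)"
    by (rule integrable_bounded_finite_borel[OF M, where C=1], measurable, use b in \<open>force simp: indicator_def\<close>)+
  have "(LINT x|M. \<bar>\<psi> x - indicator B x\<bar>)
      \<le> (LINT x|M. \<bar>\<psi> x - indicator (A n) x\<bar> + \<bar>indicator (A n) x - indicator B x :: real\<bar>)"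
    by (rule integral_mono[OF i(3) Bochner_Integration.integrable_add[OF i(1,2)]]) auto
  also have "\<dots> < \<epsilon>" using Bochner_Integration.integral_add[OF i(1,2)] n \<psi>(3) by simp
  finally show "\<exists>\<psi>. smooth \<psi> \<and> (\<forall>x. 0 \<le> \<psi> x \<and> \<psi> x \<le> 1) \<and> (LINT x|M. \<bar>\<psi> x - indicator B x\<bar>) < \<epsilon>"
    using \<psi> by blast
qed

lemma smoothly_approximable_Un:
  assumes meas: "A \<in> sets borel" "B \<in> sets borel"
    and "smoothly_approximable M A" "smoothly_approximable M B"
  shows "smoothly_approximable M (A \<union> B)"
  unfolding smoothly_approximable_def
proof (intro allI impI)
  fix \<epsilon> :: real assume "0 < \<epsilon>"
  then obtain \<phi> \<psi> where \<phi>: "smooth \<phi>" "\<And>x. 0 \<le> \<phi> x \<and> \<phi> x \<le> 1" "(LINT x|M. \<bar>\<phi> x - indicator A x\<bar>) < \<epsilon> / 2"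
    and \<psi>: "smooth \<psi>" "\<And>x. 0 \<le> \<psi> x \<and> \<psi> x \<le> 1" "(LINT x|M. \<bar>\<psi> x - indicator B x\<bar>) < \<epsilon> / 2"
    using assms(3,4) unfolding smoothly_approximable_def by (meson half_gt_zero)
  note [measurable] = smooth_borel_measurable[OF \<psi>(1)] smooth_borel_measurable[OF \<phi>(1)] meas
  \<comment> \<open>Probabilistic sum of the two approximants: it stays in [0, 1], and its error is
    at most the sum of the two errors.\<close>
  define \<eta> where "\<eta> = (\<lambda>x. \<phi> x + \<psi> x - \<phi> x * \<psi> x)"
  have sm: "smooth \<eta>" unfolding \<eta>_def by (intro smooth_diff smooth_add smooth_mult \<phi> \<psi>)
  note [measurable] = smooth_borel_measurable[OF sm]
  have \<eta>: "1 - \<eta> x = (1 - \<phi> x) * (1 - \<psi> x)" for x by (simp add: \<eta>_def algebra_simps)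
  have \<eta>_bounds: "0 \<le> \<eta> x \<and> \<eta> x \<le> 1" for x
  proof -
    have "0 \<le> (1 - \<phi> x) * (1 - \<psi> x)" "(1 - \<phi> x) * (1 - \<psi> x) \<le> 1"
      using \<phi>(2)[of x] \<psi>(2)[of x] by (auto intro!: mult_le_one)
    then show ?thesis using \<eta>[of x] by linarith
  qed
  have b: "\<bar>f x - indicator C x\<bar> \<le> 1" if "0 \<le> f x \<and> f x \<le> 1" for C x and f :: "real \<Rightarrow> real"
    using that by (auto simp: indicator_def)
  have i: "integrable M (\<lambda>x. \<bar>\<phi> x - indicator A x\<bar>)" "integrable M (\<lambda>x. \<bar>\<psi> x - indicator B x\<bar>)"
    "integrable M (\<lambda>x. \<bar>\<eta> x - indicator (A \<union> B) x\<bar>)"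
    by (rule integrable_bounded_finite_borel[OF M, where C=1], measurable, use b \<phi>(2) \<psi>(2) \<eta>_bounds in force)+
  have "\<bar>\<eta> x - indicator (A \<union> B) x\<bar> \<le> \<bar>\<phi> x - indicator A x\<bar> + \<bar>\<psi> x - indicator B x\<bar>" for x
  proof -
    have "\<phi> x * \<psi> x \<le> \<phi> x" "\<phi> x * \<psi> x \<le> \<psi> x" "0 \<le> \<phi> x * \<psi> x"
      using \<phi>(2)[of x] \<psi>(2)[of x] by (auto intro!: mult_left_le mult_right_le_one_le mult_left_le_one_le)
    then show ?thesis using \<phi>(2)[of x] \<psi>(2)[of x] \<eta>_bounds[of x]
      unfolding \<eta>_def indicator_def by auto
  qed
  then have "(LINT x|M. \<bar>\<eta> x - indicator (A \<union> B) x\<bar>)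
      \<le> (LINT x|M. \<bar>\<phi> x - indicator A x\<bar> + \<bar>\<psi> x - indicator B x\<bar>)"
    by (intro integral_mono[OF i(3) Bochner_Integration.integrable_add[OF i(1,2)]])
  also have "\<dots> < \<epsilon>" using Bochner_Integration.integral_add[OF i(1,2)] \<phi>(3) \<psi>(3) by simp
  finally show "\<exists>\<psi>. smooth \<psi> \<and> (\<forall>x. 0 \<le> \<psi> x \<and> \<psi> x \<le> 1) \<and> (LINT x|M. \<bar>\<psi> x - indicator (A \<union> B) x\<bar>) < \<epsilon>"
    using sm \<eta>_bounds by blast
qed

text \<open>Good-sets argument over the open half-lines, for which \<open>flat\<close> with
  parameter tending to 0 does the job. Countable unions are limits of finite ones.\<close>

lemma smoothly_approximable_borel:
  assumes "A \<in> sets borel" shows "smoothly_approximable M A"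
proof -
  from assms have "A \<in> sigma_sets UNIV (range greaterThan)"
    by (simp only: borel_eq_sigma_sets_greaterThan)
  then show ?thesis
  proof (induction rule: sigma_sets.induct)
    case (Basic A)
    then obtain a where A: "A = {a<..}" by auto
    show ?case unfolding smoothly_approximable_def
    proof (intro allI impI)
      fix \<epsilon> :: real assume "0 < \<epsilon>"
      let ?\<psi> = "\<lambda>n x. flat (1 / real (Suc n)) (- a + 1 * x)"
      have sm: "smooth (?\<psi> n)" for n by (intro smooth_affine smooth_flat) simp
      have lim: "(\<lambda>n. ?\<psi> n x) \<longlonglongrightarrow> indicator A x" for x
        using flat_tendsto_indicator[of "- a + 1 * x"] by (simp add: A indicator_def)
      have b: "0 \<le> ?\<psi> n x \<and> ?\<psi> n x \<le> 1" for n x by (simp add: flat_bounds)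
      have "(\<lambda>n. LINT x|M. \<bar>?\<psi> n x - indicator A x\<bar>) \<longlonglongrightarrow> (LINT x|M. 0)"
      proof (rule integral_tendsto_bounded[OF M, where C=1])
        show "(\<lambda>n. \<bar>?\<psi> n x - indicator A x\<bar>) \<longlonglongrightarrow> 0" for x
          using tendsto_rabs[OF tendsto_diff[OF lim[of x] tendsto_const[of "indicator A x"]]] by simp
        show "\<bar>\<bar>?\<psi> n x - indicator A x\<bar>\<bar> \<le> 1" for n x using b[of n x] by (auto simp: indicator_def)
        show "(\<lambda>x. \<bar>?\<psi> n x - indicator A x\<bar>) \<in> borel_measurable borel" for n
          using smooth_borel_measurable[OF sm[of n]] unfolding A by measurable
      qed simp
      then have "(\<lambda>n. LINT x|M. \<bar>?\<psi> n x - indicator A x\<bar>) \<longlonglongrightarrow> 0" by simp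
      from order_tendstoD(2)[OF this \<open>0 < \<epsilon>\<close>]
      obtain n where "(LINT x|M. \<bar>?\<psi> n x - indicator A x\<bar>) < \<epsilon>" by (auto simp: eventually_sequentially)
      then show "\<exists>\<psi>. smooth \<psi> \<and> (\<forall>x. 0 \<le> \<psi> x \<and> \<psi> x \<le> 1) \<and> (LINT x|M. \<bar>\<psi> x - indicator A x\<bar>) < \<epsilon>"
        using sm b by (intro exI[of _ "?\<psi> n"]) simp
    qed
  next
    case Empty
    show ?case unfolding smoothly_approximable_def
      by (auto intro!: exI[of _ "\<lambda>x. 0"] smooth_const)
  next
    case (Compl A)
    show ?case unfolding smoothly_approximable_def
    proof (intro allI impI)
      fix \<epsilon> :: real assume "0 < \<epsilon>"
      with Compl.IH obtain \<psi> where \<psi>: "smooth \<psi>" "\<And>x. 0 \<le> \<psi> x \<and> \<psi> x \<le> 1"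
        "(LINT x|M. \<bar>\<psi> x - indicator A x\<bar>) < \<epsilon>"
        unfolding smoothly_approximable_def by blast
      have "\<bar>(1 - \<psi> x) - indicator (UNIV - A) x\<bar> = \<bar>\<psi> x - indicator A x\<bar>" for x
        by (auto simp: indicator_def)
      with \<psi> show "\<exists>\<psi>. smooth \<psi> \<and> (\<forall>x. 0 \<le> \<psi> x \<and> \<psi> x \<le> 1) \<and> (LINT x|M. \<bar>\<psi> x - indicator (UNIV - A) x\<bar>) < \<epsilon>"
        by (intro exI[of _ "\<lambda>x. 1 - \<psi> x"]) (auto intro: smooth_diff smooth_const)
    qed
  next
    case (Union A)
    have A: "A n \<in> sets borel" for n
      using Union.hyps by (simp only: borel_eq_sigma_sets_greaterThan)
    have fin: "smoothly_approximable M (\<Union>i<n. A i)" for n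
    proof (induction n)
      case 0
      show ?case unfolding smoothly_approximable_def
        by (auto intro!: exI[of _ "\<lambda>x. 0"] smooth_const)
    next
      case (Suc n)
      have "smoothly_approximable M (A n \<union> (\<Union>i<n. A i))"
        using A by (intro smoothly_approximable_Un Suc Union.IH) auto
      then show ?case by (simp add: lessThan_Suc)
    qed
    show ?case
      by (rule smoothly_approximable_limit[OF _ _ fin LIMSEQ_indicator_UN]) (use A in auto)
  qed
qed

text \<open>Multiplying by windows that increase to the indicator of the open interval forces the
  support; in the limit the error can only shrink, since A lies inside that interval.\<close>

lemma indicator_approx_supported:
  assumes A: "A \<in> sets borel" "A \<subseteq> {a<..<b}" and "0 < \<epsilon>"
  shows "\<exists>\<psi>. smooth \<psi> \<and> (\<forall>x. 0 \<le> \<psi> x \<and> \<psi> x \<le> 1) \<and> (\<forall>x. x \<notin> {a<..<b} \<longrightarrow> \<psi> x = 0) \<and>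
     (LINT x|M. \<bar>\<psi> x - indicator A x\<bar>) < \<epsilon>"
proof -
  obtain \<psi> where \<psi>: "smooth \<psi>" "\<And>x. 0 \<le> \<psi> x \<and> \<psi> x \<le> 1" "(LINT x|M. \<bar>\<psi> x - indicator A x\<bar>) < \<epsilon>"
    using smoothly_approximable_borel[OF A(1)] \<open>0 < \<epsilon>\<close> unfolding smoothly_approximable_def by blast
  note [measurable] = smooth_borel_measurable[OF \<psi>(1)] A(1)
  let ?w = "\<lambda>n. window (1 / real (Suc n)) a b"
  have w: "smooth (?w n)" "0 \<le> ?w n x" "?w n x \<le> 1" for n x
    by (simp_all add: smooth_window window_bounds)
  have [measurable]: "?w n \<in> borel_measurable borel" for n by (rule smooth_borel_measurable[OF w(1)])
  have b: "0 \<le> \<psi> x * ?w n x \<and> \<psi> x * ?w n x \<le> 1" for n x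
    using w(2)[of n x] w(3)[of n x] \<psi>(2)[of x] by (auto intro: mult_le_one)
  have bi: "\<bar>\<bar>s - indicator A x\<bar>\<bar> \<le> 1" if "0 \<le> s \<and> s \<le> 1" for s x :: real
    using that by (auto simp: indicator_def)
  have b1: "0 \<le> \<psi> x * indicator {a<..<b} x \<and> \<psi> x * indicator {a<..<b} x \<le> 1" for x
    using \<psi>(2)[of x] by (auto simp: indicator_def)
  have "(\<lambda>n. LINT x|M. \<bar>\<psi> x * ?w n x - indicator A x\<bar>) \<longlonglongrightarrow> (LINT x|M. \<bar>\<psi> x * indicator {a<..<b} x - indicator A x\<bar>)"
  proof (rule integral_tendsto_bounded[OF M, where C=1])
    show "(\<lambda>n. \<bar>\<psi> x * ?w n x - indicator A x\<bar>) \<longlonglongrightarrow> \<bar>\<psi> x * indicator {a<..<b} x - indicator A x\<bar>" for x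
      by (intro tendsto_rabs tendsto_diff tendsto_mult tendsto_const window_tendsto_indicator)
    show "\<bar>\<bar>\<psi> x * ?w n x - indicator A x\<bar>\<bar> \<le> 1" for n x using bi[OF b] .
  qed measurable
  moreover have "(LINT x|M. \<bar>\<psi> x * indicator {a<..<b} x - indicator A x\<bar>) < \<epsilon>"
  proof (rule le_less_trans[OF integral_mono \<psi>(3)])
    show "integrable M (\<lambda>x. \<bar>\<psi> x * indicator {a<..<b} x - indicator A x\<bar>)"
      by (rule integrable_bounded_finite_borel[OF M _ bi[OF b1]]) measurable
    show "integrable M (\<lambda>x. \<bar>\<psi> x - indicator A x\<bar>)"
      by (rule integrable_bounded_finite_borel[OF M _ bi[OF \<psi>(2)]]) measurable
    show "\<bar>\<psi> x * indicator {a<..<b} x - indicator A x\<bar> \<le> \<bar>\<psi> x - indicator A x\<bar>" for x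
      using A(2) by (auto simp: indicator_def)
  qed
  ultimately have "\<forall>\<^sub>F n in sequentially. (LINT x|M. \<bar>\<psi> x * ?w n x - indicator A x\<bar>) < \<epsilon>"
    by (rule order_tendstoD(2))
  then obtain n where n: "(LINT x|M. \<bar>\<psi> x * ?w n x - indicator A x\<bar>) < \<epsilon>"
    by (auto simp: eventually_sequentially)
  have "smooth (\<lambda>x. \<psi> x * ?w n x)" by (rule smooth_mult[OF \<psi>(1) w(1)])
  moreover have "\<psi> x * ?w n x = 0" if "x \<notin> {a<..<b}" for x using that by (simp add: window_eq_0)
  ultimately show ?thesis using b n by blast
qed

end

section \<open>Test functions determine the distributional derivative\<close>

lemma integrable_test_function:
  assumes "finite_borel_measure M" "test_function \<phi>" shows "integrable M \<phi>"
proof -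
  obtain C where "\<And>x. \<bar>\<phi> x\<bar> \<le> C" using test_function_bounded[OF assms(2)] by blast
  then show ?thesis
    using assms by (intro integrable_bounded_finite_borel) (auto intro: smooth_borel_measurable simp: test_function_def)
qed

lemma test_function_borel_measurable: "test_function \<phi> \<Longrightarrow> \<phi> \<in> borel_measurable borel"
  by (simp add: test_function_def smooth_borel_measurable)

lemma integrable_lborel_test_function:
  assumes "test_function \<phi>" shows "integrable lborel \<phi>"
proof -
  obtain a where a: "\<And>x. x \<notin> {-a..a} \<Longrightarrow> \<phi> x = 0" using test_function_support[OF assms] by blast
  have "integrable lborel (\<lambda>x. indicator {-a..a} x *\<^sub>R \<phi> x)"
    using assms by (intro borel_integrable_compact smooth_continuous_on) (auto simp: test_function_def)
  moreover have "(\<lambda>x. indicator {-a..a} x *\<^sub>R \<phi> x) = \<phi>"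
    using a by (auto simp: indicator_def fun_eq_iff)
  ultimately show ?thesis by simp
qed

lemma test_function_add:
  assumes "test_function f" "test_function g" shows "test_function (\<lambda>x. f x + g x)"
proof -
  obtain a b where ab: "\<And>x. x \<notin> {-a..a} \<Longrightarrow> f x = 0" "\<And>x. x \<notin> {-b..b} \<Longrightarrow> g x = 0"
    using test_function_support[OF assms(1)] test_function_support[OF assms(2)] by blast
  have "f x + g x = 0" if "x \<notin> {- max a b..max a b}" for x
  proof -
    have "x \<notin> {-a..a}" "x \<notin> {-b..b}" using that by (auto simp: max_def split: if_splits)
    then show ?thesis using ab by simp
  qed
  with assms show ?thesis
    by (intro test_functionI[of _ "- max a b" "max a b"] smooth_add) (auto simp: test_function_def)
qed

lemma test_function_window: "0 < c \<Longrightarrow> test_function (window c a b)"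
  by (rule test_functionI[of _ a b]) (auto intro: smooth_window window_eq_0)

lemma signed_integral_tendsto:
  assumes D: "finite_signed_measure D" and A: "A \<in> sets borel"
    and "\<And>n. \<psi> n \<in> borel_measurable borel" "\<And>n x. \<bar>\<psi> n x\<bar> \<le> 1" "\<And>x. (\<lambda>n. \<psi> n x) \<longlonglongrightarrow> indicator A x"
  shows "(\<lambda>n. signed_integral D (\<psi> n)) \<longlonglongrightarrow> D A"
proof -
  have J: "jordan_decomposition D (pos_part D) (neg_part D)" by (rule jordan_decomposition_parts[OF D])
  then have fin: "finite_borel_measure (pos_part D)" "finite_borel_measure (neg_part D)"
    and DA: "D A = measure (pos_part D) A - measure (neg_part D) A"
    using A by (auto simp: jordan_decomposition_def)
  have "(\<lambda>n. signed_integral D (\<psi> n)) \<longlonglongrightarrow> (LINT x|pos_part D. indicator A x) - (LINT x|neg_part D. indicator A x)"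
    unfolding signed_integral_def
    using assms by (intro tendsto_diff integral_tendsto_bounded[where C=1] fin) auto
  then show ?thesis using DA fin A finite_borel_measureD by simp
qed

text \<open>Windows with parameters tending to 0 recover the mass of every open interval, and open
  intervals determine a signed measure.\<close>

lemma signed_measure_eqI:
  assumes D: "finite_signed_measure D" "finite_signed_measure D'"
    and eq: "\<And>\<phi>. test_function \<phi> \<Longrightarrow> signed_integral D \<phi> = signed_integral D' \<phi>"
  shows "D = D'"
proof
  have limeq: "D A = D' A" if "A \<in> sets borel" "\<And>x. (\<lambda>n. window (1 / real (Suc n)) (a n) (b n) x) \<longlonglongrightarrow> indicator A x" for A and a b :: "nat \<Rightarrow> real"
  proof (rule LIMSEQ_unique)
    have m: "window (1 / real (Suc n)) (a n) (b n) \<in> borel_measurable borel"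
      "\<bar>window (1 / real (Suc n)) (a n) (b n) x\<bar> \<le> 1" for n x
      using window_bounds[of "1 / real (Suc n)"] by (auto intro!: smooth_borel_measurable smooth_window)
    show "(\<lambda>n. signed_integral D (window (1 / real (Suc n)) (a n) (b n))) \<longlonglongrightarrow> D A"
      by (rule signed_integral_tendsto[OF D(1) that(1) m that(2)])
    have "(\<lambda>n. signed_integral D' (window (1 / real (Suc n)) (a n) (b n))) \<longlonglongrightarrow> D' A"
      by (rule signed_integral_tendsto[OF D(2) that(1) m that(2)])
    then show "(\<lambda>n. signed_integral D (window (1 / real (Suc n)) (a n) (b n))) \<longlonglongrightarrow> D' A"
      by (simp add: eq test_function_window)
  qed
  \<comment> \<open>The induction over open intervals subtracts from the whole line in its
    complement case. The total mass is reached by windows whose endpoints -n and n grow while the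
    parameter shrinks.\<close>
  have UNIV: "D UNIV = D' UNIV"
  proof (rule limeq[of _ "\<lambda>n. - real n" "\<lambda>n. real n"])
    fix x :: real
    have at_top: "filterlim (\<lambda>n. (s + real n) * real (Suc n)) at_top sequentially" for s
    proof (rule filterlim_at_top_mult_at_top)
      show "filterlim (\<lambda>n. s + real n) at_top sequentially"
        by (rule filterlim_tendsto_add_at_top[OF tendsto_const filterlim_real_sequentially])
      show "filterlim (\<lambda>n. real (Suc n)) at_top sequentially"
        by (rule filterlim_compose[OF filterlim_real_sequentially filterlim_Suc])
    qed
    have 1: "(\<lambda>n. flat (1 / real (Suc n)) (s + real n)) \<longlonglongrightarrow> 1" for s
    proof -
      have "(\<lambda>n. exp (- inverse ((s + real n) * real (Suc n)))) \<longlonglongrightarrow> exp (- 0)"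
        by (intro tendsto_exp tendsto_minus tendsto_inverse_0_at_top at_top)
      moreover have "\<forall>\<^sub>F n in sequentially. exp (- inverse ((s + real n) * real (Suc n))) = flat (1 / real (Suc n)) (s + real n)"
        using eventually_gt_at_top[of "nat \<lceil>\<bar>s\<bar>\<rceil>"]
      proof eventually_elim
        case (elim n)
        then have "0 < s + real n" by linarith
        then show ?case by (simp add: flat_def divide_inverse)
      qed
      ultimately show ?thesis by (auto intro: Lim_transform_eventually)
    qed
    show "(\<lambda>n. window (1 / real (Suc n)) (- real n) (real n) x) \<longlonglongrightarrow> indicator UNIV x"
      unfolding window_def using tendsto_mult[OF 1[of x] 1[of "- x"]] by simp
  qed simp
  fix A show "D A = D' A"
  proof (cases "A \<in> sets borel")
    case True
    let ?G = "range (\<lambda>(a, b). {a<..<b :: real})"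
    have Int: "Int_stable ?G"
      unfolding Int_stable_def
    proof (intro ballI)
      fix X Y assume "X \<in> ?G" "Y \<in> ?G"
      then obtain a b c d where "X = {a<..<b}" "Y = {c<..<d}" by auto
      then have "X \<inter> Y = (\<lambda>(a, b). {a<..<b}) (max a c, min b d)" by auto
      then show "X \<inter> Y \<in> ?G" by (simp only: rangeI)
    qed
    have borel: "sets borel = sigma_sets UNIV ?G"
      by (subst borel_eq_box) (simp add: sets_measure_of box_real image_def case_prod_beta)
    have Pow: "?G \<subseteq> Pow UNIV" by simp
    from True borel have "A \<in> sigma_sets UNIV ?G" by simp
    with Int Pow show ?thesis
    proof (induction rule: sigma_sets_induct_disjoint)
      case (basic A)
      then obtain a b where A: "A = {a<..<b}" by auto
      show ?case unfolding A
        by (rule limeq[of _ "\<lambda>_. a" "\<lambda>_. b"]) (simp, rule window_tendsto_indicator)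
    next
      case empty
      show ?case using signed_empty[OF D(1)] signed_empty[OF D(2)] by simp
    next
      case (compl A)
      then have "A \<in> sets borel" using borel by simp
      then have "D (A \<union> (UNIV - A)) = D A + D (UNIV - A)" "D' (A \<union> (UNIV - A)) = D' A + D' (UNIV - A)"
        by (intro signed_Un D; auto)+
      then show ?case using compl(2) UNIV by simp
    next
      case (union A)
      then have "range A \<subseteq> sets borel" using borel by simp
      from signed_sums[OF D(1) this union(1)] signed_sums[OF D(2) this union(1)]
      show ?case using union(3) sums_unique2 by simp
    qed
  qed (use D in \<open>simp add: finite_signed_measure_def\<close>)
qed

lemma distributional_derivative_unique:
  assumes "distributional_derivative u D" "distributional_derivative u D'" shows "D = D'"
  using assms by (intro signed_measure_eqI) (auto simp: distributional_derivative_def)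

lemma distributional_derivative_Du:
  assumes "u \<in> BV" shows "distributional_derivative u (Du u)"
proof -
  obtain D where D: "distributional_derivative u D" using assms by (auto simp: BV_def)
  then show ?thesis
    unfolding Du_def by (rule theI[of "distributional_derivative u" D]) (rule distributional_derivative_unique[OF _ D])
qed

text \<open>Induction over integrable functions reduces this to the indicator of a set of finite
  measure. There smooth approximation is available only for finite measures on bounded sets, so the
  set is first truncated and Lebesgue measure restricted to a bounded interval.\<close>

lemma test_function_dense:
  assumes "integrable lborel f" "0 < \<epsilon>"
  shows "\<exists>g. test_function g \<and> (LINT x|lborel. \<bar>f x - g x\<bar>) < \<epsilon>"
  using assms
proof (induction f arbitrary: \<epsilon> rule: integrable_induct)
  case (base A c)
  note [measurable] = base(1)
  have Ai: "integrable lborel (indicator A :: real \<Rightarrow> real)"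
    using base by (simp add: integrable_indicator_iff)
  \<comment> \<open>The two errors, truncation and smoothing, cost |c| * 2 * delta together; adding
    1 to |c| covers c = 0 and makes the final inequality strict.\<close>
  define \<delta> where "\<delta> = \<epsilon> / (2 * (\<bar>c\<bar> + 1))"
  have "0 < \<delta>" using base(3) by (simp add: \<delta>_def)
  let ?A = "\<lambda>n. A \<inter> {- real n<..<real n}"
  have "(\<lambda>n. LINT x|lborel. \<bar>indicator A x - indicator (?A n) x :: real\<bar>) \<longlonglongrightarrow> (LINT x|(lborel :: real measure). (0 :: real))"
  proof (rule integral_dominated_convergence[where w="indicat_real A"])
    show "AE x in lborel. (\<lambda>n. \<bar>indicator A x - indicator (?A n) x :: real\<bar>) \<longlonglongrightarrow> 0"
    proof (intro AE_I2)
      fix x :: real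
      have "\<forall>\<^sub>F n in sequentially. \<bar>indicator A x - indicator (?A n) x :: real\<bar> = 0"
        using eventually_gt_at_top[of "nat \<lceil>\<bar>x\<bar>\<rceil>"]
      proof eventually_elim
        case (elim n)
        then have "\<bar>x\<bar> < real n" by linarith
        then show ?case by (auto simp: indicator_def)
      qed
      then show "(\<lambda>n. \<bar>indicator A x - indicator (?A n) x :: real\<bar>) \<longlonglongrightarrow> 0"
        by (rule tendsto_eventually)
    qed
  qed (use Ai in \<open>auto simp: indicator_def\<close>)
  then have "(\<lambda>n. LINT x|lborel. \<bar>indicator A x - indicator (?A n) x :: real\<bar>) \<longlonglongrightarrow> 0" by simp
  from order_tendstoD(2)[OF this \<open>0 < \<delta>\<close>]
  obtain n where n: "(LINT x|lborel. \<bar>indicator A x - indicator (?A n) x :: real\<bar>) < \<delta>"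
    by (auto simp: eventually_sequentially)
  let ?S = "{- real n<..<real n}"
  define M where "M = density lborel (\<lambda>x. ennreal (indicator ?S x))"
  have "emeasure M UNIV = ennreal (2 * real n)"
    by (simp add: M_def emeasure_density ennreal_indicator)
  then have "finite_borel_measure M"
    unfolding finite_borel_measure_def by (auto simp: M_def intro!: finite_measureI)
  from indicator_approx_supported[OF this, of "?A n" "- real n" "real n" \<delta>] base(1) \<open>0 < \<delta>\<close>
  obtain \<psi> where \<psi>: "smooth \<psi>" "\<And>x. x \<notin> ?S \<Longrightarrow> \<psi> x = 0" "\<And>x. 0 \<le> \<psi> x \<and> \<psi> x \<le> 1"
    "(LINT x|M. \<bar>\<psi> x - indicator (?A n) x\<bar>) < \<delta>"
    by auto
  note [measurable] = smooth_borel_measurable[OF \<psi>(1)]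
  have "(LINT x|M. \<bar>\<psi> x - indicator (?A n) x\<bar>) = (LINT x|lborel. indicator ?S x *\<^sub>R \<bar>\<psi> x - indicator (?A n) x\<bar>)"
    unfolding M_def by (subst integral_density) auto
  also have "\<dots> = (LINT x|lborel. \<bar>\<psi> x - indicator (?A n) x\<bar>)"
    by (intro Bochner_Integration.integral_cong refl) (use \<psi>(2) in \<open>auto simp: indicator_def\<close>)
  finally have \<psi>4: "(LINT x|lborel. \<bar>\<psi> x - indicator (?A n) x\<bar>) < \<delta>" using \<psi>(4) by simp
  have \<psi>i: "integrable lborel \<psi>"
  proof (rule Bochner_Integration.integrable_bound[of lborel "indicator ?S :: real \<Rightarrow> real"])
    show "AE x in lborel. norm (\<psi> x) \<le> norm (indicator ?S x :: real)"
      using \<psi>(2,3) by (intro AE_I2) (auto simp: indicator_def)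
  qed (auto simp: integrable_indicator_iff)
  have Ani: "integrable lborel (indicator (?A n) :: real \<Rightarrow> real)"
    by (rule Bochner_Integration.integrable_bound[OF Ai]) (auto simp: indicator_def)
  have "(LINT x|lborel. \<bar>indicator A x *\<^sub>R c - c * \<psi> x\<bar>)
      \<le> (LINT x|lborel. \<bar>c\<bar> * (\<bar>indicator A x - indicator (?A n) x\<bar> + \<bar>\<psi> x - indicator (?A n) x\<bar>))"
  proof (rule integral_mono)
    fix x
    have "\<bar>indicator A x *\<^sub>R c - c * \<psi> x\<bar> = \<bar>c\<bar> * \<bar>indicator A x - \<psi> x\<bar>"
      by (simp add: algebra_simps flip: abs_mult)
    also have "\<dots> \<le> \<bar>c\<bar> * (\<bar>indicator A x - indicator (?A n) x\<bar> + \<bar>\<psi> x - indicator (?A n) x\<bar>)"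
      by (rule mult_left_mono) linarith+
    finally show "\<bar>indicator A x *\<^sub>R c - c * \<psi> x\<bar> \<le> \<dots>" .
  qed (use Ai Ani \<psi>i in auto)
  also have "\<dots> = \<bar>c\<bar> * ((LINT x|lborel. \<bar>indicator A x - indicator (?A n) x :: real\<bar>) + (LINT x|lborel. \<bar>\<psi> x - indicator (?A n) x\<bar>))"
    using Ai Ani \<psi>i by simp
  also have "\<dots> \<le> \<bar>c\<bar> * (\<delta> + \<delta>)" using n \<psi>4 by (intro mult_left_mono) auto
  also have "\<dots> < (\<bar>c\<bar> + 1) * (\<delta> + \<delta>)" using \<open>0 < \<delta>\<close> by simp
  also have "\<dots> = \<delta> * (2 * (\<bar>c\<bar> + 1))" by (simp add: algebra_simps)
  also have "\<dots> = \<epsilon>" unfolding \<delta>_def by (rule nonzero_eq_divide_eq[THEN iffD1]) auto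
  finally show ?case
    using \<psi> by (intro exI[of _ "\<lambda>x. c * \<psi> x"]) (auto intro!: test_functionI[of _ "- real n" "real n"] smooth_mult smooth_const)
next
  case (add f g)
  from add.IH(1)[of "\<epsilon> / 2"] add.IH(2)[of "\<epsilon> / 2"] add.prems
  obtain \<phi> \<psi> where \<phi>: "test_function \<phi>" "(LINT x|lborel. \<bar>f x - \<phi> x\<bar>) < \<epsilon> / 2"
    and \<psi>: "test_function \<psi>" "(LINT x|lborel. \<bar>g x - \<psi> x\<bar>) < \<epsilon> / 2" by auto
  have i: "integrable lborel \<phi>" "integrable lborel \<psi>" using \<phi> \<psi> by (auto intro: integrable_lborel_test_function)
  have "(LINT x|lborel. \<bar>f x + g x - (\<phi> x + \<psi> x)\<bar>) \<le> (LINT x|lborel. \<bar>f x - \<phi> x\<bar> + \<bar>g x - \<psi> x\<bar>)"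
    using add.hyps i by (intro integral_mono) auto
  also have "\<dots> < \<epsilon>" using add.hyps i \<phi> \<psi> by simp
  finally show ?case using test_function_add[OF \<phi>(1) \<psi>(1)] by blast
next
  case (lim f s)
  have i: "integrable lborel f" "\<And>n. integrable lborel (s n)" using lim by auto
  have "(\<lambda>n. LINT x|lborel. \<bar>f x - s n x\<bar>) \<longlonglongrightarrow> (LINT x|(lborel :: real measure). (0 :: real))"
  proof (rule integral_dominated_convergence[where w="\<lambda>x. 3 * \<bar>f x\<bar>"])
    show "AE x in lborel. (\<lambda>n. \<bar>f x - s n x\<bar>) \<longlonglongrightarrow> 0"
    proof (intro AE_I2)
      fix x :: real
      show "(\<lambda>n. \<bar>f x - s n x\<bar>) \<longlonglongrightarrow> 0"
        using tendsto_rabs[OF tendsto_diff[OF tendsto_const[of "f x"] lim.hyps(2)[of x]]] by simp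
    qed
    show "AE x in lborel. norm \<bar>f x - s n x\<bar> \<le> 3 * \<bar>f x\<bar>" for n
    proof (intro AE_I2)
      fix x :: real
      show "norm \<bar>f x - s n x\<bar> \<le> 3 * \<bar>f x\<bar>" using lim.hyps(3)[of x n] by simp
    qed
  qed (use i in auto)
  then have "(\<lambda>n. LINT x|lborel. \<bar>f x - s n x\<bar>) \<longlonglongrightarrow> 0" by simp
  from order_tendstoD(2)[OF this, of "\<epsilon> / 2"] lim.prems
  obtain n where n: "(LINT x|lborel. \<bar>f x - s n x\<bar>) < \<epsilon> / 2" by (auto simp: eventually_sequentially)
  from lim.IH[of "\<epsilon> / 2" n] lim.prems obtain \<phi> where
    \<phi>: "test_function \<phi>" "(LINT x|lborel. \<bar>s n x - \<phi> x\<bar>) < \<epsilon> / 2" by auto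
  have i': "integrable lborel \<phi>" using \<phi> by (auto intro: integrable_lborel_test_function)
  have "(LINT x|lborel. \<bar>f x - \<phi> x\<bar>) \<le> (LINT x|lborel. \<bar>f x - s n x\<bar> + \<bar>s n x - \<phi> x\<bar>)"
    using i i' by (intro integral_mono) auto
  also have "\<dots> < \<epsilon>" using i i' \<phi> n by simp
  finally show ?case using \<phi>(1) by blast
qed

section \<open>Mollification\<close>

text \<open>Convolution of f with the image under h of the signed measure with density u. The
  general h lets differentiation and the L^1 bound be proved once, although only affine contractions
  are used later.\<close>

definition smear :: "(real \<Rightarrow> real) \<Rightarrow> (real \<Rightarrow> real) \<Rightarrow> (real \<Rightarrow> real) \<Rightarrow> real \<Rightarrow> real" where
  "smear f h u x = (LINT z|lborel. f (x - h z) * u z)"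

lemma integrable_smear:
  assumes f: "test_function f" and u: "integrable lborel u" and [measurable]: "h \<in> borel_measurable borel"
  shows "integrable lborel (\<lambda>z. f (x - h z) * u z)"
proof -
  note [measurable] = test_function_borel_measurable[OF f] borel_measurable_integrable[OF u]
  obtain C where C: "0 < C" "\<And>x. \<bar>f x\<bar> \<le> C" using test_function_bounded[OF f] by blast
  show ?thesis
  proof (rule Bochner_Integration.integrable_bound[OF integrable_mult_right[OF u, of C]])
    show "AE z in lborel. norm (f (x - h z) * u z) \<le> norm (C * u z)"
      using C by (intro AE_I2) (simp add: abs_mult mult_right_mono)
  qed measurable
qed

text \<open>The difference quotients of f are bounded by a bound C of its derivative, so C * |u|
  dominates and the limit passes under the integral.\<close>

lemma smear_has_derivative:
  assumes f: "test_function f" and u: "integrable lborel u" and h[measurable]: "h \<in> borel_measurable borel"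
  shows "(smear f h u has_real_derivative smear (deriv f) h u x) (at x)"
proof -
  have smf: "smooth f" using f by (simp add: test_function_def)
  note [measurable] = test_function_borel_measurable[OF f] borel_measurable_integrable[OF u]
    test_function_borel_measurable[OF test_function_deriv[OF f]]
  obtain C where C: "0 < C" "\<And>x. \<bar>deriv f x\<bar> \<le> C"
    using test_function_bounded[OF test_function_deriv[OF f]] by blast
  have lip: "\<bar>f a - f b\<bar> \<le> C * \<bar>a - b\<bar>" for a b
    using field_differentiable_bound[of UNIV f "deriv f" C a b] C smooth_has_derivative[OF smf] by simp
  have "((\<lambda>t. (smear f h u (x + t) - smear f h u x) / t) \<longlongrightarrow> smear (deriv f) h u x) (at 0)"
    unfolding tendsto_at_iff_sequentially
  proof (intro allI impI)
    fix t :: "nat \<Rightarrow> real" assume t: "\<forall>i. t i \<in> UNIV - {0}" "t \<longlonglongrightarrow> 0"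
    have lim: "(\<lambda>n. LINT z|lborel. (f (x + t n - h z) - f (x - h z)) / t n * u z) \<longlonglongrightarrow> (LINT z|lborel. deriv f (x - h z) * u z)"
    proof (rule integral_dominated_convergence[where w="\<lambda>z. C * \<bar>u z\<bar>"])
      show "AE z in lborel. (\<lambda>n. (f (x + t n - h z) - f (x - h z)) / t n * u z) \<longlonglongrightarrow> deriv f (x - h z) * u z"
      proof (intro AE_I2 tendsto_mult tendsto_const)
        fix z :: real
        have "((\<lambda>s. (f (x - h z + s) - f (x - h z)) / s) \<longlongrightarrow> deriv f (x - h z)) (at 0)"
          using smooth_has_derivative[OF smf, of "x - h z"] by (simp add: DERIV_def)
        then have "(\<lambda>n. (f (x - h z + t n) - f (x - h z)) / t n) \<longlonglongrightarrow> deriv f (x - h z)"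
          using t unfolding tendsto_at_iff_sequentially comp_def by blast
        then show "(\<lambda>n. (f (x + t n - h z) - f (x - h z)) / t n) \<longlonglongrightarrow> deriv f (x - h z)"
          by (simp add: algebra_simps)
      qed
      show "AE z in lborel. norm ((f (x + t n - h z) - f (x - h z)) / t n * u z) \<le> C * \<bar>u z\<bar>" for n
      proof (intro AE_I2)
        fix z :: real
        have "\<bar>f (x + t n - h z) - f (x - h z)\<bar> \<le> C * \<bar>t n\<bar>" using lip[of "x + t n - h z" "x - h z"] by simp
        then have "\<bar>(f (x + t n - h z) - f (x - h z)) / t n\<bar> \<le> C" using t(1) by (simp add: divide_simps)
        then show "norm ((f (x + t n - h z) - f (x - h z)) / t n * u z) \<le> C * \<bar>u z\<bar>"
          by (simp only: real_norm_def abs_mult) (rule mult_right_mono, auto)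
      qed
    qed (use u in auto)
    have eq: "(LINT z|lborel. (f (x + t n - h z) - f (x - h z)) / t n * u z) = (smear f h u (x + t n) - smear f h u x) / t n" for n
    proof -
      have "(LINT z|lborel. (f (x + t n - h z) - f (x - h z)) / t n * u z)
        = (LINT z|lborel. (f (x + t n - h z) * u z - f (x - h z) * u z) / t n)"
        by (simp add: algebra_simps diff_divide_distrib)
      also have "\<dots> = (smear f h u (x + t n) - smear f h u x) / t n"
        unfolding smear_def using integrable_smear[OF f u h] by simp
      finally show ?thesis .
    qed
    show "((\<lambda>s. (smear f h u (x + s) - smear f h u x) / s) \<circ> t) \<longlonglongrightarrow> smear (deriv f) h u x"
      using lim unfolding eq smear_def[of "deriv f" h u x, symmetric] comp_def .
  qed
  then show ?thesis by (simp add: DERIV_def)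
qed

lemma smooth_smear:
  assumes "test_function f" "integrable lborel u" "h \<in> borel_measurable borel"
  shows "smooth (smear f h u)"
proof (rule smooth_if_derivative_closed[of "(\<lambda>f. smear f h u) ` Collect test_function"])
  fix g assume "g \<in> (\<lambda>f. smear f h u) ` Collect test_function"
  then obtain f where "test_function f" "g = smear f h u" by auto
  then show "\<exists>f'\<in>(\<lambda>f. smear f h u) ` Collect test_function. \<forall>x. (g has_real_derivative f' x) (at x)"
    using smear_has_derivative[OF _ assms(2,3)] test_function_deriv
    by (intro bexI[of _ "smear (deriv f) h u"]) auto
qed (use assms in auto)

lemma smear_diff:
  assumes "test_function f" "integrable lborel u" "integrable lborel v" "h \<in> borel_measurable borel"
  shows "smear f h (\<lambda>x. u x - v x) x = smear f h u x - smear f h v x"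
  using integrable_smear[OF assms(1,2,4)] integrable_smear[OF assms(1,3,4)]
  by (simp add: smear_def right_diff_distrib)

text \<open>By Tonelli the x-integral can be taken first, and translation invariance gives every
  shifted copy of f mass 1, whatever h is. Since the bound does not depend on h or on the width of
  f, it is uniform along the mollifications.\<close>

lemma smear_contraction:
  assumes f: "test_function f" "\<And>x. 0 \<le> f x" "(LINT x|lborel. f x) = 1"
    and u: "integrable lborel u" and h[measurable]: "h \<in> borel_measurable borel"
  shows "integrable lborel (smear f h u)"
    and "(LINT x|lborel. \<bar>smear f h u x\<bar>) \<le> (LINT x|lborel. \<bar>u x\<bar>)"
proof -
  note [measurable] = test_function_borel_measurable[OF f(1)] borel_measurable_integrable[OF u]
    smooth_borel_measurable[OF smooth_smear[OF f(1) u h]]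
  have f1: "(\<integral>\<^sup>+x. ennreal (f (x - y)) \<partial>lborel) = 1" for y
  proof -
    have "(\<integral>\<^sup>+x. ennreal (f x) \<partial>lborel) = (\<integral>\<^sup>+x. ennreal (f (- y + 1 * x)) \<partial>lborel)"
      by (subst nn_integral_real_affine[of _ 1 "- y"]) auto
    moreover have "(\<integral>\<^sup>+x. ennreal (f x) \<partial>lborel) = 1"
      using nn_integral_eq_integral[OF integrable_lborel_test_function[OF f(1)]] f by simp
    ultimately show ?thesis by (simp add: algebra_simps)
  qed
  have "(\<integral>\<^sup>+x. ennreal \<bar>smear f h u x\<bar> \<partial>lborel) \<le> (\<integral>\<^sup>+x. \<integral>\<^sup>+z. ennreal (f (x - h z) * \<bar>u z\<bar>) \<partial>lborel \<partial>lborel)"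
    using integral_norm_bound_ennreal[OF integrable_smear[OF f(1) u h]] f(2)
    by (intro nn_integral_mono) (simp add: smear_def abs_mult)
  also have "\<dots> = (\<integral>\<^sup>+z. \<integral>\<^sup>+x. ennreal (f (x - h z) * \<bar>u z\<bar>) \<partial>lborel \<partial>lborel)"
    by (rule lborel_pair.Fubini') measurable
  also have "\<dots> = (\<integral>\<^sup>+z. ennreal \<bar>u z\<bar> \<partial>lborel)"
    using f(2) f1 by (simp add: ennreal_mult nn_integral_multc)
  finally have le: "(\<integral>\<^sup>+x. ennreal \<bar>smear f h u x\<bar> \<partial>lborel) \<le> (\<integral>\<^sup>+z. ennreal \<bar>u z\<bar> \<partial>lborel)" .
  have eq: "(\<integral>\<^sup>+z. ennreal \<bar>u z\<bar> \<partial>lborel) = ennreal (LINT z|lborel. \<bar>u z\<bar>)"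
    using u by (intro nn_integral_eq_integral) auto
  show i: "integrable lborel (smear f h u)"
    using le unfolding eq by (intro integrableI_bounded) (auto intro: le_less_trans)
  have "ennreal (LINT x|lborel. \<bar>smear f h u x\<bar>) = (\<integral>\<^sup>+x. ennreal \<bar>smear f h u x\<bar> \<partial>lborel)"
    using i by (intro nn_integral_eq_integral[symmetric]) auto
  with le eq have "ennreal (LINT x|lborel. \<bar>smear f h u x\<bar>) \<le> ennreal (LINT z|lborel. \<bar>u z\<bar>)" by simp
  then show "(LINT x|lborel. \<bar>smear f h u x\<bar>) \<le> (LINT x|lborel. \<bar>u x\<bar>)"
    by (subst (asm) ennreal_le_iff) auto
qed

section \<open>The mollifier and contracted mollification\<close>

definition bump :: "real \<Rightarrow> real" where
  "bump x = window 1 (-1) 1 x / (LINT t|lborel. window 1 (-1) 1 t)"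

lemma integral_window_pos: "0 < (LINT t|lborel. window 1 (-1) 1 t)"
proof -
  have i: "integrable lborel (window 1 (-1) 1)"
    by (intro integrable_lborel_test_function test_function_window) simp
  have "(LINT t|lborel. window 1 (-1) 1 t) \<noteq> 0"
  proof
    assume "(LINT t|lborel. window 1 (-1) 1 t) = 0"
    then have "AE t in lborel. window 1 (-1) 1 t = 0"
      using integral_nonneg_eq_0_iff_AE[OF i] by (simp add: window_bounds)
    then have "AE t in lborel. t \<notin> {-1<..<1 :: real}"
      by (rule eventually_mono) (metis window_pos less_irrefl)
    then have "emeasure lborel {-1<..<1 :: real} = 0"
      by (rule AE_iff_measurable[THEN iffD1, rotated 2]) auto
    then show False by simp
  qed
  moreover have "0 \<le> (LINT t|lborel. window 1 (-1) 1 t)"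
    by (intro integral_nonneg_AE AE_I2) (simp add: window_bounds)
  ultimately show ?thesis by simp
qed

lemma test_function_cmult: "test_function f \<Longrightarrow> test_function (\<lambda>x. c * f x)"
  using test_function_support[of f]
  by (auto simp: test_function_def intro!: test_functionI[THEN test_function_def[THEN iffD1, THEN conjunct2]] smooth_mult smooth_const)

lemma test_function_bump: "test_function bump"
  using test_function_cmult[OF test_function_window, of 1 "inverse (LINT t|lborel. window 1 (-1) 1 t)" "-1" 1]
  by (simp add: bump_def[abs_def] field_simps)

lemma bump_nonneg: "0 \<le> bump x"
  using integral_window_pos by (simp add: bump_def window_bounds)

lemma bump_eq_0: "1 \<le> \<bar>x\<bar> \<Longrightarrow> bump x = 0"
  by (auto simp: bump_def intro!: window_eq_0)

lemma integral_bump: "(LINT x|lborel. bump x) = 1"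
  using integral_window_pos by (simp add: bump_def)

lemma integrable_bump: "integrable lborel bump"
  by (rule integrable_lborel_test_function[OF test_function_bump])

definition kern :: "real \<Rightarrow> real \<Rightarrow> real" where
  "kern e t = bump (t / e) / e"

lemma test_function_affine:
  assumes "test_function f" "b \<noteq> 0" shows "test_function (\<lambda>x. f (a + b * x))"
proof -
  obtain r where r: "\<And>x. x \<notin> {-r..r} \<Longrightarrow> f x = 0" using test_function_support[OF assms(1)] by blast
  let ?R = "(\<bar>a\<bar> + \<bar>r\<bar>) / \<bar>b\<bar>"
  have "f (a + b * x) = 0" if "x \<notin> {-?R..?R}" for x
  proof (rule r)
    have "?R < \<bar>x\<bar>" using that by auto
    then have "\<bar>a\<bar> + \<bar>r\<bar> < \<bar>b * x\<bar>" using assms(2) by (simp add: divide_simps abs_mult mult.commute)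
    then show "a + b * x \<notin> {-r..r}" by auto
  qed
  with assms(1) show ?thesis by (intro test_functionI[of _ "-?R" ?R] smooth_affine) (auto simp: test_function_def)
qed

lemma test_function_kern: "0 < e \<Longrightarrow> test_function (kern e)"
  using test_function_cmult[OF test_function_affine[OF test_function_bump], of "1 / e" "1 / e" 0]
  by (simp add: kern_def[abs_def])

lemma kern_nonneg: "0 < e \<Longrightarrow> 0 \<le> kern e t"
  by (simp add: kern_def bump_nonneg)

lemma kern_eq_0: "0 < e \<Longrightarrow> e \<le> \<bar>t\<bar> \<Longrightarrow> kern e t = 0"
  by (simp add: kern_def bump_eq_0)

lemma integral_kern:
  assumes "0 < e" shows "(LINT x|lborel. kern e (x - y) * g x) = (LINT s|lborel. bump s * g (y + e * s))"
proof -
  have "(LINT x|lborel. kern e (x - y) * g x) = \<bar>e\<bar> *\<^sub>R (LINT s|lborel. kern e (y + e * s - y) * g (y + e * s))"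
    by (rule lborel_integral_real_affine) (use assms in simp)
  also have "\<dots> = (LINT s|lborel. e * (kern e (y + e * s - y) * g (y + e * s)))" using assms by simp
  also have "\<dots> = (LINT s|lborel. bump s * g (y + e * s))"
    using assms by (intro Bochner_Integration.integral_cong) (auto simp: kern_def)
  finally show ?thesis .
qed

lemma integral_kern_1: "0 < e \<Longrightarrow> (LINT x|lborel. kern e x) = 1"
  using integral_kern[of e 0 "\<lambda>_. 1"] by (simp add: integral_bump)

text \<open>The contraction \<open>z \<mapsto> c + l * (z - c)\<close> towards \<open>c\<close> makes room for the mollification.\<close>

definition mollify :: "real \<Rightarrow> real \<Rightarrow> real \<Rightarrow> (real \<Rightarrow> real) \<Rightarrow> real \<Rightarrow> real" where
  "mollify c l e u = smear (kern e) (\<lambda>z. c + l * (z - c)) u"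

text \<open>The substitution turns the argument of the kernel into e * s and moves both parameters
  into the argument of u, where continuity can be used. The Jacobian e / l and the factor 1 / e of
  the kernel leave 1 / l.\<close>

lemma mollify_alt:
  assumes "0 < e" "0 < l"
  shows "mollify c l e u x = (LINT s|lborel. bump s * u (c + (x - c - e * s) / l)) / l"
proof -
  let ?t = "c + (x - c) / l" and ?k = "- e / l"
  have eq: "x - (c + l * (?t + ?k * s - c)) = e * s" "?t + ?k * s = c + (x - c - e * s) / l" for s
    using assms by (simp_all add: field_simps)
  have "mollify c l e u x = \<bar>?k\<bar> *\<^sub>R (LINT s|lborel. kern e (x - (c + l * (?t + ?k * s - c))) * u (?t + ?k * s))"
    unfolding mollify_def smear_def by (rule lborel_integral_real_affine) (use assms in simp)
  also have "\<dots> = \<bar>?k\<bar> *\<^sub>R (LINT s|lborel. (bump s * u (c + (x - c - e * s) / l)) / e)"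
    unfolding eq using assms by (simp add: kern_def)
  also have "\<dots> = (LINT s|lborel. bump s * u (c + (x - c - e * s) / l)) / l"
    using assms by simp
  finally show ?thesis .
qed

text \<open>Dominated convergence. Convergence is pointwise by continuity of g; the dominating
  constant 3 * C is 2 * C for the mollification, from 1 / l at most 2, plus C for g, on a common
  bounded interval.\<close>

lemma mollify_test_function_tendsto:
  assumes g: "test_function g" and l: "l \<longlonglongrightarrow> 1" "\<And>n. 1 / 2 \<le> l n" "\<And>n. l n \<le> 1"
    and e: "e \<longlonglongrightarrow> 0" "\<And>n. 0 < e n" "\<And>n. e n \<le> (1 :: real)"
  shows "(\<lambda>n. LINT x|lborel. \<bar>mollify c (l n) (e n) g x - g x\<bar>) \<longlonglongrightarrow> 0"
proof -
  have l0: "0 < l n" for n using l(2)[of n] by simp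
  note [measurable] = test_function_borel_measurable[OF g] test_function_borel_measurable[OF test_function_bump]
  have [measurable]: "mollify c (l n) (e n) g \<in> borel_measurable borel" for n
    unfolding mollify_def
    by (rule smooth_borel_measurable[OF smooth_smear[OF test_function_kern[OF e(2)] integrable_lborel_test_function[OF g]]]) measurable
  obtain C where C: "0 < C" "\<And>x. \<bar>g x\<bar> \<le> C" using test_function_bounded[OF g] by blast
  obtain a where a: "\<And>x. x \<notin> {-a..a} \<Longrightarrow> g x = 0" "0 < a" using test_function_support[OF g] by blast
  have pt: "(\<lambda>n. mollify c (l n) (e n) g x) \<longlonglongrightarrow> g x" for x
  proof -
    have "(\<lambda>n. LINT s|lborel. bump s * g (c + (x - c - e n * s) / l n)) \<longlonglongrightarrow> (LINT s|lborel. bump s * g x)"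
    proof (rule integral_dominated_convergence[where w="\<lambda>s. C * bump s"])
      show "AE s in lborel. (\<lambda>n. bump s * g (c + (x - c - e n * s) / l n)) \<longlonglongrightarrow> bump s * g x"
      proof (intro AE_I2 tendsto_mult tendsto_const)
        fix s :: real
        have "isCont g x" using smooth_has_derivative g unfolding test_function_def by (blast intro: DERIV_isCont)
        moreover have "(\<lambda>n. c + (x - c - e n * s) / l n) \<longlonglongrightarrow> c + (x - c - 0 * s) / 1"
          by (intro tendsto_intros l e) simp
        ultimately show "(\<lambda>n. g (c + (x - c - e n * s) / l n)) \<longlonglongrightarrow> g x"
          using isCont_tendsto_compose by fastforce
      qed
      show "AE s in lborel. norm (bump s * g (c + (x - c - e n * s) / l n)) \<le> C * bump s" for n
        using C bump_nonneg by (intro AE_I2) (auto simp: abs_mult mult.commute[of C] intro!: mult_left_mono)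
    qed (use integrable_bump in auto)
    then have "(\<lambda>n. (LINT s|lborel. bump s * g (c + (x - c - e n * s) / l n)) / l n) \<longlonglongrightarrow> (LINT s|lborel. bump s * g x) / 1"
      by (intro tendsto_divide l) auto
    then show ?thesis by (simp add: mollify_alt[OF e(2) l0] integral_bump)
  qed
  have bd: "\<bar>mollify c (l n) (e n) g x\<bar> \<le> 2 * C" for n x
  proof -
    have "\<bar>LINT s|lborel. bump s * g (c + (x - c - e n * s) / l n)\<bar> \<le> (LINT s|lborel. bump s * C)"
    proof (rule order_trans[OF integral_abs_bound integral_mono_AE'])
      show "AE s in lborel. \<bar>bump s * g (c + (x - c - e n * s) / l n)\<bar> \<le> bump s * C"
        using C bump_nonneg by (intro AE_I2) (auto simp: abs_mult intro!: mult_left_mono)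
    qed (use integrable_bump C bump_nonneg in \<open>auto intro!: AE_I2\<close>)
    also have "\<dots> = C" by (simp add: integral_bump)
    finally have "\<bar>mollify c (l n) (e n) g x\<bar> \<le> C / l n"
      using l0[of n] by (simp add: mollify_alt[OF e(2) l0] divide_right_mono)
    also have "\<dots> \<le> C / (1 / 2)" using l(2)[of n] C by (intro divide_left_mono) auto
    finally show ?thesis by simp
  qed
  \<comment> \<open>If |x| exceeds this and |s| < 1, then x - c - e * s has size more than a + |c|;
    dividing by l at most 1 only enlarges it, and adding c back still leaves the support of
    g.\<close>
  let ?B = "a + 2 * \<bar>c\<bar> + 1"
  have zero: "mollify c (l n) (e n) g x = 0" if "x \<notin> {-?B..?B}" for n x
  proof -
    have z: "bump s * g (c + (x - c - e n * s) / l n) = 0" for s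
    proof (cases "\<bar>s\<bar> \<ge> 1")
      case False
      have "\<bar>e n * s\<bar> \<le> 1" using e(2)[of n] e(3)[of n] False by (auto simp: abs_mult intro!: mult_le_one)
      moreover have "?B < \<bar>x\<bar>" using that by auto
      ultimately have "a + \<bar>c\<bar> < \<bar>x - c - e n * s\<bar>" by linarith
      also have "\<dots> \<le> \<bar>x - c - e n * s\<bar> / l n"
        using l(3)[of n] l0[of n] by (simp add: le_divide_eq mult_left_le)
      also have "\<dots> = \<bar>(x - c - e n * s) / l n\<bar>" using l0[of n] by simp
      finally show ?thesis by (intro mult_eq_0_iff[THEN iffD2] disjI2 a) auto
    qed (simp add: bump_eq_0)
    show ?thesis unfolding mollify_alt[OF e(2) l0] z by simp
  qed
  have "(\<lambda>n. LINT x|lborel. \<bar>mollify c (l n) (e n) g x - g x\<bar>) \<longlonglongrightarrow> (LINT x|(lborel :: real measure). (0 :: real))"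
  proof (rule integral_dominated_convergence[where w="\<lambda>x. 3 * C * indicat_real {-?B..?B} x"])
    show "AE x in lborel. (\<lambda>n. \<bar>mollify c (l n) (e n) g x - g x\<bar>) \<longlonglongrightarrow> 0"
    proof (intro AE_I2)
      fix x :: real
      show "(\<lambda>n. \<bar>mollify c (l n) (e n) g x - g x\<bar>) \<longlonglongrightarrow> 0"
        using tendsto_rabs[OF tendsto_diff[OF pt[of x] tendsto_const[of "g x"]]] by simp
    qed
    show "AE x in lborel. norm \<bar>mollify c (l n) (e n) g x - g x\<bar> \<le> 3 * C * indicat_real {-?B..?B} x" for n
    proof (intro AE_I2)
      fix x :: real
      show "norm \<bar>mollify c (l n) (e n) g x - g x\<bar> \<le> 3 * C * indicat_real {-?B..?B} x"
      proof (cases "x \<in> {-?B..?B}")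
        case True
        then show ?thesis using bd[of n x] C(2)[of x] by simp
      next
        case False
        then have "x \<notin> {-a..a}" by auto
        with False zero a(1) show ?thesis by simp
      qed
    qed
  qed (auto simp: integrable_indicator_iff emeasure_lborel_Icc_eq)
  then show ?thesis by simp
qed

text \<open>Density argument: u - g is small in L^1 for a test function g, its mollification is no
  larger by \<open>smear_contraction\<close>, and the case of g is known. Each of the three errors
  is below r / 3.\<close>

lemma mollify_L1_tendsto:
  assumes u: "integrable lborel u" and l: "l \<longlonglongrightarrow> 1" "\<And>n. 1 / 2 \<le> l n" "\<And>n. l n \<le> 1"
    and e: "e \<longlonglongrightarrow> 0" "\<And>n. 0 < e n" "\<And>n. e n \<le> (1 :: real)"
  shows "(\<lambda>n. LINT x|lborel. \<bar>mollify c (l n) (e n) u x - u x\<bar>) \<longlonglongrightarrow> 0"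
proof (rule LIMSEQ_I)
  fix r :: real assume "0 < r"
  obtain g where g: "test_function g" "(LINT x|lborel. \<bar>u x - g x\<bar>) < r / 3"
    using test_function_dense[OF u, of "r / 3"] \<open>0 < r\<close> by auto
  have gi: "integrable lborel g" by (rule integrable_lborel_test_function[OF g(1)])
  let ?M = "\<lambda>n. mollify c (l n) (e n)"
  have k: "test_function (kern (e n))" "\<And>x. 0 \<le> kern (e n) x" "(LINT x|lborel. kern (e n) x) = 1" for n
    using e(2)[of n] by (auto intro: test_function_kern kern_nonneg integral_kern_1)
  have h: "(\<lambda>z. c + l n * (z - c)) \<in> borel_measurable borel" for n by measurable
  have Mi: "integrable lborel (?M n v)" if "integrable lborel v" for n v
    unfolding mollify_def by (rule smear_contraction(1)[OF k that h])
  from LIMSEQ_D[OF mollify_test_function_tendsto[OF g(1) l e, of c], of "r / 3"] \<open>0 < r\<close>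
  obtain N where N: "\<And>n. n \<ge> N \<Longrightarrow> (LINT x|lborel. \<bar>?M n g x - g x\<bar>) < r / 3" by auto
  have "norm ((LINT x|lborel. \<bar>?M n u x - u x\<bar>) - 0) < r" if "n \<ge> N" for n
  proof -
    have "(LINT x|lborel. \<bar>?M n u x - u x\<bar>)
      \<le> (LINT x|lborel. \<bar>?M n (\<lambda>x. u x - g x) x\<bar> + \<bar>?M n g x - g x\<bar> + \<bar>u x - g x\<bar>)"
    proof (rule integral_mono)
      fix x
      have "?M n (\<lambda>x. u x - g x) x = ?M n u x - ?M n g x"
        unfolding mollify_def by (rule smear_diff[OF k(1) u gi h])
      then show "\<bar>?M n u x - u x\<bar> \<le> \<bar>?M n (\<lambda>x. u x - g x) x\<bar> + \<bar>?M n g x - g x\<bar> + \<bar>u x - g x\<bar>" by linarith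
    qed (use u gi Mi in auto)
    also have "\<dots> = (LINT x|lborel. \<bar>?M n (\<lambda>x. u x - g x) x\<bar>) + (LINT x|lborel. \<bar>?M n g x - g x\<bar>) + (LINT x|lborel. \<bar>u x - g x\<bar>)"
      using u gi Mi by simp
    also have "(LINT x|lborel. \<bar>?M n (\<lambda>x. u x - g x) x\<bar>) \<le> (LINT x|lborel. \<bar>u x - g x\<bar>)"
      unfolding mollify_def using u gi by (intro smear_contraction(2)[OF k _ h]) simp
    finally show ?thesis using N[OF that] g(2) by simp
  qed
  then show "\<exists>N. \<forall>n\<ge>N. norm ((LINT x|lborel. \<bar>?M n u x - u x\<bar>) - 0) < r" by blast
qed

text \<open>The x-derivative of the kernel is -1 / l times its derivative in z, and as a function of
  z the kernel is a test function, so the integration-by-parts formula applies. The contraction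
  accounts for the factor 1 / l.\<close>

lemma deriv_mollify:
  assumes u: "integrable lborel u" and "0 < e" "0 < l"
    and D: "\<And>\<phi>. test_function \<phi> \<Longrightarrow> (LINT x|lborel. u x * deriv \<phi> x) = - ((LINT x|M. \<phi> x) - (LINT x|N. \<phi> x))"
  shows "deriv (mollify c l e u) x =
    ((LINT z|M. kern e (x - (c + l * (z - c)))) - (LINT z|N. kern e (x - (c + l * (z - c))))) / l"
proof -
  define \<phi> where "\<phi> z = kern e (x - (c + l * (z - c)))" for z
  have \<phi>_alt: "\<phi> = (\<lambda>z. kern e ((x - c + l * c) + (- l) * z))"
    by (auto simp: \<phi>_def algebra_simps)
  have k: "test_function (kern e)" by (rule test_function_kern[OF \<open>0 < e\<close>])
  have \<phi>: "test_function \<phi>" unfolding \<phi>_alt using \<open>0 < l\<close> by (intro test_function_affine k) simp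
  have d\<phi>: "deriv \<phi> z = - l * deriv (kern e) (x - (c + l * (z - c)))" for z
  proof -
    have "(kern e has_real_derivative deriv (kern e) (x - (c + l * (z - c)))) (at (x - (c + l * (z - c))))"
      using k by (intro smooth_has_derivative) (simp add: test_function_def)
    moreover have "((\<lambda>z. x - (c + l * (z - c))) has_real_derivative - l) (at z)"
      by (auto intro!: derivative_eq_intros)
    ultimately have "((\<lambda>z. kern e (x - (c + l * (z - c)))) has_real_derivative
        deriv (kern e) (x - (c + l * (z - c))) * - l) (at z)"
      by (rule DERIV_chain2)
    then have "(\<phi> has_real_derivative - l * deriv (kern e) (x - (c + l * (z - c)))) (at z)"
      unfolding \<phi>_def by (simp add: mult.commute)
    then show ?thesis by (rule DERIV_imp_deriv)
  qed
  have "deriv (mollify c l e u) x = (LINT z|lborel. deriv (kern e) (x - (c + l * (z - c))) * u z)"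
    unfolding mollify_def using smear_has_derivative[OF k u] by (intro DERIV_imp_deriv) (simp add: smear_def)
  also have "\<dots> = (LINT z|lborel. (- 1 / l) * (u z * deriv \<phi> z))"
    using \<open>0 < l\<close> by (simp add: d\<phi> mult.commute)
  also have "\<dots> = (- 1 / l) * (LINT z|lborel. u z * deriv \<phi> z)" by (rule integral_mult_right_zero)
  also have "\<dots> = ((LINT z|M. \<phi> z) - (LINT z|N. \<phi> z)) / l" unfolding D[OF \<phi>] using \<open>0 < l\<close> by (simp add: field_simps)
  finally show ?thesis unfolding \<phi>_def .
qed

section \<open>The weight\<close>

text \<open>The constraints of \<open>A_BV\<close> other than bounded variation, holding everywhere
  instead of almost everywhere. Members of \<open>A_infty\<close> and suitable representatives of BV
  functions both satisfy it, so one set of weight estimates compares the two.\<close>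

definition profile :: "real \<Rightarrow> real \<Rightarrow> (real \<Rightarrow> real) \<Rightarrow> bool" where
  "profile R1 R2 v \<longleftrightarrow> integrable lborel v \<and> (\<forall>x. 0 \<le> v x) \<and> (\<forall>x. x \<notin> {R1..R2} \<longrightarrow> v x = 0) \<and>
     (LINT r|lborel. r\<^sup>2 * v r) = 1"

locale shell =
  fixes M1 M2 R1 R2 :: real
  assumes M1: "0 < M1" and M12: "M1 < M2" and M2R1: "2 * M2 < R1" and R12: "R1 < R2"
begin

abbreviation "F \<equiv> F_fun M1 M2 R1"
abbreviation "P \<equiv> P_fun R1"

definition W :: "(real \<Rightarrow> real) \<Rightarrow> real \<Rightarrow> real" where
  "W v r = r ^ 3 / sqrt (F v r)"

text \<open>Comes from 0 <= P <= 1, which gives m <= M2, together with r >= R1.\<close>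

definition F_lower :: real where "F_lower = 1 - 2 * M2 / R1"

lemma R1_pos: "0 < R1" using M1 M12 M2R1 by linarith

lemma F_lower_pos: "0 < F_lower"
  using M2R1 R1_pos by (simp add: F_lower_def)

lemma profile_moment_bound:
  assumes "x \<notin> {R1..R2} \<Longrightarrow> v x = 0"
  shows "\<bar>x\<^sup>2 * v x\<bar> \<le> R2\<^sup>2 * \<bar>v x\<bar>"
proof (cases "x \<in> {R1..R2}")
  case True
  then have "x\<^sup>2 \<le> R2\<^sup>2" using R1_pos by (intro power_mono) auto
  then show ?thesis by (simp add: abs_mult mult_right_mono)
qed (use assms in simp)

lemma integrable_moment:
  assumes "integrable lborel v" "\<And>x. x \<notin> {R1..R2} \<Longrightarrow> v x = 0"
  shows "integrable lborel (\<lambda>r. r\<^sup>2 * v r)"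
proof (rule Bochner_Integration.integrable_bound[OF integrable_mult_right[OF assms(1), of "R2\<^sup>2"]])
  show "(\<lambda>r. r\<^sup>2 * v r) \<in> borel_measurable lborel"
    using borel_measurable_integrable[OF assms(1)] by measurable
  show "AE x in lborel. norm (x\<^sup>2 * v x) \<le> norm (R2\<^sup>2 * v x)"
    using profile_moment_bound assms(2) by (intro AE_I2) (simp add: abs_mult)
qed

text \<open>A is left general for two uses: A = [R1, r] controls P, and A = UNIV controls the total
  mass in the normalisation.\<close>

lemma moment_abs_le:
  assumes "integrable lborel v" "\<And>x. x \<notin> {R1..R2} \<Longrightarrow> v x = 0" "A \<in> sets borel"
  shows "\<bar>LINT s|lborel. indicator A s * (s\<^sup>2 * v s)\<bar> \<le> R2\<^sup>2 * (LINT x|lborel. \<bar>v x\<bar>)"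
proof -
  have "\<bar>LINT s|lborel. indicator A s * (s\<^sup>2 * v s)\<bar> \<le> (LINT s|lborel. \<bar>indicator A s * (s\<^sup>2 * v s)\<bar>)"
    by (rule integral_abs_bound)
  also have "\<dots> \<le> (LINT s|lborel. R2\<^sup>2 * \<bar>v s\<bar>)"
  proof (rule integral_mono_AE')
    show "AE s in lborel. \<bar>indicator A s * (s\<^sup>2 * v s)\<bar> \<le> R2\<^sup>2 * \<bar>v s\<bar>"
    proof (intro AE_I2)
      fix s
      show "\<bar>indicator A s * (s\<^sup>2 * v s)\<bar> \<le> R2\<^sup>2 * \<bar>v s\<bar>"
        using profile_moment_bound[of s v] assms(2)[of s] by (cases "s \<in> A") auto
    qed
  qed (use assms in auto)
  finally show ?thesis by simp
qed

lemma P_lborel: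
  assumes "v \<in> borel_measurable borel"
  shows "P v r = (LINT s|lborel. indicator {R1..r} s * (s\<^sup>2 * v s))"
  unfolding P_fun_def set_lebesgue_integral_def
  using assms by (subst integral_completion) auto

lemma profile_measurable: "profile R1 R2 v \<Longrightarrow> v \<in> borel_measurable borel"
  using borel_measurable_integrable by (force simp: profile_def)

lemma profileD:
  assumes "profile R1 R2 v"
  shows "integrable lborel v" "\<And>x. 0 \<le> v x" "\<And>x. x \<notin> {R1..R2} \<Longrightarrow> v x = 0"
    "(LINT r|lborel. r\<^sup>2 * v r) = 1"
  using assms by (auto simp: profile_def)

lemma P_bounds:
  assumes v: "profile R1 R2 v" shows "0 \<le> P v r" "P v r \<le> 1"
proof -
  note v' = profileD[OF v]
  have i: "integrable lborel (\<lambda>r. r\<^sup>2 * v r)" by (rule integrable_moment[OF v'(1,3)])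
  show "0 \<le> P v r"
    unfolding P_lborel[OF profile_measurable[OF v]] using v'(2) by (intro integral_nonneg_AE AE_I2) auto
  have "P v r \<le> (LINT r|lborel. r\<^sup>2 * v r)"
    unfolding P_lborel[OF profile_measurable[OF v]]
    using v'(2) by (intro integral_mono_AE' i AE_I2) (auto simp: indicator_def)
  then show "P v r \<le> 1" using v'(4) by simp
qed

lemma continuous_on_P:
  assumes v: "profile R1 R2 v" shows "continuous_on {R1..R2} (P v)"
proof -
  note v' = profileD[OF v]
  have i: "integrable lborel (\<lambda>r. r\<^sup>2 * v r)" by (rule integrable_moment[OF v'(1,3)])
  have si: "set_integrable lborel {a..b} (\<lambda>r. r\<^sup>2 * v r)" for a b
    unfolding set_integrable_def using i by (intro integrable_mult_indicator) auto
  have "P v r = integral {R1..r} (\<lambda>r. r\<^sup>2 * v r)" for r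
    using set_borel_integral_eq_integral(2)[OF si[of R1 r]]
    by (simp add: P_lborel[OF profile_measurable[OF v]] set_lebesgue_integral_def)
  then show ?thesis
    using indefinite_integral_continuous_1[OF set_borel_integral_eq_integral(1)[OF si[of R1 R2]]]
    by (simp cong: continuous_on_cong)
qed

lemma P_diff_le:
  assumes v: "profile R1 R2 v" and w: "profile R1 R2 w"
  shows "\<bar>P v r - P w r\<bar> \<le> R2\<^sup>2 * (LINT x|lborel. \<bar>v x - w x\<bar>)"
proof -
  note v' = profileD[OF v] and w' = profileD[OF w]
  have si: "integrable lborel (\<lambda>s. indicator {R1..r} s * (s\<^sup>2 * v s))" if "profile R1 R2 v" for v
    using integrable_mult_indicator[OF _ integrable_moment[OF profileD(1,3)[OF that]], of "{R1..r}"] by simp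
  have "P v r - P w r = (LINT s|lborel. indicator {R1..r} s * (s\<^sup>2 * (v s - w s)))"
    using si[OF v] si[OF w]
    by (simp add: P_lborel[OF profile_measurable[OF v]] P_lborel[OF profile_measurable[OF w]] right_diff_distrib)
  then show ?thesis
    using v' w' by (simp only:) (rule moment_abs_le, auto)
qed

lemma F_bounds:
  assumes v: "profile R1 R2 v" and r: "r \<in> {R1..R2}"
  shows "F_lower \<le> F v r" "F v r \<le> 1"
proof -
  have "(M2 - M1) * P v r \<le> (M2 - M1) * 1" using P_bounds[OF v] M12 by (intro mult_left_mono) auto
  then have m: "m_fun M1 M2 R1 v r \<le> M2" by (simp add: m_fun_def)
  have "0 \<le> (M2 - M1) * P v r" using P_bounds[OF v] M12 by simp
  then have m0: "0 \<le> m_fun M1 M2 R1 v r" using M1 by (simp add: m_fun_def)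
  have "2 * m_fun M1 M2 R1 v r / r \<le> 2 * M2 / R1"
    using m m0 r R1_pos by (intro frac_le) auto
  then show "F_lower \<le> F v r" by (simp add: F_fun_def F_lower_def)
  show "F v r \<le> 1" using m0 r R1_pos by (simp add: F_fun_def)
qed

lemma F_diff_le:
  assumes v: "profile R1 R2 v" and w: "profile R1 R2 w" and r: "r \<in> {R1..R2}"
  shows "\<bar>F v r - F w r\<bar> \<le> 2 * (M2 - M1) * R2\<^sup>2 / R1 * (LINT x|lborel. \<bar>v x - w x\<bar>)"
proof -
  have "F v r - F w r = 2 * (M2 - M1) * (P w r - P v r) / r"
    using r R1_pos by (simp add: F_fun_def m_fun_def field_simps)
  then have "\<bar>F v r - F w r\<bar> = 2 * (M2 - M1) * \<bar>P v r - P w r\<bar> / r"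
    using r R1_pos M12 by (simp add: abs_mult abs_minus_commute)
  also have "\<dots> \<le> 2 * (M2 - M1) * (R2\<^sup>2 * (LINT x|lborel. \<bar>v x - w x\<bar>)) / R1"
    using r R1_pos M12 P_diff_le[OF v w, of r] by (intro frac_le mult_left_mono mult_nonneg_nonneg) auto
  finally show ?thesis by (simp add: mult.assoc)
qed

lemma continuous_on_W:
  assumes v: "profile R1 R2 v" shows "continuous_on {R1..R2} (W v)"
proof -
  have "r \<noteq> 0" "sqrt (F v r) \<noteq> 0" if "r \<in> {R1..R2}" for r
    using that R1_pos F_bounds[OF v that] F_lower_pos by auto
  then show ?thesis
    unfolding W_def F_fun_def m_fun_def
    by (intro continuous_intros continuous_on_P v) (auto simp: F_fun_def m_fun_def)
qed

lemma W_bounds: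
  assumes v: "profile R1 R2 v" and r: "r \<in> {R1..R2}"
  shows "R1 ^ 3 \<le> W v r" "W v r \<le> R2 ^ 3 / sqrt F_lower"
proof -
  note F = F_bounds[OF v r]
  have s: "0 < sqrt (F v r)" "sqrt (F v r) \<le> 1" "sqrt F_lower \<le> sqrt (F v r)" using F F_lower_pos by auto
  have "R1 ^ 3 \<le> r ^ 3" "r ^ 3 \<le> R2 ^ 3" using r R1_pos by (auto intro: power_mono)
  moreover have "r ^ 3 / 1 \<le> r ^ 3 / sqrt (F v r)" using s r R1_pos by (intro divide_left_mono) auto
  ultimately show "R1 ^ 3 \<le> W v r" by (simp add: W_def)
  show "W v r \<le> R2 ^ 3 / sqrt F_lower"
    unfolding W_def using s r R1_pos F_lower_pos by (intro frac_le power_mono) auto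
qed

text \<open>Rationalising gives |a - b| over sqrt a * sqrt b * (sqrt a + sqrt b), and each of the
  three factors is at least sqrt k.\<close>

lemma inverse_sqrt_diff_le:
  fixes a b k :: real assumes "0 < k" "k \<le> a" "k \<le> b"
  shows "\<bar>1 / sqrt a - 1 / sqrt b\<bar> \<le> \<bar>a - b\<bar> / (k * sqrt k)"
proof -
  have s: "0 < sqrt k" "sqrt k \<le> sqrt a" "sqrt k \<le> sqrt b" using assms by auto
  have ab: "0 < sqrt a" "0 < sqrt b" using s by linarith+
  have "1 / sqrt a - 1 / sqrt b = (sqrt b - sqrt a) / (sqrt a * sqrt b)"
    using ab by (simp add: field_simps)
  also have "\<dots> = (b - a) / (sqrt a * sqrt b * (sqrt b + sqrt a))"
  proof -
    have eq: "b - a = (sqrt b - sqrt a) * (sqrt b + sqrt a)"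
      using assms by (simp add: algebra_simps)
    have cancel: "x / y = x * z / (y * z)" if "z \<noteq> 0" for x y z :: real using that by simp
    show ?thesis unfolding eq by (rule cancel) (use ab in linarith)
  qed
  finally have "\<bar>1 / sqrt a - 1 / sqrt b\<bar> = \<bar>a - b\<bar> / (sqrt a * sqrt b * (sqrt b + sqrt a))"
    using ab by (simp add: abs_mult abs_minus_commute)
  also have "\<dots> \<le> \<bar>a - b\<bar> / (sqrt k * sqrt k * sqrt k)"
  proof -
    have ba: "sqrt k \<le> sqrt b + sqrt a" "0 < sqrt b + sqrt a" using s ab by linarith+
    show ?thesis
      by (intro divide_left_mono mult_mono mult_pos_pos ba s ab mult_nonneg_nonneg less_imp_le[OF s(1)]
          less_imp_le[OF ab(1)] less_imp_le[OF ab(2)] abs_ge_zero)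
  qed
  finally show ?thesis using assms by simp
qed

text \<open>The nonlocal weight is Lipschitz in the L^1 norm, uniformly in r: a is the constant of
  \<open>F_diff_le\<close>, the inverse square root contributes 1 / (F_lower * sqrt F_lower), and r
  ^ 3 is at most R2 ^ 3.\<close>

lemma W_lipschitz:
  obtains K where "0 < K" "\<And>v w r. profile R1 R2 v \<Longrightarrow> profile R1 R2 w \<Longrightarrow> r \<in> {R1..R2} \<Longrightarrow>
    \<bar>W v r - W w r\<bar> \<le> K * (LINT x|lborel. \<bar>v x - w x\<bar>)"
proof -
  define a where "a = 2 * (M2 - M1) * R2\<^sup>2 / R1"
  define K where "K = R2 ^ 3 * (a / (F_lower * sqrt F_lower))"
  have a: "0 < a" using R1_pos R12 M12 by (simp add: a_def)
  have "0 < K" using a R1_pos R12 F_lower_pos by (simp add: K_def)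
  moreover have "\<bar>W v r - W w r\<bar> \<le> K * (LINT x|lborel. \<bar>v x - w x\<bar>)"
    if v: "profile R1 R2 v" and w: "profile R1 R2 w" and r: "r \<in> {R1..R2}" for v w r
  proof -
    have "W v r - W w r = r ^ 3 * (1 / sqrt (F v r) - 1 / sqrt (F w r))"
      by (simp add: W_def right_diff_distrib)
    then have "\<bar>W v r - W w r\<bar> = r ^ 3 * \<bar>1 / sqrt (F v r) - 1 / sqrt (F w r)\<bar>"
      using r R1_pos by (simp add: abs_mult)
    also have "\<dots> \<le> R2 ^ 3 * (\<bar>F v r - F w r\<bar> / (F_lower * sqrt F_lower))"
      using r R1_pos F_bounds[OF v r] F_bounds[OF w r] F_lower_pos
      by (intro mult_mono power_mono inverse_sqrt_diff_le) auto
    also have "\<dots> \<le> R2 ^ 3 * (a * (LINT x|lborel. \<bar>v x - w x\<bar>) / (F_lower * sqrt F_lower))"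
      using F_diff_le[OF v w r] F_lower_pos R1_pos R12
      by (intro mult_left_mono divide_right_mono) (auto simp: a_def)
    finally show ?thesis by (simp add: K_def)
  qed
  ultimately show ?thesis by (rule that)
qed

lemma A_infty_vanishes:
  assumes "v \<in> A_infty R1 R2" "x \<notin> {R1<..<R2}" shows "v x = 0"
  using assms outside_supp by (fastforce simp: A_infty_def)

lemma A_infty_test_function:
  assumes "v \<in> A_infty R1 R2" shows "test_function v"
  using assms A_infty_vanishes[OF assms]
  by (intro test_functionI[of _ R1 R2]) (auto simp: A_infty_def)

lemma A_infty_profile:
  assumes v: "v \<in> A_infty R1 R2" shows "profile R1 R2 v"
proof -
  have [measurable]: "v \<in> borel_measurable borel"
    by (rule test_function_borel_measurable[OF A_infty_test_function[OF v]])
  have v0: "v x = 0" if "x \<notin> {R1..R2}" for x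
    using that by (intro A_infty_vanishes[OF v]) auto
  have "(LINT r:{R1..R2}|lebesgue. r\<^sup>2 * v r) = (LINT r|lborel. indicator {R1..R2} r *\<^sub>R (r\<^sup>2 * v r))"
    unfolding set_lebesgue_integral_def by (rule integral_completion) measurable
  also have "\<dots> = (LINT r|lborel. r\<^sup>2 * v r)"
    using v0 by (intro Bochner_Integration.integral_cong) (auto simp: indicator_def)
  finally show ?thesis
    using v v0 integrable_lborel_test_function[OF A_infty_test_function[OF v]]
    by (auto simp: profile_def A_infty_def)
qed

lemma integrable_W_times:
  assumes v: "profile R1 R2 v" and g: "continuous_on {R1..R2} g"
  shows "integrable lborel (\<lambda>r. indicator {R1..R2} r * (W v r * g r))"
  using borel_integrable_compact[of "{R1..R2}" "\<lambda>r. W v r * g r"]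
    continuous_on_mult[OF continuous_on_W[OF v] g] by simp

lemma I_fun_lborel:
  assumes v: "v \<in> A_infty R1 R2"
  shows "I_fun M1 M2 R1 R2 v = (LINT r|lborel. indicator {R1..R2} r * (W v r * max (deriv v r) 0))"
    "integrable lborel (\<lambda>r. indicator {R1..R2} r * (W v r * max (deriv v r) 0))"
proof -
  have "continuous_on {R1..R2} (\<lambda>r. max (deriv v r) 0)"
    using v by (intro continuous_intros smooth_continuous_on smooth_deriv) (auto simp: A_infty_def)
  then show i: "integrable lborel (\<lambda>r. indicator {R1..R2} r * (W v r * max (deriv v r) 0))"
    by (rule integrable_W_times[OF A_infty_profile[OF v]])
  have "I_fun M1 M2 R1 R2 v = (LINT r|lebesgue. indicator {R1..R2} r * (W v r * max (deriv v r) 0))"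
    by (simp add: I_fun_def set_lebesgue_integral_def W_def)
  also have "\<dots> = (LINT r|lborel. indicator {R1..R2} r * (W v r * max (deriv v r) 0))"
    using borel_measurable_integrable[OF i] by (rule integral_completion)
  finally show "I_fun M1 M2 R1 R2 v = (LINT r|lborel. indicator {R1..R2} r * (W v r * max (deriv v r) 0))" .
qed

end

section \<open>Lower semicontinuity\<close>

text \<open>X is the sum of M and N. A single smooth function has to approximate the Hahn set in L^1
  of both Jordan parts, and closeness in L^1 of X gives both at once.\<close>

lemma dominating_measure:
  assumes M: "finite_borel_measure M" and N: "finite_borel_measure N"
  obtains X where "finite_borel_measure X" "M \<le> X" "N \<le> X"
proof -
  interpret M: finite_measure M by (rule finite_borel_measureD(1)[OF M])
  interpret N: finite_measure N by (rule finite_borel_measureD(1)[OF N])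
  note sets = finite_borel_measureD(2)[OF M] finite_borel_measureD(2)[OF N]
  define D where "D A = (if A \<in> sets borel then measure M A + measure N A else 0)" for A
  have "finite_signed_measure D"
    unfolding finite_signed_measure_def
  proof (intro conjI allI impI)
    fix A :: "nat \<Rightarrow> real set" assume A: "range A \<subseteq> sets borel" "disjoint_family A"
    then have "D (A i) = measure M (A i) + measure N (A i)" for i by (auto simp: D_def)
    moreover have "D (\<Union>i. A i) = measure M (\<Union>i. A i) + measure N (\<Union>i. A i)" using A by (auto simp: D_def)
    ultimately show "(\<lambda>i. D (A i)) sums D (\<Union>i. A i)"
      using A by (simp add: sums_add M.finite_measure_UNION N.finite_measure_UNION sets)
  qed (auto simp: D_def)
  then obtain X where X: "finite_borel_measure X" "\<And>A. A \<in> sets borel \<Longrightarrow> measure X A = 1 * D (A \<inter> UNIV)"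
    by (rule signed_finite_borel_measure[of D UNIV 1]) (auto simp: D_def)
  interpret X: finite_measure X by (rule finite_borel_measureD(1)[OF X(1)])
  have "M \<le> X" "N \<le> X"
    using X(2) by (auto simp: le_measure sets finite_borel_measureD(2)[OF X(1)] le_fun_def D_def
      M.emeasure_eq_measure N.emeasure_eq_measure X.emeasure_eq_measure emeasure_notin_sets intro!: le_measure[THEN iffD2])
  then show ?thesis using X(1) that by blast
qed

lemma integral_mono_dominating:
  fixes f :: "real \<Rightarrow> real"
  assumes M: "finite_borel_measure M" and X: "finite_borel_measure X" "M \<le> X"
    and f: "f \<in> borel_measurable borel" "\<And>x. 0 \<le> f x" "\<And>x. f x \<le> C"
  shows "(LINT x|M. f x) \<le> (LINT x|X. f x)"
proof -
  have b: "\<bar>f x\<bar> \<le> C" for x using f(2,3)[of x] by simp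
  have i: "integrable M f" "integrable X f"
    by (rule integrable_bounded_finite_borel[OF M f(1) b], rule integrable_bounded_finite_borel[OF X(1) f(1) b])
  have "(\<integral>\<^sup>+x. ennreal (f x) \<partial>M) \<le> (\<integral>\<^sup>+x. ennreal (f x) \<partial>X)"
    by (rule nn_integral_mono_measure) (simp_all add: X(2) finite_borel_measureD(2)[OF M] finite_borel_measureD(2)[OF X(1)])
  then show ?thesis
    using f(2) by (simp add: nn_integral_eq_integral i ennreal_le_iff)
qed

lemma integral_by_parts_test_function:
  assumes f: "smooth f" and g: "test_function g"
  shows "(LINT x|lborel. f x * deriv g x) = - (LINT x|lborel. g x * deriv f x)"
proof -
  have smg: "smooth g" using g by (simp add: test_function_def)
  obtain a where a: "\<And>x. x \<notin> {-a..a} \<Longrightarrow> g x = 0" "0 < a" using test_function_support[OF g] by blast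
  \<comment> \<open>The vanishing of g is known only off the closed interval from -a to a, so the
    boundary terms are taken one unit further out.\<close>
  let ?b = "a + 1"
  have dg: "deriv g x = 0" if "x \<notin> {-a..a}" for x
    by (rule deriv_eq_0_outside[OF smg _ a(1) that]) auto
  have "(LINT x|lborel. indicator {-?b..?b} x *\<^sub>R (f x * deriv g x + g x * deriv f x)) = f ?b * g ?b - f (-?b) * g (-?b)"
  proof (rule integral_FTC_Icc)
    show "((\<lambda>x. f x * g x) has_vector_derivative f x * deriv g x + g x * deriv f x) (at x within {-?b..?b})" for x
    proof -
      have "((\<lambda>x. f x * g x) has_real_derivative f x * deriv g x + g x * deriv f x) (at x)"
        by (rule DERIV_cong[OF DERIV_mult[OF smooth_has_derivative[OF f] smooth_has_derivative[OF smg]]]) simp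
      then show ?thesis
        by (rule has_vector_derivative_at_within[OF has_real_derivative_iff_has_vector_derivative[THEN iffD1]])
    qed
    show "continuous_on {-?b..?b} (\<lambda>x. f x * deriv g x + g x * deriv f x)"
      by (intro continuous_on_add continuous_on_mult smooth_continuous_on smooth_deriv f smg)
  qed (use a in simp)
  also have "\<dots> = 0" using a(1)[of ?b] a(1)[of "- ?b"] by simp
  also have "(\<lambda>x. indicator {-?b..?b} x *\<^sub>R (f x * deriv g x + g x * deriv f x)) = (\<lambda>x. f x * deriv g x + g x * deriv f x)"
  proof
    fix x show "indicator {-?b..?b} x *\<^sub>R (f x * deriv g x + g x * deriv f x) = f x * deriv g x + g x * deriv f x"
    proof (cases "x \<in> {-?b..?b}")
      case False
      then have "x \<notin> {-a..a}" by auto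
      then show ?thesis using a(1) dg by simp
    qed simp
  qed
  finally have "(LINT x|lborel. f x * deriv g x + g x * deriv f x) = 0" .
  moreover have "integrable lborel (\<lambda>x. f x * deriv g x)"
  proof (rule integrable_lborel_test_function)
    show "test_function (\<lambda>x. f x * deriv g x)"
      using dg by (intro test_functionI[of _ "-a" a] smooth_mult smooth_deriv f smg) auto
  qed
  moreover have "integrable lborel (\<lambda>x. g x * deriv f x)"
  proof (rule integrable_lborel_test_function)
    show "test_function (\<lambda>x. g x * deriv f x)"
      using a(1) by (intro test_functionI[of _ "-a" a] smooth_mult smooth_deriv f smg) auto
  qed
  ultimately show ?thesis by simp
qed

lemma integral_times_L1_tendsto:
  assumes g: "test_function g" and u: "integrable lborel u" "\<And>n. integrable lborel (un n)"
    and lim: "(\<lambda>n. LINT x|lborel. \<bar>un n x - u x\<bar>) \<longlonglongrightarrow> 0"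
  shows "(\<lambda>n. LINT x|lborel. un n x * g x) \<longlonglongrightarrow> (LINT x|lborel. u x * g x)"
proof -
  obtain C where C: "0 < C" "\<And>x. \<bar>g x\<bar> \<le> C" using test_function_bounded[OF g] by blast
  note [measurable] = test_function_borel_measurable[OF g]
  have i: "integrable lborel (\<lambda>x. v x * g x)" if "integrable lborel v" for v
  proof (rule Bochner_Integration.integrable_bound[OF integrable_mult_right[OF that, of C]])
    show "(\<lambda>x. v x * g x) \<in> borel_measurable lborel" using borel_measurable_integrable[OF that] by measurable
    show "AE x in lborel. norm (v x * g x) \<le> norm (C * v x)"
      using C by (intro AE_I2) (simp add: abs_mult mult.commute mult_right_mono)
  qed
  have "\<bar>(LINT x|lborel. un n x * g x) - (LINT x|lborel. u x * g x)\<bar> \<le> C * (LINT x|lborel. \<bar>un n x - u x\<bar>)" for n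
  proof -
    have "(LINT x|lborel. un n x * g x) - (LINT x|lborel. u x * g x) = (LINT x|lborel. (un n x - u x) * g x)"
      using i[OF u(1)] i[OF u(2)] by (simp add: left_diff_distrib)
    also have "\<bar>\<dots>\<bar> \<le> (LINT x|lborel. \<bar>(un n x - u x) * g x\<bar>)" by (rule integral_abs_bound)
    also have "\<dots> \<le> (LINT x|lborel. C * \<bar>un n x - u x\<bar>)"
    proof (rule integral_mono)
      show "integrable lborel (\<lambda>x. \<bar>(un n x - u x) * g x\<bar>)" using i u by auto
      show "\<bar>(un n x - u x) * g x\<bar> \<le> C * \<bar>un n x - u x\<bar>" for x
        using C by (simp add: abs_mult mult.commute mult_right_mono)
    qed (use u in auto)
    finally show ?thesis by simp
  qed
  then have "(\<lambda>n. (LINT x|lborel. un n x * g x) - (LINT x|lborel. u x * g x)) \<longlonglongrightarrow> 0"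
    by (intro Lim_null_comparison[OF _ tendsto_mult_right_zero[OF lim, of C]] always_eventually) simp
  then show ?thesis by (simp add: LIM_zero_iff)
qed

context shell begin

lemma W_indicator_measurable:
  assumes v: "profile R1 R2 v" shows "(\<lambda>r. indicator {R1..R2} r * W v r) \<in> borel_measurable borel"
  using borel_measurable_continuous_on_indicator[OF _ continuous_on_W[OF v]] by simp

lemma W_indicator_bound:
  assumes v: "profile R1 R2 v" shows "\<bar>indicator {R1..R2} r * W v r\<bar> \<le> R2 ^ 3 / sqrt F_lower"
proof (cases "r \<in> {R1..R2}")
  case True
  moreover have "0 \<le> W v r" by (rule order_trans[OF _ W_bounds(1)[OF v True]]) (use R1_pos in simp)
  ultimately show ?thesis using W_bounds(2)[OF v True] by simp
next
  case False
  then show ?thesis using R1_pos R12 F_lower_pos by simp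
qed

text \<open>Pointwise phi * v' <= phi * (v')_+ <= W * (v')_+. This bounds the nonlinear energy below
  by a functional linear in v. Bounds on phi are needed only on the closed interval because v'
  vanishes elsewhere.\<close>

lemma I_fun_lower_bound:
  assumes v: "v \<in> A_infty R1 R2" and \<phi>: "smooth \<phi>" "\<And>r. r \<in> {R1..R2} \<Longrightarrow> 0 \<le> \<phi> r" "\<And>r. r \<in> {R1..R2} \<Longrightarrow> \<phi> r \<le> W v r"
  shows "- (LINT x|lborel. v x * deriv \<phi> x) \<le> I_fun M1 M2 R1 R2 v"
proof -
  have smv: "smooth v" using v by (simp add: A_infty_def)
  have dv: "deriv v x = 0" if "x \<notin> {R1..R2}" for x
    using A_infty_vanishes[OF v] that by (intro deriv_eq_0_outside[OF smv, of "{R1..R2}"]) auto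
  have "- (LINT x|lborel. v x * deriv \<phi> x) = (LINT x|lborel. \<phi> x * deriv v x)"
    using integral_by_parts_test_function[OF \<phi>(1) A_infty_test_function[OF v]] by simp
  also have "\<dots> \<le> (LINT r|lborel. indicator {R1..R2} r * (W v r * max (deriv v r) 0))"
  proof (rule integral_mono)
    show "integrable lborel (\<lambda>x. \<phi> x * deriv v x)"
    proof (rule integrable_lborel_test_function)
      show "test_function (\<lambda>x. \<phi> x * deriv v x)"
        using dv by (intro test_functionI[of _ R1 R2] smooth_mult smooth_deriv \<phi> smv) auto
    qed
    show "\<phi> r * deriv v r \<le> indicator {R1..R2} r * (W v r * max (deriv v r) 0)" for r
    proof (cases "r \<in> {R1..R2}")
      case True
      have "\<phi> r * deriv v r \<le> \<phi> r * max (deriv v r) 0" using \<phi>(2)[OF True] by (intro mult_left_mono) auto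
      also have "\<dots> \<le> W v r * max (deriv v r) 0" using \<phi>(3)[OF True] by (intro mult_right_mono) auto
      finally show ?thesis using True by simp
    qed (simp add: dv)
  qed (rule I_fun_lborel(2)[OF v])
  finally show ?thesis by (simp only: I_fun_lborel(1)[OF v])
qed

text \<open>The test function is a polynomial slightly below the weight times a smooth approximation of
  the positive Hahn set.\<close>

lemma weighted_positive_part_approx:
  assumes u: "profile R1 R2 u" and M: "finite_borel_measure M" and N: "finite_borel_measure N"
    and sing: "mutually_singular M N" and "0 < \<epsilon>"
  obtains \<phi> \<delta> where "test_function \<phi>" "0 < \<delta>" "\<And>r. r \<in> {R1..R2} \<Longrightarrow> 0 \<le> \<phi> r"
    "\<And>r. r \<in> {R1..R2} \<Longrightarrow> \<phi> r \<le> W u r - \<delta>"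
    "(LINT r|M. indicator {R1..R2} r * W u r) - \<epsilon> < (LINT x|M. \<phi> x) - (LINT x|N. \<phi> x)"
proof -
  obtain S where S: "S \<in> sets borel" "emeasure M S = 0" "emeasure N (- S) = 0"
    using sing by (auto simp: mutually_singular_def)
  define m where "m = measure M UNIV"
  \<comment> \<open>The first entry gives 3 * delta <= R1 ^ 3 <= W, so the polynomial below stays
    nonnegative; the second makes the total loss 3 * delta * m at most epsilon / 2, with m + 1
    covering m = 0.\<close>
  define \<delta> where "\<delta> = min (R1 ^ 3 / 3) (\<epsilon> / (6 * (m + 1)))"
  have m: "0 \<le> m" by (simp add: m_def)
  have \<delta>: "0 < \<delta>" "3 * \<delta> \<le> R1 ^ 3" using \<open>0 < \<epsilon>\<close> R1_pos m by (auto simp: \<delta>_def)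
  have "\<delta> * m \<le> \<epsilon> / (6 * (m + 1)) * m" using m by (intro mult_right_mono) (auto simp: \<delta>_def)
  also have "\<dots> \<le> \<epsilon> / 6" using m \<open>0 < \<epsilon>\<close> by (simp add: field_simps)
  finally have \<delta>m: "3 * \<delta> * m \<le> \<epsilon> / 2" by simp
  have cont: "continuous_on {R1..R2} (\<lambda>r. W u r - 2 * \<delta>)"
    by (intro continuous_on_diff continuous_on_W[OF u] continuous_on_const)
  \<comment> \<open>Aiming at W - 2 * delta with tolerance delta places p between W - 3 * delta and
    W - delta.\<close>
  obtain p where p: "real_polynomial_function p" "\<And>r. r \<in> {R1..R2} \<Longrightarrow> \<bar>(W u r - 2 * \<delta>) - p r\<bar> < \<delta>"
    using Stone_Weierstrass_real_polynomial_function[OF compact_Icc cont \<delta>(1)] by blast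
  have smp: "smooth p" by (rule smooth_polynomial[OF p(1)])
  have p_bounds: "0 \<le> p r" "W u r - 3 * \<delta> \<le> p r" "p r \<le> W u r - \<delta>" if "r \<in> {R1..R2}" for r
    using p(2)[OF that] W_bounds(1)[OF u that] \<delta> by auto
  \<comment> \<open>The closed interval must lie inside the open one carrying the support, so that
    atoms at R1 and R2 are reached.\<close>
  let ?a = "R1 - 1" and ?b = "R2 + 1"
  have "bounded (p ` {?a..?b})" by (intro compact_imp_bounded compact_continuous_image smooth_continuous_on smp) auto
  then obtain C where C: "0 < C" "\<And>x. x \<in> {?a..?b} \<Longrightarrow> \<bar>p x\<bar> \<le> C" by (auto simp: bounded_pos)
  \<comment> \<open>Replacing the indicator by psi costs C * eta = epsilon / 8 for each of M and N,
    which with the epsilon / 2 above stays below epsilon.\<close>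
  define \<eta> where "\<eta> = \<epsilon> / (8 * C)"
  have "0 < \<eta>" using \<open>0 < \<epsilon>\<close> C by (simp add: \<eta>_def)
  let ?A = "{R1..R2} - S"
  have A: "?A \<in> sets borel" "?A \<subseteq> {?a<..<?b}" using S(1) by auto
  obtain X where X: "finite_borel_measure X" "M \<le> X" "N \<le> X" using dominating_measure[OF M N] by blast
  obtain \<psi> where \<psi>: "smooth \<psi>" "\<And>x. 0 \<le> \<psi> x \<and> \<psi> x \<le> 1" "\<And>x. x \<notin> {?a<..<?b} \<Longrightarrow> \<psi> x = 0"
    "(LINT x|X. \<bar>\<psi> x - indicator ?A x\<bar>) < \<eta>"
    using indicator_approx_supported[OF X(1) A \<open>0 < \<eta>\<close>] by blast
  note [measurable] = smooth_borel_measurable[OF \<psi>(1)] smooth_borel_measurable[OF smp] S(1)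
  define \<phi> where "\<phi> x = \<psi> x * p x" for x
  have \<phi>: "test_function \<phi>"
    unfolding \<phi>_def using \<psi>(3) by (intro test_functionI[of _ ?a ?b] smooth_mult \<psi> smp) auto
  have pA: "\<bar>indicator ?A x * p x\<bar> \<le> C" for x using C(2)[of x] C(1) by (auto simp: indicator_def)
  have close: "\<bar>(LINT x|Y. \<phi> x) - (LINT x|Y. indicator ?A x * p x)\<bar> \<le> C * \<eta>"
    if Y: "finite_borel_measure Y" "Y \<le> X" for Y
  proof -
    have b: "\<bar>\<bar>\<psi> x - indicator ?A x\<bar>\<bar> \<le> 1" for x using \<psi>(2)[of x] by (auto simp: indicator_def)
    have i: "integrable Y \<phi>" "integrable Y (\<lambda>x. indicator ?A x * p x)" "integrable Y (\<lambda>x. \<bar>\<psi> x - indicator ?A x\<bar>)"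
      by (rule integrable_test_function[OF Y(1) \<phi>], rule integrable_bounded_finite_borel[OF Y(1) _ pA], measurable,
          rule integrable_bounded_finite_borel[OF Y(1) _ b], measurable)
    have "(LINT x|Y. \<phi> x) - (LINT x|Y. indicator ?A x * p x) = (LINT x|Y. \<phi> x - indicator ?A x * p x)"
      using i by simp
    also have "\<bar>\<dots>\<bar> \<le> (LINT x|Y. \<bar>\<phi> x - indicator ?A x * p x\<bar>)" by (rule integral_abs_bound)
    also have "\<dots> \<le> (LINT x|Y. C * \<bar>\<psi> x - indicator ?A x\<bar>)"
    proof (rule integral_mono)
      show "integrable Y (\<lambda>x. \<bar>\<phi> x - indicator ?A x * p x\<bar>)" using i by auto
      show "integrable Y (\<lambda>x. C * \<bar>\<psi> x - indicator ?A x\<bar>)" using i by auto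
      show "\<bar>\<phi> x - indicator ?A x * p x\<bar> \<le> C * \<bar>\<psi> x - indicator ?A x\<bar>" for x
      proof (cases "x \<in> {?a<..<?b}")
        case True
        have "\<bar>\<phi> x - indicator ?A x * p x\<bar> = \<bar>p x\<bar> * \<bar>\<psi> x - indicator ?A x\<bar>"
          by (simp add: \<phi>_def algebra_simps flip: abs_mult)
        also have "\<dots> \<le> C * \<bar>\<psi> x - indicator ?A x\<bar>" using C(2)[of x] True by (intro mult_right_mono) auto
        finally show ?thesis .
      next
        case False
        then have "x \<notin> ?A" by auto
        then show ?thesis using \<psi>(3)[OF False] by (simp add: \<phi>_def)
      qed
    qed
    also have "\<dots> = C * (LINT x|Y. \<bar>\<psi> x - indicator ?A x\<bar>)" by simp
    also have "\<dots> \<le> C * (LINT x|X. \<bar>\<psi> x - indicator ?A x\<bar>)"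
      using b C(1) by (intro mult_left_mono integral_mono_dominating[OF Y(1) X(1) Y(2), of _ 1]) auto
    also have "\<dots> \<le> C * \<eta>" using \<psi>(4) C(1) by (intro mult_left_mono) auto
    finally show ?thesis .
  qed
  \<comment> \<open>N is concentrated on S and M on its complement: the negative part does not see
    \<open>?A\<close>, while removing S from the interval costs M nothing.\<close>
  have "AE x in N. x \<in> S"
    using S finite_borel_measureD[OF N] by (intro AE_I[of _ _ "- S"]) auto
  then have "(LINT x|N. indicator ?A x * p x) = (LINT x|N. 0)"
    using finite_borel_measureD(4)[OF N] by (intro integral_cong_AE) (auto simp: indicator_def)
  then have N0: "(LINT x|N. indicator ?A x * p x) = 0" by simp
  have "AE x in M. x \<notin> S"
    using S finite_borel_measureD[OF M] by (intro AE_I[of _ _ S]) auto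
  note [measurable] = W_indicator_measurable[OF u]
  have "(LINT r|M. indicator {R1..R2} r * W u r) - 3 * \<delta> * m = (LINT r|M. indicator {R1..R2} r * W u r - 3 * \<delta>)"
  proof -
    have "integrable M (\<lambda>r. indicator {R1..R2} r * W u r)" "integrable M (\<lambda>r. 3 * \<delta>)"
      by (rule integrable_bounded_finite_borel[OF M W_indicator_measurable[OF u] W_indicator_bound[OF u]])
        (use finite_borel_measureD(1)[OF M] in \<open>auto intro: finite_measure.integrable_const\<close>)
    then show ?thesis using finite_borel_measureD(3)[OF M] by (simp add: m_def)
  qed
  also have "\<dots> \<le> (LINT x|M. indicator ?A x * p x)"
  proof (rule integral_mono_AE)
    show "integrable M (\<lambda>r. indicator {R1..R2} r * W u r - 3 * \<delta>)"
      using finite_borel_measureD(1)[OF M] integrable_bounded_finite_borel[OF M W_indicator_measurable[OF u] W_indicator_bound[OF u]]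
      by (auto intro: finite_measure.integrable_const)
    show "integrable M (\<lambda>x. indicator ?A x * p x)"
      by (rule integrable_bounded_finite_borel[OF M _ pA]) measurable
    show "AE r in M. indicator {R1..R2} r * W u r - 3 * \<delta> \<le> indicator ?A r * p r"
      using \<open>AE x in M. x \<notin> S\<close>
    proof eventually_elim
      case (elim r)
      then show ?case using p_bounds(2)[of r] \<delta>(1) by (auto simp: indicator_def)
    qed
  qed
  finally have "(LINT r|M. indicator {R1..R2} r * W u r) - \<epsilon> / 2 \<le> (LINT x|M. indicator ?A x * p x)"
    using \<delta>m by linarith
  moreover have "C * \<eta> = \<epsilon> / 8" using C by (simp add: \<eta>_def)
  ultimately have main: "(LINT r|M. indicator {R1..R2} r * W u r) - \<epsilon> < (LINT x|M. \<phi> x) - (LINT x|N. \<phi> x)"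
    using close[OF M X(2)] close[OF N X(3)] N0 \<open>0 < \<epsilon>\<close> by linarith
  have "0 \<le> \<phi> r" "\<phi> r \<le> W u r - \<delta>" if "r \<in> {R1..R2}" for r
  proof -
    show "0 \<le> \<phi> r" using \<psi>(2)[of r] p_bounds(1)[OF that] by (simp add: \<phi>_def)
    have "\<phi> r \<le> p r" using \<psi>(2)[of r] p_bounds(1)[OF that] by (simp add: \<phi>_def mult_left_le_one_le)
    then show "\<phi> r \<le> W u r - \<delta>" using p_bounds(3)[OF that] by linarith
  qed
  then show ?thesis using that[OF \<phi> \<delta>(1)] main by blast
qed

text \<open>The margin delta between phi and W u absorbs the change of weight from u to
  \<open>un n\<close>, so one phi is admissible for all large n and the linear bound passes to the
  limit. The form with epsilon serves both the liminf inequality and the convergence of the recovery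
  sequence.\<close>

lemma eventually_lower_bound:
  assumes u: "profile R1 R2 u" and M: "finite_borel_measure M" and N: "finite_borel_measure N"
    and sing: "mutually_singular M N"
    and D: "\<And>\<phi>. test_function \<phi> \<Longrightarrow> (LINT x|lborel. u x * deriv \<phi> x) = - ((LINT x|M. \<phi> x) - (LINT x|N. \<phi> x))"
    and un: "\<And>n. un n \<in> A_infty R1 R2" and lim: "(\<lambda>n. LINT x|lborel. \<bar>un n x - u x\<bar>) \<longlonglongrightarrow> 0"
    and "0 < \<epsilon>"
  shows "\<forall>\<^sub>F n in sequentially. (LINT r|M. indicator {R1..R2} r * W u r) - \<epsilon> < I_fun M1 M2 R1 R2 (un n)"
proof -
  obtain \<phi> \<delta> where \<phi>: "test_function \<phi>" "0 < \<delta>" "\<And>r. r \<in> {R1..R2} \<Longrightarrow> 0 \<le> \<phi> r"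
    "\<And>r. r \<in> {R1..R2} \<Longrightarrow> \<phi> r \<le> W u r - \<delta>"
    "(LINT r|M. indicator {R1..R2} r * W u r) - \<epsilon> < (LINT x|M. \<phi> x) - (LINT x|N. \<phi> x)"
    using weighted_positive_part_approx[OF u M N sing \<open>0 < \<epsilon>\<close>] by blast
  obtain K where K: "0 < K" "\<And>v w r. profile R1 R2 v \<Longrightarrow> profile R1 R2 w \<Longrightarrow> r \<in> {R1..R2} \<Longrightarrow>
    \<bar>W v r - W w r\<bar> \<le> K * (LINT x|lborel. \<bar>v x - w x\<bar>)" by (rule W_lipschitz) blast
  have "(\<lambda>n. - (LINT x|lborel. un n x * deriv \<phi> x)) \<longlonglongrightarrow> - (LINT x|lborel. u x * deriv \<phi> x)"
    by (intro tendsto_minus integral_times_L1_tendsto test_function_deriv \<phi> profileD(1)[OF u]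
        profileD(1)[OF A_infty_profile[OF un]] lim)
  then have "\<forall>\<^sub>F n in sequentially. (LINT r|M. indicator {R1..R2} r * W u r) - \<epsilon> < - (LINT x|lborel. un n x * deriv \<phi> x)"
    using \<phi>(5) by (intro order_tendstoD(1)) (auto simp: D[OF \<phi>(1)])
  moreover have "\<forall>\<^sub>F n in sequentially. K * (LINT x|lborel. \<bar>un n x - u x\<bar>) < \<delta>"
    using tendsto_mult_right_zero[OF lim, of K] \<phi>(2) by (rule order_tendstoD(2))
  ultimately show ?thesis
  proof eventually_elim
    case (elim n)
    have "\<phi> r \<le> W (un n) r" if "r \<in> {R1..R2}" for r
      using K(2)[OF A_infty_profile[OF un[of n]] u that] \<phi>(4)[OF that] elim(2) by linarith
    then have "- (LINT x|lborel. un n x * deriv \<phi> x) \<le> I_fun M1 M2 R1 R2 (un n)"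
      using \<phi>(1,3) by (intro I_fun_lower_bound un) (auto simp: test_function_def)
    with elim(1) show ?case by linarith
  qed
qed

end

section \<open>Recovery sequences\<close>

text \<open>Fubini, justified by boundedness of f, finiteness of M and integrability of V. It
  transfers the mollification from the measure to the weight.\<close>

lemma smear_swap:
  assumes M: "finite_borel_measure M" and f: "test_function f"
    and V: "integrable lborel V" and h[measurable]: "h \<in> borel_measurable borel"
  shows "integrable lborel (\<lambda>x. V x * (LINT z|M. f (x - h z)))"
    and "(LINT x|lborel. V x * (LINT z|M. f (x - h z))) = (LINT z|M. LINT x|lborel. f (x - h z) * V x)"
proof -
  interpret M: finite_measure M by (rule finite_borel_measureD(1)[OF M])
  interpret pair_sigma_finite lborel M ..
  note [measurable_cong] = finite_borel_measureD(2)[OF M]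
  note [measurable] = test_function_borel_measurable[OF f] borel_measurable_integrable[OF V]
  obtain C where C: "0 < C" "\<And>x. \<bar>f x\<bar> \<le> C" using test_function_bounded[OF f] by blast
  have fi: "integrable M (\<lambda>z. f (x - h z))" for x
    by (rule integrable_bounded_finite_borel[OF M, of _ C]) (use C in auto)
  have i: "integrable (lborel \<Otimes>\<^sub>M M) (\<lambda>(x, z). V x * f (x - h z))"
  proof (rule Fubini_integrable)
    show "(\<lambda>(x, z). V x * f (x - h z)) \<in> borel_measurable (lborel \<Otimes>\<^sub>M M)" by measurable
    show "integrable lborel (\<lambda>x. LINT z|M. norm (case (x, z) of (x, z) \<Rightarrow> V x * f (x - h z)))"
    proof (rule Bochner_Integration.integrable_bound[OF integrable_mult_left[OF V, of "C * measure M UNIV"]])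
      show "AE x in lborel. norm (LINT z|M. norm (case (x, z) of (x, z) \<Rightarrow> V x * f (x - h z))) \<le> norm (V x * (C * measure M UNIV))"
      proof (intro AE_I2)
        fix x :: real
        have "(LINT z|M. \<bar>V x * f (x - h z)\<bar>) \<le> (LINT z|M. \<bar>V x\<bar> * C)"
          using fi C by (intro integral_mono) (auto simp: abs_mult intro!: mult_left_mono)
        also have "\<dots> = \<bar>V x\<bar> * C * measure M UNIV" using finite_borel_measureD(3)[OF M] by simp
        finally show "norm (LINT z|M. norm (case (x, z) of (x, z) \<Rightarrow> V x * f (x - h z))) \<le> norm (V x * (C * measure M UNIV))"
          using C(1) by (simp add: abs_mult mult.assoc)
      qed
    qed measurable
    show "AE x in lborel. integrable M (\<lambda>z. case (x, z) of (x, z) \<Rightarrow> V x * f (x - h z))" using fi by simp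
  qed
  show "integrable lborel (\<lambda>x. V x * (LINT z|M. f (x - h z)))"
    using integrable_fst'[OF i] by simp
  show "(LINT x|lborel. V x * (LINT z|M. f (x - h z))) = (LINT z|M. LINT x|lborel. f (x - h z) * V x)"
    using Fubini_integral[OF i] by (simp add: mult.commute)
qed

lemma normalized_L1_tendsto:
  fixes a :: "nat \<Rightarrow> real"
  assumes u: "integrable lborel u" and v: "\<And>n. integrable lborel (v n)"
    and lim: "(\<lambda>n. LINT x|lborel. \<bar>v n x - u x\<bar>) \<longlonglongrightarrow> 0" and a: "a \<longlonglongrightarrow> 1"
  shows "(\<lambda>n. LINT x|lborel. \<bar>a n * v n x - u x\<bar>) \<longlonglongrightarrow> 0"
proof -
  have "(\<lambda>n. \<bar>a n\<bar> * (LINT x|lborel. \<bar>v n x - u x\<bar>) + \<bar>a n - 1\<bar> * (LINT x|lborel. \<bar>u x\<bar>))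
      \<longlonglongrightarrow> \<bar>1\<bar> * 0 + \<bar>1 - 1\<bar> * (LINT x|lborel. \<bar>u x\<bar>)"
    by (intro tendsto_add tendsto_mult tendsto_rabs tendsto_diff a lim tendsto_const)
  then have lim': "(\<lambda>n. \<bar>a n\<bar> * (LINT x|lborel. \<bar>v n x - u x\<bar>) + \<bar>a n - 1\<bar> * (LINT x|lborel. \<bar>u x\<bar>)) \<longlonglongrightarrow> 0"
    by simp
  have "(LINT x|lborel. \<bar>a n * v n x - u x\<bar>)
      \<le> \<bar>a n\<bar> * (LINT x|lborel. \<bar>v n x - u x\<bar>) + \<bar>a n - 1\<bar> * (LINT x|lborel. \<bar>u x\<bar>)" for n
  proof -
    have "(LINT x|lborel. \<bar>a n * v n x - u x\<bar>) \<le> (LINT x|lborel. \<bar>a n\<bar> * \<bar>v n x - u x\<bar> + \<bar>a n - 1\<bar> * \<bar>u x\<bar>)"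
    proof (rule integral_mono)
      show "\<bar>a n * v n x - u x\<bar> \<le> \<bar>a n\<bar> * \<bar>v n x - u x\<bar> + \<bar>a n - 1\<bar> * \<bar>u x\<bar>" for x
      proof -
        have "a n * v n x - u x = a n * (v n x - u x) + (a n - 1) * u x" by (simp add: algebra_simps)
        then show ?thesis using abs_triangle_ineq[of "a n * (v n x - u x)" "(a n - 1) * u x"] by (simp add: abs_mult)
      qed
    qed (use u v in auto)
    then show ?thesis using u v by simp
  qed
  then show ?thesis
    by (intro Lim_null_comparison[OF always_eventually lim'] allI) simp
qed

context shell begin

lemma W_nonneg: "profile R1 R2 v \<Longrightarrow> r \<in> {R1..R2} \<Longrightarrow> 0 \<le> W v r"
  by (rule order_trans[OF _ W_bounds(1)]) (use R1_pos in auto)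

lemma W_indicator_nonneg: "profile R1 R2 v \<Longrightarrow> 0 \<le> indicator {R1..R2} r * W v r"
  using W_nonneg[of v r] by (simp add: indicator_def)

definition mid :: real where "mid = (R1 + R2) / 2"
definition half :: real where "half = (R2 - R1) / 2"

lemma half_pos: "0 < half" using R12 by (simp add: half_def)

lemma mem_interval_iff: "x \<in> {R1..R2} \<longleftrightarrow> \<bar>x - mid\<bar> \<le> half"
  by (auto simp: mid_def half_def abs_le_iff field_simps)

lemma contraction_bound:
  assumes "z \<in> {R1..R2}" "0 \<le> l"
  shows "\<bar>mid + l * (z - mid) - mid\<bar> \<le> l * half"
proof -
  have "\<bar>z - mid\<bar> \<le> half" using assms(1) by (simp only: mem_interval_iff)
  then show ?thesis using assms(2) by (simp add: abs_mult mult_left_mono)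
qed

text \<open>Contracted points lie within (1 - t) * half of the midpoint and mollification moves them
  by less than t * half / 2. A margin of t * half / 2 to the endpoints remains, which gives compact
  support in the open interval.\<close>

lemma mollify_eq_0:
  assumes u: "\<And>z. z \<notin> {R1..R2} \<Longrightarrow> u z = 0" and t: "0 < t" "t < 1" and e: "0 < e" "e \<le> t * half / 2"
    and x: "(1 - t / 2) * half \<le> \<bar>x - mid\<bar>"
  shows "mollify mid (1 - t) e u x = 0"
proof -
  have z: "kern e (x - (mid + (1 - t) * (z - mid))) * u z = 0" for z
  proof (cases "z \<in> {R1..R2}")
    case True
    have "\<bar>mid + (1 - t) * (z - mid) - mid\<bar> \<le> (1 - t) * half" using True t by (intro contraction_bound) auto
    then have "e \<le> \<bar>x - (mid + (1 - t) * (z - mid))\<bar>" using x e(2) by (simp add: algebra_simps)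
    then show ?thesis using e by (simp add: kern_eq_0)
  qed (simp add: u)
  show ?thesis unfolding mollify_def smear_def z by simp
qed

lemma A_inftyI:
  assumes "smooth v" "\<And>x. 0 \<le> v x" "R1 < a" "b < R2" and v0: "\<And>x. x \<notin> {a..b} \<Longrightarrow> v x = 0"
    and "(LINT r|lborel. r\<^sup>2 * v r) = 1"
  shows "v \<in> A_infty R1 R2"
proof -
  have v0': "v x = 0" if "x \<notin> {R1..R2}" for x using that assms(3,4) by (intro v0) auto
  have "supp v \<subseteq> {a..b}" by (rule supp_subset) (use v0 in auto)
  then have "supp v \<subseteq> {R1<..<R2}" using assms(3,4) by auto
  moreover have [measurable]: "v \<in> borel_measurable borel" using assms(1) by (rule smooth_borel_measurable)
  have "(LINT r:{R1..R2}|lebesgue. r\<^sup>2 * v r) = (LINT r|lborel. indicator {R1..R2} r *\<^sub>R (r\<^sup>2 * v r))"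
    unfolding set_lebesgue_integral_def by (rule integral_completion) measurable
  moreover have "(LINT r|lborel. indicator {R1..R2} r *\<^sub>R (r\<^sup>2 * v r)) = (LINT r|lborel. r\<^sup>2 * v r)"
    using v0' by (intro Bochner_Integration.integral_cong) (auto simp: indicator_def)
  ultimately show ?thesis using assms by (simp add: A_infty_def)
qed

text \<open>The average of the weight around the contracted image of z, that is, the adjoint of
  mollification applied to the weight of u. The indicator is there because \<open>W\<close> is
  controlled only on [R1, R2].\<close>

definition averaged_weight :: "(real \<Rightarrow> real) \<Rightarrow> real \<Rightarrow> real \<Rightarrow> real \<Rightarrow> real" where
  "averaged_weight u l e z = (LINT s|lborel. bump s *
     (indicator {R1..R2} (mid + l * (z - mid) + e * s) * W u (mid + l * (z - mid) + e * s)))"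

context
  fixes u
  assumes u: "profile R1 R2 u"
begin

lemma averaged_weight_measurable: "averaged_weight u l e \<in> borel_measurable borel"
proof -
  note [measurable] = W_indicator_measurable[OF u] test_function_borel_measurable[OF test_function_bump]
  have "(\<lambda>z. LINT s|lborel. bump s *
     ((\<lambda>r. indicator {R1..R2} r * W u r) (mid + l * (z - mid) + e * s))) \<in> borel_measurable borel" by measurable
  then show ?thesis unfolding averaged_weight_def[abs_def] by simp
qed

lemma integrable_bump_weight:
  "integrable lborel (\<lambda>s. bump s * (indicator {R1..R2} (p + q * s) * W u (p + q * s)))"
proof (rule Bochner_Integration.integrable_bound[OF integrable_mult_right[OF integrable_bump, of "R2 ^ 3 / sqrt F_lower"]])
  note [measurable] = W_indicator_measurable[OF u] test_function_borel_measurable[OF test_function_bump]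
  have "(\<lambda>s. bump s * ((\<lambda>r. indicator {R1..R2} r * W u r) (p + q * s))) \<in> borel_measurable lborel" by measurable
  then show "(\<lambda>s. bump s * (indicator {R1..R2} (p + q * s) * W u (p + q * s))) \<in> borel_measurable lborel" by simp
  show "AE s in lborel. norm (bump s * (indicator {R1..R2} (p + q * s) * W u (p + q * s))) \<le> norm (R2 ^ 3 / sqrt F_lower * bump s)"
  proof (intro AE_I2)
    fix s
    have "\<bar>bump s * (indicator {R1..R2} (p + q * s) * W u (p + q * s))\<bar> = bump s * \<bar>indicator {R1..R2} (p + q * s) * W u (p + q * s)\<bar>"
      using bump_nonneg[of s] by (simp add: abs_mult)
    also have "\<dots> \<le> bump s * (R2 ^ 3 / sqrt F_lower)"
      by (rule mult_left_mono[OF W_indicator_bound[OF u] bump_nonneg])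
    also have "\<dots> = R2 ^ 3 / sqrt F_lower * bump s" by (rule mult.commute)
    also have "\<dots> \<le> \<bar>R2 ^ 3 / sqrt F_lower * bump s\<bar>" by (rule abs_ge_self)
    finally show "norm (bump s * (indicator {R1..R2} (p + q * s) * W u (p + q * s))) \<le> norm (R2 ^ 3 / sqrt F_lower * bump s)"
      by simp
  qed
qed

lemma averaged_weight_bound: "\<bar>averaged_weight u l e z\<bar> \<le> R2 ^ 3 / sqrt F_lower"
proof -
  let ?f = "\<lambda>s. bump s * (indicator {R1..R2} (mid + l * (z - mid) + e * s) * W u (mid + l * (z - mid) + e * s))"
  have "\<bar>averaged_weight u l e z\<bar> \<le> (LINT s|lborel. \<bar>?f s\<bar>)"
    unfolding averaged_weight_def by (rule integral_abs_bound)
  also have "\<dots> \<le> (LINT s|lborel. bump s * (R2 ^ 3 / sqrt F_lower))"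
  proof (rule integral_mono)
    show "integrable lborel (\<lambda>s. \<bar>?f s\<bar>)" by (rule integrable_abs[OF integrable_bump_weight])
    show "integrable lborel (\<lambda>s. bump s * (R2 ^ 3 / sqrt F_lower))" by (rule integrable_mult_left[OF integrable_bump])
    show "\<bar>?f s\<bar> \<le> bump s * (R2 ^ 3 / sqrt F_lower)" for s
      using mult_left_mono[OF W_indicator_bound[OF u, of "mid + l * (z - mid) + e * s"] bump_nonneg[of s]] bump_nonneg[of s]
      by (simp only: abs_mult abs_of_nonneg)
  qed
  also have "\<dots> = R2 ^ 3 / sqrt F_lower" by (simp add: integral_bump)
  finally show ?thesis .
qed

lemma averaged_weight_nonneg: "0 \<le> averaged_weight u l e z"
  unfolding averaged_weight_def
  by (intro integral_nonneg_AE AE_I2 mult_nonneg_nonneg[OF bump_nonneg W_indicator_nonneg[OF u]])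

text \<open>For z in [R1, R2], endpoints included, the bound on e keeps all sample points in the
  interval, so the indicator cuts nothing off and continuity of W on the closed interval suffices.
  Without contraction an endpoint would lose the part of the average lying outside. For z outside,
  the sample points are eventually outside as well.\<close>

lemma averaged_weight_tendsto:
  assumes t: "t \<longlonglongrightarrow> 0" "\<And>n. 0 < t n" "\<And>n. t n < 1"
    and e: "e \<longlonglongrightarrow> 0" "\<And>n. 0 < e n" "\<And>n. e n \<le> t n * half / 2"
  shows "(\<lambda>n. averaged_weight u (1 - t n) (e n) z) \<longlonglongrightarrow> indicator {R1..R2} z * W u z"
proof -
  let ?V = "\<lambda>r. indicator {R1..R2} r * W u r"
  let ?y = "\<lambda>n s. mid + (1 - t n) * (z - mid) + e n * s"
  note [measurable] = W_indicator_measurable[OF u] test_function_borel_measurable[OF test_function_bump]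
  have y: "(\<lambda>n. ?y n s) \<longlonglongrightarrow> z" for s
  proof -
    have "(\<lambda>n. ?y n s) \<longlonglongrightarrow> mid + (1 - 0) * (z - mid) + 0 * s"
      by (intro tendsto_add tendsto_mult tendsto_diff tendsto_const t e)
    then show ?thesis by simp
  qed
  have "(\<lambda>n. bump s * ?V (?y n s)) \<longlonglongrightarrow> bump s * ?V z" for s
  proof (cases "\<bar>s\<bar> < 1")
    case True
    show ?thesis
    proof (rule tendsto_mult[OF tendsto_const])
      show "(\<lambda>n. ?V (?y n s)) \<longlonglongrightarrow> ?V z"
      proof (cases "z \<in> {R1..R2}")
        case z: True
        have mem: "?y n s \<in> {R1..R2}" for n
        proof -
          have "\<bar>mid + (1 - t n) * (z - mid) - mid\<bar> \<le> (1 - t n) * half"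
            using z t(3)[of n] by (intro contraction_bound) auto
          moreover have "\<bar>e n * s\<bar> \<le> e n"
            using True e(2)[of n] by (simp add: abs_mult mult_left_le)
          ultimately have "\<bar>?y n s - mid\<bar> \<le> (1 - t n) * half + t n * half / 2"
            using e(3)[of n] by linarith
          also have "\<dots> \<le> half" using half_pos t(2)[of n] by (simp add: algebra_simps)
          finally show ?thesis by (simp only: mem_interval_iff)
        qed
        have "(\<lambda>n. W u (?y n s)) \<longlonglongrightarrow> W u z"
          by (rule continuous_on_tendsto_compose[OF continuous_on_W[OF u] y z]) (use mem in simp)
        then show ?thesis using mem z by simp
      next
        case z: False
        have "\<forall>\<^sub>F n in sequentially. ?y n s \<in> - {R1..R2}"
          by (rule topological_tendstoD[OF y]) (use z in auto)
        then have "\<forall>\<^sub>F n in sequentially. ?V (?y n s) = 0"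
          by eventually_elim simp
        then show ?thesis using z by (simp add: tendsto_eventually)
      qed
    qed
  qed (simp add: bump_eq_0)
  then have "(\<lambda>n. LINT s|lborel. bump s * ?V (?y n s)) \<longlonglongrightarrow> (LINT s|lborel. bump s * ?V z)"
  proof (intro integral_dominated_convergence[where w="\<lambda>s. bump s * (R2 ^ 3 / sqrt F_lower)"])
    show "integrable lborel (\<lambda>s. bump s * (R2 ^ 3 / sqrt F_lower))" by (rule integrable_mult_left[OF integrable_bump])
    show "(\<lambda>s. bump s * ?V (?y n s)) \<in> borel_measurable lborel" for n
      by (rule borel_measurable_integrable[OF integrable_bump_weight])
    show "AE s in lborel. norm (bump s * ?V (?y n s)) \<le> bump s * (R2 ^ 3 / sqrt F_lower)" for n
    proof (intro AE_I2)
      fix s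
      show "norm (bump s * ?V (?y n s)) \<le> bump s * (R2 ^ 3 / sqrt F_lower)"
        using mult_left_mono[OF W_indicator_bound[OF u, of "?y n s"] bump_nonneg[of s]] bump_nonneg[of s]
        by (simp only: abs_mult abs_of_nonneg real_norm_def)
    qed
  qed (auto intro!: AE_I2)
  then show ?thesis by (simp add: averaged_weight_def integral_bump)
qed

text \<open>The competitor's own weight is first replaced by that of u at the price of delta, so
  that only the weight of u gets averaged. Dropping the N-part of the derivative bounds its positive
  part; a is the normalisation and 1 / l comes from the contraction.\<close>

lemma I_fun_mollify_le:
  assumes M: "finite_borel_measure M"
    and D: "\<And>\<phi>. test_function \<phi> \<Longrightarrow> (LINT x|lborel. u x * deriv \<phi> x) = - ((LINT x|M. \<phi> x) - (LINT x|N. \<phi> x))"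
    and "0 < e" "0 < l" "0 \<le> a" and v_eq: "v = (\<lambda>x. a * mollify mid l e u x)" and v: "v \<in> A_infty R1 R2"
    and \<delta>: "\<And>r. r \<in> {R1..R2} \<Longrightarrow> \<bar>W v r - W u r\<bar> \<le> \<delta>"
  shows "I_fun M1 M2 R1 R2 v \<le> a / l * ((LINT z|M. averaged_weight u l e z) + \<delta> * measure M UNIV)"
proof -
  let ?T = "\<lambda>z. mid + l * (z - mid)"
  let ?G = "\<lambda>x. LINT z|M. kern e (x - ?T z)"
  let ?V = "\<lambda>r. indicator {R1..R2} r * W u r"
  let ?V' = "\<lambda>r. indicator {R1..R2} r * (W u r + \<delta>)"
  have k: "test_function (kern e)" by (rule test_function_kern[OF \<open>0 < e\<close>])
  have u': "integrable lborel u" by (rule profileD(1)[OF u])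
  have [measurable]: "?T \<in> borel_measurable borel" by measurable
  have G0: "0 \<le> ?G x" for x using kern_nonneg[OF \<open>0 < e\<close>] by (intro integral_nonneg_AE AE_I2) auto
  have V'i: "integrable lborel ?V'"
    using borel_integrable_compact[of "{R1..R2}" "\<lambda>r. W u r + \<delta>"]
      continuous_on_add[OF continuous_on_W[OF u] continuous_on_const] by simp
  \<comment> \<open>Nonnegativity is read off from the assumed bound at the point R1.\<close>
  have \<delta>0: "0 \<le> \<delta>" using \<delta>[of R1] R12 by force
  have mollder: "(mollify mid l e u has_real_derivative deriv (mollify mid l e u) x) (at x)" for x
    unfolding mollify_def by (rule smooth_has_derivative[OF smooth_smear[OF k u']]) measurable
  have deriv_le: "max (deriv v x) 0 \<le> a / l * ?G x" for x
  proof -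
    have "deriv v x = a * deriv (mollify mid l e u) x"
      unfolding v_eq by (rule DERIV_imp_deriv[OF DERIV_cmult[OF mollder]])
    also have "\<dots> = a / l * (?G x - (LINT z|N. kern e (x - ?T z)))"
      by (simp add: deriv_mollify[OF u' \<open>0 < e\<close> \<open>0 < l\<close> D])
    also have "\<dots> \<le> a / l * ?G x"
      using kern_nonneg[OF \<open>0 < e\<close>] \<open>0 < l\<close> \<open>0 \<le> a\<close> by (intro mult_left_mono) (auto intro!: integral_nonneg_AE AE_I2)
    finally show ?thesis using G0[of x] \<open>0 < l\<close> \<open>0 \<le> a\<close> by simp
  qed
  note swap = smear_swap[OF M k V'i, of ?T]
  have "I_fun M1 M2 R1 R2 v = (LINT r|lborel. indicator {R1..R2} r * (W v r * max (deriv v r) 0))"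
    by (rule I_fun_lborel(1)[OF v])
  also have "\<dots> \<le> (LINT r|lborel. a / l * (?V' r * ?G r))"
  proof (rule integral_mono)
    show "integrable lborel (\<lambda>r. indicator {R1..R2} r * (W v r * max (deriv v r) 0))" by (rule I_fun_lborel(2)[OF v])
    show "integrable lborel (\<lambda>r. a / l * (?V' r * ?G r))" by (rule integrable_mult_right) (rule swap(1), measurable)
    show "indicator {R1..R2} r * (W v r * max (deriv v r) 0) \<le> a / l * (?V' r * ?G r)" for r
    proof (cases "r \<in> {R1..R2}")
      case True
      have "0 \<le> W v r" by (rule W_nonneg[OF A_infty_profile[OF v] True])
      then have "W v r * max (deriv v r) 0 \<le> (W u r + \<delta>) * (a / l * ?G r)"
        using \<delta>[OF True] deriv_le[of r] by (intro mult_mono) auto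
      then show ?thesis
        by (simp only: indicator_simps(1)[OF True] mult_1_left mult.left_commute[of "a / l"])
    qed simp
  qed
  also have "\<dots> = a / l * (LINT r|lborel. ?V' r * ?G r)" by (rule integral_mult_right_zero)
  also have "(LINT r|lborel. ?V' r * ?G r) = (LINT z|M. LINT x|lborel. kern e (x - ?T z) * ?V' x)"
    by (rule swap(2)) measurable
  also have "\<dots> = (LINT z|M. LINT s|lborel. bump s * ?V' (?T z + e * s))"
    by (simp only: integral_kern[OF \<open>0 < e\<close>])
  also have "\<dots> \<le> (LINT z|M. averaged_weight u l e z + \<delta>)"
  proof (rule integral_mono_AE')
    show "integrable M (\<lambda>z. averaged_weight u l e z + \<delta>)"
      using finite_borel_measureD(1)[OF M] integrable_bounded_finite_borel[OF M averaged_weight_measurable averaged_weight_bound]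
      by (auto intro: finite_measure.integrable_const)
    show "AE z in M. (LINT s|lborel. bump s * ?V' (?T z + e * s)) \<le> averaged_weight u l e z + \<delta>"
    proof (intro AE_I2)
      fix z
      \<comment> \<open>The indicator in front of delta is bounded by 1; since \<open>bump\<close>
        has integral 1 the extra term is exactly delta.\<close>
      have "(LINT s|lborel. bump s * ?V' (?T z + e * s)) \<le> (LINT s|lborel. bump s * ?V (?T z + e * s) + bump s * \<delta>)"
      proof (rule integral_mono_AE')
        show "integrable lborel (\<lambda>s. bump s * ?V (?T z + e * s) + bump s * \<delta>)"
          by (intro Bochner_Integration.integrable_add integrable_bump_weight integrable_mult_left integrable_bump)
        show "AE s in lborel. bump s * ?V' (?T z + e * s) \<le> bump s * ?V (?T z + e * s) + bump s * \<delta>"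
          using bump_nonneg \<delta>0 by (intro AE_I2) (auto simp: indicator_def algebra_simps)
        show "AE s in lborel. 0 \<le> bump s * ?V (?T z + e * s) + bump s * \<delta>"
          by (intro AE_I2 add_nonneg_nonneg mult_nonneg_nonneg[OF bump_nonneg W_indicator_nonneg[OF u]]
              mult_nonneg_nonneg[OF bump_nonneg \<delta>0])
      qed
      also have "\<dots> = averaged_weight u l e z + \<delta>"
        using integrable_bump_weight[of "?T z" e] integrable_bump by (simp add: averaged_weight_def integral_bump)
      finally show "(LINT s|lborel. bump s * ?V' (?T z + e * s)) \<le> averaged_weight u l e z + \<delta>" .
    qed
    show "AE z in M. 0 \<le> averaged_weight u l e z + \<delta>"
      using averaged_weight_nonneg \<delta>0 by (intro AE_I2 add_nonneg_nonneg)
  qed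
  also have "\<dots> = (LINT z|M. averaged_weight u l e z) + \<delta> * measure M UNIV"
    using finite_borel_measureD[OF M] integrable_bounded_finite_borel[OF M averaged_weight_measurable averaged_weight_bound]
    by (simp add: finite_measure.integrable_const)
  finally show ?thesis using \<open>0 < l\<close> \<open>0 \<le> a\<close> by (simp add: mult_left_mono divide_right_mono)
qed

end

end

context shell begin

context
  fixes u
  assumes u: "profile R1 R2 u"
begin

lemma normalized_mollify_A_infty:
  assumes t: "0 < t" "t < 1" and e: "0 < e" "e \<le> t * half / 2"
    and mass: "0 < (LINT r|lborel. r\<^sup>2 * mollify mid (1 - t) e u r)"
  shows "(\<lambda>x. 1 / (LINT r|lborel. r\<^sup>2 * mollify mid (1 - t) e u r) * mollify mid (1 - t) e u x) \<in> A_infty R1 R2"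
proof (rule A_inftyI)
  let ?m = "LINT r|lborel. r\<^sup>2 * mollify mid (1 - t) e u r"
  let ?a = "mid - (1 - t / 2) * half" and ?b = "mid + (1 - t / 2) * half"
  have "(1 - t / 2) * half < 1 * half" using t half_pos by (intro mult_strict_right_mono) auto
  moreover have "R1 = mid - half" "R2 = mid + half" by (simp_all add: mid_def half_def field_simps)
  ultimately show "R1 < ?a" "?b < R2" by simp_all
  have "smooth (mollify mid (1 - t) e u)"
    unfolding mollify_def
    by (rule smooth_smear[OF test_function_kern[OF e(1)] profileD(1)[OF u]]) measurable
  then show "smooth (\<lambda>x. 1 / ?m * mollify mid (1 - t) e u x)" by (intro smooth_mult smooth_const)
  have "0 \<le> mollify mid (1 - t) e u x" for x
    unfolding mollify_def smear_def using kern_nonneg[OF e(1)] profileD(2)[OF u]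
    by (intro integral_nonneg_AE AE_I2 mult_nonneg_nonneg)
  then show "0 \<le> 1 / ?m * mollify mid (1 - t) e u x" for x using mass by simp
  show "1 / ?m * mollify mid (1 - t) e u x = 0" if "x \<notin> {?a..?b}" for x
  proof -
    have "(1 - t / 2) * half \<le> \<bar>x - mid\<bar>" using that by auto
    then have "mollify mid (1 - t) e u x = 0" using profileD(3)[OF u] t e by (intro mollify_eq_0)
    then show ?thesis by simp
  qed
  have "(LINT r|lborel. r\<^sup>2 * (1 / ?m * mollify mid (1 - t) e u r)) = (LINT r|lborel. 1 / ?m * (r\<^sup>2 * mollify mid (1 - t) e u r))"
    by (simp only: mult.left_commute)
  also have "\<dots> = 1 / ?m * ?m" by (rule integral_mult_right_zero)
  also have "\<dots> = 1" using mass by simp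
  finally show "(LINT r|lborel. r\<^sup>2 * (1 / ?m * mollify mid (1 - t) e u r)) = 1" .
qed

text \<open>On [R1, R2] the factor r^2 is bounded by R2^2, so L^1 convergence carries the
  normalisation to the limit.\<close>

lemma mass_tendsto:
  assumes v: "\<And>n. integrable lborel (v n)" "\<And>n x. x \<notin> {R1..R2} \<Longrightarrow> v n x = 0"
    and lim: "(\<lambda>n. LINT x|lborel. \<bar>v n x - u x\<bar>) \<longlonglongrightarrow> 0"
  shows "(\<lambda>n. LINT r|lborel. r\<^sup>2 * v n r) \<longlonglongrightarrow> 1"
proof -
  have "\<bar>(LINT r|lborel. r\<^sup>2 * v n r) - 1\<bar> \<le> R2\<^sup>2 * (LINT x|lborel. \<bar>v n x - u x\<bar>)" for n
  proof -
    have "(LINT r|lborel. r\<^sup>2 * v n r) - 1 = (LINT r|lborel. indicator UNIV r * (r\<^sup>2 * (v n r - u r)))"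
      using integrable_moment[OF v(1) v(2), of n] integrable_moment[OF profileD(1,3)[OF u]] profileD(4)[OF u]
      by (simp add: right_diff_distrib)
    also have "\<bar>\<dots>\<bar> \<le> R2\<^sup>2 * (LINT x|lborel. \<bar>v n x - u x\<bar>)"
      using v profileD(1,3)[OF u] by (intro moment_abs_le) auto
    finally show ?thesis .
  qed
  then have "(\<lambda>n. (LINT r|lborel. r\<^sup>2 * v n r) - 1) \<longlonglongrightarrow> 0"
    by (intro Lim_null_comparison[OF always_eventually tendsto_mult_right_zero[OF lim, of "R2\<^sup>2"]] allI) simp
  then show ?thesis by (simp add: LIM_zero_iff)
qed

text \<open>The explicit bound B gives the upper estimate in the limit; the lower estimate is
  \<open>eventually_lower_bound\<close> applied to this very sequence. Together they give
  convergence of the energies, not just a bound on the limsup.\<close>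

lemma recovery_sequence:
  assumes M: "finite_borel_measure M" and N: "finite_borel_measure N" and sing: "mutually_singular M N"
    and D: "\<And>\<phi>. test_function \<phi> \<Longrightarrow> (LINT x|lborel. u x * deriv \<phi> x) = - ((LINT x|M. \<phi> x) - (LINT x|N. \<phi> x))"
  obtains un where "\<And>n. un n \<in> A_infty R1 R2" "(\<lambda>n. LINT x|lborel. \<bar>un n x - u x\<bar>) \<longlonglongrightarrow> 0"
    "(\<lambda>n. I_fun M1 M2 R1 R2 (un n)) \<longlonglongrightarrow> (LINT r|M. indicator {R1..R2} r * W u r)"
proof -
  \<comment> \<open>The shift by 2 gives t0 <= 1 / 2, hence the lower bound 1 / 2 on the contraction
    factor that the L^1 convergence asks for. In \<open>e0\<close> the entry half / 2 keeps the
    mollified support inside, and the entry 1 bounds the width.\<close>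
  define t0 where "t0 n = 1 / real (n + 2)" for n
  define e0 where "e0 n = t0 n * min (half / 2) 1" for n
  have t0: "t0 \<longlonglongrightarrow> 0" "\<And>n. 0 < t0 n" "\<And>n. t0 n \<le> 1 / 2"
  proof -
    show "t0 \<longlonglongrightarrow> 0"
      unfolding t0_def using LIMSEQ_ignore_initial_segment[OF lim_1_over_n, of 2] by simp
    show "0 < t0 n" "t0 n \<le> 1 / 2" for n by (simp_all add: t0_def field_simps)
  qed
  have e0: "e0 \<longlonglongrightarrow> 0" "\<And>n. 0 < e0 n" "\<And>n. e0 n \<le> 1" "\<And>n. e0 n \<le> t0 n * half / 2"
  proof -
    show "e0 \<longlonglongrightarrow> 0" unfolding e0_def by (rule tendsto_mult_left_zero[OF t0(1)])
    show "0 < e0 n" for n using t0(2)[of n] half_pos by (simp add: e0_def)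
    have "t0 n * min (half / 2) 1 \<le> 1 * 1" for n
      using t0(2,3)[of n] half_pos by (intro mult_mono) auto
    then show "e0 n \<le> 1" for n by (simp add: e0_def)
    have "t0 n * min (half / 2) 1 \<le> t0 n * (half / 2)" for n
      using t0(2)[of n] by (intro mult_left_mono) auto
    then show "e0 n \<le> t0 n * half / 2" for n by (simp add: e0_def)
  qed
  have l0: "(\<lambda>n. 1 - t0 n) \<longlonglongrightarrow> 1" using tendsto_diff[OF tendsto_const[of 1] t0(1)] by simp
  define v0 where "v0 n = mollify mid (1 - t0 n) (e0 n) u" for n
  have v0_lim: "(\<lambda>n. LINT x|lborel. \<bar>v0 n x - u x\<bar>) \<longlonglongrightarrow> 0"
    unfolding v0_def
    using t0 by (intro mollify_L1_tendsto profileD(1)[OF u] l0 e0) (auto simp: less_imp_le)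
  have v0_int: "integrable lborel (v0 n)" for n
    unfolding v0_def mollify_def using e0(2)[of n]
    by (intro smear_contraction(1) test_function_kern kern_nonneg integral_kern_1 profileD(1)[OF u]) auto
  have v0_zero: "v0 n x = 0" if "x \<notin> {R1..R2}" for n x
    unfolding v0_def
  proof (rule mollify_eq_0)
    have "(1 - t0 n / 2) * half \<le> 1 * half" using t0(2)[of n] half_pos by (intro mult_right_mono) auto
    moreover have "half < \<bar>x - mid\<bar>" using that by (simp only: mem_interval_iff not_le)
    ultimately show "(1 - t0 n / 2) * half \<le> \<bar>x - mid\<bar>" by simp
  qed (use t0(2,3)[of n] e0(2,4)[of n] profileD(3)[OF u] in auto)
  define m0 where "m0 n = (LINT r|lborel. r\<^sup>2 * v0 n r)" for n
  have m0_lim: "m0 \<longlonglongrightarrow> 1" unfolding m0_def by (rule mass_tendsto[OF v0_int v0_zero v0_lim])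
  \<comment> \<open>The mass is known to be positive only from some index k on, while every member
    of the sequence must be normalised; hence the shift by k below.\<close>
  from order_tendstoD(1)[OF this, of 0] obtain k where k: "\<And>n. n \<ge> k \<Longrightarrow> 0 < m0 n"
    by (auto simp: eventually_sequentially)
  define t where "t n = t0 (n + k)" for n
  define e where "e n = e0 (n + k)" for n
  define a where "a n = 1 / m0 (n + k)" for n
  define un where "un n = (\<lambda>x. a n * mollify mid (1 - t n) (e n) u x)" for n
  have t: "t \<longlonglongrightarrow> 0" "\<And>n. 0 < t n" "\<And>n. t n < 1"
  proof -
    show "t \<longlonglongrightarrow> 0" unfolding t_def by (rule LIMSEQ_ignore_initial_segment[OF t0(1)])
    show "0 < t n" "t n < 1" for n using t0(2,3)[of "n + k"] by (simp_all add: t_def)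
  qed
  have e: "e \<longlonglongrightarrow> 0" "\<And>n. 0 < e n" "\<And>n. e n \<le> t n * half / 2"
    using LIMSEQ_ignore_initial_segment[OF e0(1), of k] e0(2,4) unfolding e_def t_def by auto
  have a: "a \<longlonglongrightarrow> 1" "\<And>n. 0 \<le> a n"
  proof -
    have "a \<longlonglongrightarrow> 1 / 1"
      unfolding a_def by (intro tendsto_divide tendsto_const LIMSEQ_ignore_initial_segment[OF m0_lim]) simp
    then show "a \<longlonglongrightarrow> 1" by simp
    show "0 \<le> a n" for n using k[of "n + k"] by (simp add: a_def)
  qed
  have un: "un n \<in> A_infty R1 R2" for n
  proof -
    have "0 < (LINT r|lborel. r\<^sup>2 * mollify mid (1 - t n) (e n) u r)"
      using k[of "n + k"] by (simp add: m0_def v0_def t_def e_def)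
    from normalized_mollify_A_infty[OF t(2,3) e(2,3) this]
    show ?thesis by (simp add: un_def a_def m0_def v0_def t_def e_def)
  qed
  have un_lim: "(\<lambda>n. LINT x|lborel. \<bar>un n x - u x\<bar>) \<longlonglongrightarrow> 0"
    using normalized_L1_tendsto[OF profileD(1)[OF u] v0_int[of "_ + k"] LIMSEQ_ignore_initial_segment[OF v0_lim, of k] a(1)]
    by (simp add: un_def v0_def t_def e_def)
  obtain K where K: "0 < K" "\<And>v w r. profile R1 R2 v \<Longrightarrow> profile R1 R2 w \<Longrightarrow> r \<in> {R1..R2} \<Longrightarrow>
    \<bar>W v r - W w r\<bar> \<le> K * (LINT x|lborel. \<bar>v x - w x\<bar>)" by (rule W_lipschitz) blast
  let ?J = "LINT r|M. indicator {R1..R2} r * W u r"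
  define B where "B n = a n / (1 - t n) * ((LINT z|M. averaged_weight u (1 - t n) (e n) z) +
      K * (LINT x|lborel. \<bar>un n x - u x\<bar>) * measure M UNIV)" for n
  have le: "I_fun M1 M2 R1 R2 (un n) \<le> B n" for n
    unfolding B_def
  proof (rule I_fun_mollify_le[OF u M D])
    show "\<bar>W (un n) r - W u r\<bar> \<le> K * (LINT x|lborel. \<bar>un n x - u x\<bar>)" if "r \<in> {R1..R2}" for r
      by (rule K(2)[OF A_infty_profile[OF un] u that])
  qed (use t(3)[of n] e(2)[of n] a(2)[of n] un in \<open>auto simp: un_def\<close>)
  have avg: "(\<lambda>n. LINT z|M. averaged_weight u (1 - t n) (e n) z) \<longlonglongrightarrow> ?J"
    by (rule integral_tendsto_bounded[OF M averaged_weight_measurable[OF u] W_indicator_measurable[OF u]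
        averaged_weight_bound[OF u] averaged_weight_tendsto[OF u t e]])
  have "B \<longlonglongrightarrow> 1 / (1 - 0) * (?J + 0 * measure M UNIV)"
    unfolding B_def
    by (intro tendsto_mult tendsto_divide tendsto_add tendsto_diff tendsto_const a(1) t(1) avg
        tendsto_mult_right_zero[OF un_lim]) simp
  then have B: "B \<longlonglongrightarrow> ?J" by simp
  have "(\<lambda>n. I_fun M1 M2 R1 R2 (un n)) \<longlonglongrightarrow> ?J"
  proof (rule order_tendstoI)
    fix y assume "y < ?J"
    then show "\<forall>\<^sub>F n in sequentially. y < I_fun M1 M2 R1 R2 (un n)"
      using eventually_lower_bound[OF u M N sing D un un_lim, of "?J - y"] by simp
  next
    fix y assume "?J < y"
    from order_tendstoD(2)[OF B this] show "\<forall>\<^sub>F n in sequentially. I_fun M1 M2 R1 R2 (un n) < y"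
      by eventually_elim (use le le_less_trans in blast)
  qed
  then show ?thesis by (rule that[OF un un_lim])
qed

end

end

section \<open>Borel representatives and the relaxed functional\<close>

lemma BV_profile_representative:
  assumes u: "u \<in> A_BV R1 R2"
  obtains v where "profile R1 R2 v" "AE x in lebesgue. u x = v x"
proof -
  have ui: "integrable lebesgue u" using u by (simp add: A_BV_def BV_def)
  obtain g where g: "g \<in> borel_measurable lborel" "AE x in lborel. u x = g x"
    using completion_ex_borel_measurable_real[OF borel_measurable_integrable[OF ui]] by blast
  \<comment> \<open>Truncating a Borel version by the indicator and by 0 turns the almost-everywhere
    constraints into pointwise ones and changes it only on a null set.\<close>
  define v where "v x = indicator {R1..R2} x * max (g x) 0" for x
  have [measurable]: "v \<in> borel_measurable borel" using g(1) unfolding v_def by measurable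
  have "AE x in lebesgue. u x \<ge> 0" "AE x in lebesgue. x \<notin> {R1..R2} \<longrightarrow> u x = 0" "AE x in lebesgue. u x = g x"
    using u AE_completion[OF g(2)] by (auto simp: A_BV_def)
  then have uv: "AE x in lebesgue. u x = v x"
  proof eventually_elim
    case (elim x)
    then show ?case by (cases "x \<in> {R1..R2}") (auto simp: v_def)
  qed
  have vl: "v \<in> borel_measurable lebesgue" by (rule measurable_completion) measurable
  have "integrable lebesgue v" by (rule integrable_cong_AE_imp[OF ui vl uv])
  then have "integrable lborel v" by (subst (asm) integrable_completion) measurable
  moreover have "(LINT r|lborel. r\<^sup>2 * v r) = 1"
  proof -
    have "(LINT r|lborel. r\<^sup>2 * v r) = (LINT r|lebesgue. r\<^sup>2 * v r)"
      by (rule integral_completion[symmetric]) measurable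
    also have "\<dots> = (LINT r:{R1..R2}|lebesgue. r\<^sup>2 * u r)"
      unfolding set_lebesgue_integral_def
    proof (rule integral_cong_AE)
      show "(\<lambda>r. r\<^sup>2 * v r) \<in> borel_measurable lebesgue" by (rule measurable_completion) measurable
      have "(\<lambda>x :: real. x\<^sup>2) \<in> borel_measurable lebesgue" "(\<lambda>x. indicator {R1..R2} x :: real) \<in> borel_measurable lebesgue"
        by (rule measurable_completion, measurable)+
      then show "(\<lambda>x. indicator {R1..R2} x *\<^sub>R (x\<^sup>2 * u x)) \<in> borel_measurable lebesgue"
        using borel_measurable_integrable[OF ui] by measurable
      show "AE x in lebesgue. x\<^sup>2 * v x = indicator {R1..R2} x *\<^sub>R (x\<^sup>2 * u x)"
        using uv by eventually_elim (auto simp: v_def indicator_def)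
    qed
    also have "\<dots> = 1" using u by (simp add: A_BV_def)
    finally show ?thesis .
  qed
  ultimately have "profile R1 R2 v" by (auto simp: profile_def v_def)
  then show ?thesis using uv by (rule that)
qed

lemma integral_lebesgue_representative:
  fixes f g :: "real \<Rightarrow> real"
  assumes f: "f \<in> borel_measurable lebesgue" and g[measurable]: "g \<in> borel_measurable borel" and eq: "AE x in lebesgue. f x = g x"
  shows "(LINT x|lebesgue. f x) = (LINT x|lborel. g x)"
proof -
  have "(LINT x|lebesgue. f x) = (LINT x|lebesgue. g x)"
    by (rule integral_cong_AE[OF f measurable_completion eq]) measurable
  then show ?thesis by (simp add: integral_completion)
qed

theorem theorem3p6:
  fixes M1 M2 R1 R2 :: real and u :: "real \<Rightarrow> real"
  assumes "0 < M1" and "M1 < M2" and "2 * M2 < R1" and "R1 < R2"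
    and "u \<in> A_BV R1 R2"
  shows "I_rel M1 M2 R1 R2 u = ereal (J_fun M1 M2 R1 R2 u)
    \<and> approximants R1 R2 u \<noteq> {}
    \<and> \<bar>I_rel M1 M2 R1 R2 u\<bar> \<noteq> \<infinity>
    \<and> (\<exists>un. (\<forall>n. un n \<in> A_infty R1 R2) \<and> L1_converges un u
          \<and> (\<lambda>n. I_fun M1 M2 R1 R2 (un n)) \<longlonglongrightarrow> J_fun M1 M2 R1 R2 u)"
proof -
  interpret shell M1 M2 R1 R2 using assms by unfold_locales
  have uBV: "u \<in> BV" and ui: "integrable lebesgue u" using assms(5) by (auto simp: A_BV_def BV_def)
  note um = borel_measurable_integrable[OF ui]
  obtain v where v: "profile R1 R2 v" and uv: "AE x in lebesgue. u x = v x"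
    using BV_profile_representative[OF assms(5)] by blast
  note [measurable] = profile_measurable[OF v]
  have leb: "f \<in> borel_measurable lebesgue" if "f \<in> borel_measurable borel" for f :: "real \<Rightarrow> real"
    using that by (intro measurable_completion) simp
  let ?M = "pos_part (Du u)" and ?N = "neg_part (Du u)"
  have dd: "distributional_derivative u (Du u)" by (rule distributional_derivative_Du[OF uBV])
  then have "jordan_decomposition (Du u) ?M ?N"
    by (intro jordan_decomposition_parts) (simp add: distributional_derivative_def)
  then have M: "finite_borel_measure ?M" and N: "finite_borel_measure ?N" and sing: "mutually_singular ?M ?N"
    by (auto simp: jordan_decomposition_def)
  have D: "(LINT x|lborel. v x * deriv \<phi> x) = - ((LINT x|?M. \<phi> x) - (LINT x|?N. \<phi> x))" if \<phi>: "test_function \<phi>" for \<phi>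
  proof -
    have d: "deriv \<phi> \<in> borel_measurable borel"
      by (rule test_function_borel_measurable[OF test_function_deriv[OF \<phi>]])
    have "(LINT x|lebesgue. u x * deriv \<phi> x) = (LINT x|lborel. v x * deriv \<phi> x)"
    proof (rule integral_lebesgue_representative)
      show "(\<lambda>x. u x * deriv \<phi> x) \<in> borel_measurable lebesgue" by (intro borel_measurable_times um leb d)
      show "(\<lambda>x. v x * deriv \<phi> x) \<in> borel_measurable borel" using d by measurable
      show "AE x in lebesgue. u x * deriv \<phi> x = v x * deriv \<phi> x" using uv by eventually_elim simp
    qed
    then show ?thesis using dd \<phi> by (simp add: distributional_derivative_def signed_integral_def)
  qed
  \<comment> \<open>Equality at every r matters here: the weight is integrated against (Du)^+, which
    may charge Lebesgue-null sets, so almost-everywhere equality would not do.\<close>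
  have P_eq: "P_fun R1 u = P_fun R1 v"
  proof
    fix r
    have "P_fun R1 u r = (LINT s|lborel. indicator {R1..r} s *\<^sub>R (s\<^sup>2 * v s))"
      unfolding P_fun_def set_lebesgue_integral_def
    proof (rule integral_lebesgue_representative)
      show "(\<lambda>s. indicator {R1..r} s *\<^sub>R (s\<^sup>2 * u s)) \<in> borel_measurable lebesgue"
        by (intro borel_measurable_scaleR borel_measurable_times um leb) measurable
      show "AE s in lebesgue. indicator {R1..r} s *\<^sub>R (s\<^sup>2 * u s) = indicator {R1..r} s *\<^sub>R (s\<^sup>2 * v s)"
        using uv by eventually_elim simp
    qed measurable
    then show "P_fun R1 u r = P_fun R1 v r" by (simp add: P_lborel[OF profile_measurable[OF v]])
  qed
  let ?J = "LINT r|?M. indicator {R1..R2} r * W v r"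
  have J: "J_fun M1 M2 R1 R2 u = ?J"
    by (simp add: J_fun_def set_lebesgue_integral_def W_def F_fun_def m_fun_def P_eq)
  have L1: "L1_converges un u \<longleftrightarrow> (\<lambda>n. LINT x|lborel. \<bar>un n x - v x\<bar>) \<longlonglongrightarrow> 0" if un: "\<And>n. un n \<in> A_infty R1 R2" for un
  proof -
    have "(LINT x|lebesgue. \<bar>un n x - u x\<bar>) = (LINT x|lborel. \<bar>un n x - v x\<bar>)" for n
    proof (rule integral_lebesgue_representative)
      have m: "un n \<in> borel_measurable borel" by (rule profile_measurable[OF A_infty_profile[OF un]])
      show "(\<lambda>x. \<bar>un n x - u x\<bar>) \<in> borel_measurable lebesgue" by (intro borel_measurable_abs borel_measurable_diff um leb m)
      show "(\<lambda>x. \<bar>un n x - v x\<bar>) \<in> borel_measurable borel" using m by measurable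
      show "AE x in lebesgue. \<bar>un n x - u x\<bar> = \<bar>un n x - v x\<bar>" using uv by eventually_elim simp
    qed
    then show ?thesis by (simp add: L1_converges_def)
  qed
  obtain un where un: "\<And>n. un n \<in> A_infty R1 R2" "(\<lambda>n. LINT x|lborel. \<bar>un n x - v x\<bar>) \<longlonglongrightarrow> 0"
    "(\<lambda>n. I_fun M1 M2 R1 R2 (un n)) \<longlonglongrightarrow> ?J"
    using recovery_sequence[OF v M N sing D] by blast
  have approx: "un \<in> approximants R1 R2 u" using un L1[OF un(1)] by (simp add: approximants_def)
  have "I_rel M1 M2 R1 R2 u = ereal ?J"
  proof (rule antisym)
    have "I_rel M1 M2 R1 R2 u \<le> liminf (\<lambda>n. ereal (I_fun M1 M2 R1 R2 (un n)))"
      unfolding I_rel_def using approx by (rule INF_lower)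
    also have "\<dots> = ereal ?J"
      by (rule lim_imp_Liminf) (use un(3) in auto)
    finally show "I_rel M1 M2 R1 R2 u \<le> ereal ?J" .
    show "ereal ?J \<le> I_rel M1 M2 R1 R2 u"
      unfolding I_rel_def
    proof (rule INF_greatest)
      fix wn assume "wn \<in> approximants R1 R2 u"
      then have wn: "\<And>n. wn n \<in> A_infty R1 R2" "L1_converges wn u" by (auto simp: approximants_def)
      show "ereal ?J \<le> liminf (\<lambda>n. ereal (I_fun M1 M2 R1 R2 (wn n)))"
      proof (rule le_Liminf_iff[THEN iffD2], intro allI impI)
        fix y assume "y < ereal ?J"
        then show "\<forall>\<^sub>F n in sequentially. y < ereal (I_fun M1 M2 R1 R2 (wn n))"
        \<comment> \<open>Only real y carries content: infinity is excluded by y < J, and minus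
          infinity lies below every real energy.\<close>
        proof (cases y)
          case (real x)
          then show ?thesis
            using eventually_lower_bound[OF v M N sing D wn(1) L1[OF wn(1), THEN iffD1, OF wn(2)], of "?J - x"] \<open>y < ereal ?J\<close>
            by simp
        qed auto
      qed
    qed
  qed
  with J un approx show ?thesis by (auto simp: approximants_def)
qed

end
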